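(* Let $R,R_\mu,\eta$ be given positive parameters. There is a unique even solution $(F,G)\in\mathcal K^2\cap H^1(\mathbb R,\mathbb R^2)$ of (SS) with parameters $(R,R_\mu,\eta)$, which is given as follows ($F$ and $G$ vanish outside $\mathcal P_F$ and $\mathcal P_G$, respectively). (i) If $R_\mu=R_\mu^0(R,\eta)$, then $\mathcal P_F=\mathcal P_G=(-\beta,\beta)$ and $F(x)=G(x)=\frac{R_\mu-R}{6\eta^2R_\mu}(\beta^2-x^2)$ for $x\in(-\beta,\beta)$, where $\beta>0$ is defined by $\beta^3=\frac{9\eta^2R_\mu}{2(R_\mu-R)}$. (ii) If $R_\mu\in(R_\mu^0(R,\eta),R_\mu^+(R,\eta))$, then $\mathcal P_F=(-\beta,\beta)$, $\mathcal P_G=(-\gamma,\gamma)$, $$\eta^2F(x)=\frac{R_\mu-R}{6R_\mu}(\beta^2-x^2),\ |x|\le\beta,$$ $$G(x)=\begin{cases}\frac{\gamma^2}{6R_\mu}+\frac{R-R_\mu}{6R_\mu}\beta^2-\frac{1+R-R_\mu}{6R_\mu}x^2,&|x|\le\beta,\\ \frac1{6R_\mu}(\gamma^2-x^2),&\beta\le|x|\le\gamma,\end{cases}$$ where $0<\beta<\gamma$ are defined by $\beta^3=\frac{9\eta^2R_\mu}{2(R_\mu-R)}$ and $\gamma^3=\frac{9R_\mu}2(1+\eta^2)$. (iii) If $R_\mu\ge R_\mu^+(R,\eta)$, then $\mathcal P_F=(-\beta,\beta)$, $\mathcal P_G=(-\gamma,-\alpha)\cup(\alpha,\gamma)$, $$\eta^2F(x)=\begin{cases}\frac{R_\mu-R}{6R_\mu}\beta^2+\frac{R(1+R-R_\mu)}{6R_\mu(1+R)}\alpha^2-\frac{x^2}{6(1+R)},&|x|\le\alpha,\\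 \frac{R_\mu-R}{6R_\mu}(\beta^2-x^2),&\alpha\le|x|\le\beta,\end{cases}$$ $$G(x)=\begin{cases}\frac{1+R-R_\mu}{6R_\mu}(\alpha^2-x^2),&\alpha\le|x|\le\beta,\\ \frac1{6R_\mu}(\gamma^2-x^2),&\beta\le|x|\le\gamma,\end{cases}$$ where $0\le\alpha<\beta<\gamma$ is the solution of $$(R_\mu-R)\beta^3-\tfrac{R(R_\mu-R-1)}{1+R}\alpha^3=\tfrac{9\eta^2R_\mu}2,\quad \gamma^3-(R_\mu-R)\beta^3+(R_\mu-R-1)\alpha^3=\tfrac{9R_\mu}2,\quad \gamma^2-(R_\mu-R)\beta^2+(R_\mu-R-1)\alpha^2=0.$$ (iv) If $R_\mu\le R_\mu^-(R,\eta)$, then $\mathcal P_F=(-\gamma,-\alpha)\cup(\alpha,\gamma)$, $\mathcal P_G=(-\beta,\beta)$, $$\eta^2F(x)=\begin{cases}\frac{R_\mu-R}{6R_\mu}(\alpha^2-x^2),&\alpha\le|x|\le\beta,\\ \frac1{6(1+R)}(\gamma^2-x^2),&\beta\le|x|\le\gamma,\end{cases}$$ $$G(x)=\begin{cases}\frac{R_\mu-R}{6R_\mu}\alpha^2+\frac{1+R-R_\mu}{6R_\mu}\beta^2-\frac{x^2}{6R_\mu},&|x|\le\alpha,\\ \frac{1+R-R_\mu}{6R_\mu}(\beta^2-x^2),&\alpha\le|x|\le\beta,\end{cases}$$ where $0\le\alpha<\beta<\gamma$ is the solution of $$(1+R-R_\mu)\beta^3-(R-R_\mu)\alpha^3=\tfrac{9R_\mu}2,$$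 $$R_\mu\gamma^3-R(1+R-R_\mu)\beta^3+(1+R)(R-R_\mu)\alpha^3=\tfrac92R_\mu(1+R)\eta^2,$$ $$R_\mu\gamma^2-R(1+R-R_\mu)\beta^2+(1+R)(R-R_\mu)\alpha^2=0.$$ (v) If $R_\mu\in(R_\mu^-(R,\eta),R_\mu^0(R,\eta))$, then $\mathcal P_F=(-\gamma,\gamma)$, $\mathcal P_G=(-\beta,\beta)$, $$\eta^2F(x)=\begin{cases}\frac{\gamma^2}{6(1+R)}-\frac{R(1+R-R_\mu)}{6(1+R)R_\mu}\beta^2-\frac{R_\mu-R}{6R_\mu}x^2,&|x|\le\beta,\\ \frac1{6(1+R)}(\gamma^2-x^2),&\beta\le|x|\le\gamma,\end{cases}$$ $$G(x)=\frac{1+R-R_\mu}{6R_\mu}(\beta^2-x^2),\ |x|\le\beta,$$ where $0<\beta<\gamma$ are given by $\beta^3=\frac92\frac{R_\mu}{1+R-R_\mu}$ and $\gamma^3=\frac92((1+R)\eta^2+R)$.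
   Context: $\mathcal K:=\{w\in L_1(\mathbb R,(1+x^2)dx)\cap L_2(\mathbb R): w\ge0\text{ a.e. and }\|w\|_1=1\}$. A solution of (SS) with parameters $(R,R_\mu,\eta)$ is a pair $(F,G)\in\mathcal K^2\cap H^1(\mathbb R,\mathbb R^2)$ such that $$F\,\partial_x\big((1+R)\eta^2F+RG+x^2/6\big)=0,\qquad G\,\partial_x\big(R_\mu\eta^2F+R_\mu G+x^2/6\big)=0\qquad\text{a.e. in }\mathbb R.$$ It is even if both $F$ and $G$ are even. Positivity sets (for the continuous representatives): $\mathcal P_F:=\{x\in\mathbb R:F(x)>0\}$, $\mathcal P_G:=\{x\in\mathbb R:G(x)>0\}$; when $\alpha=0$ in (iii) (resp. (iv)), the set $(-\gamma,-\alpha)\cup(\alpha,\gamma)$ is $(-\gamma,0)\cup(0,\gamma)$. Thresholds: $R_\mu^0(R,\eta):=R+\frac{\eta^2}{1+\eta^2}$, $R_\mu^+(R,\eta):=R+\big(\frac{1+\eta^2}{\eta^2}\big)^2$, $R_\mu^-(R,\eta):=\frac{R^3(1+R)}{R^3+(\eta^2(1+R)+R)^2}$. *)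

theory Defs
  imports "HOL-Analysis.Analysis"
begin

(* Elements of the Lebesgue and Sobolev spaces on the real line are represented by functions;
   two functions represent the same element iff they agree almost everywhere. *)

definition in_L2 :: "(real \<Rightarrow> real) \<Rightarrow> bool" where
  "in_L2 f \<longleftrightarrow> f \<in> borel_measurable lebesgue \<and> integrable lebesgue (\<lambda>x. (f x)\<^sup>2)"

definition locally_L1 :: "(real \<Rightarrow> real) \<Rightarrow> bool" where
  "locally_L1 f \<longleftrightarrow> (\<forall>C. compact C \<longrightarrow> set_integrable lebesgue C f)"

definition test_function :: "(real \<Rightarrow> real) \<Rightarrow> bool" where
  "test_function \<phi> \<longleftrightarrow>
     (\<forall>n x. ((deriv ^^ n) \<phi>) differentiable (at x)) \<and> compact (closure {x. \<phi> x \<noteq> 0})"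

definition weak_deriv :: "(real \<Rightarrow> real) \<Rightarrow> (real \<Rightarrow> real) \<Rightarrow> bool" where
  "weak_deriv f g \<longleftrightarrow> locally_L1 f \<and> locally_L1 g \<and>
     (\<forall>\<phi>. test_function \<phi> \<longrightarrow>
        (\<integral>x. f x * deriv \<phi> x \<partial>lebesgue) = - (\<integral>x. g x * \<phi> x \<partial>lebesgue))"

definition in_H1 :: "(real \<Rightarrow> real) \<Rightarrow> bool" where
  "in_H1 f \<longleftrightarrow> in_L2 f \<and> (\<exists>g. in_L2 g \<and> weak_deriv f g)"

definition in_K :: "(real \<Rightarrow> real) \<Rightarrow> bool" where
  "in_K w \<longleftrightarrow>
     integrable (density lebesgue (\<lambda>x. ennreal (1 + x\<^sup>2))) w \<and> in_L2 w \<and>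
     (AE x in lebesgue. 0 \<le> w x) \<and> (\<integral>x. \<bar>w x\<bar> \<partial>lebesgue) = 1"

(* A weak derivative is unique up to null sets, so the choice of D1 and D2 is immaterial. *)
definition SS_solution ::
  "real \<Rightarrow> real \<Rightarrow> real \<Rightarrow> (real \<Rightarrow> real) \<Rightarrow> (real \<Rightarrow> real) \<Rightarrow> bool" where
  "SS_solution R R\<^sub>\<mu> \<eta> F G \<longleftrightarrow>
     in_K F \<and> in_K G \<and> in_H1 F \<and> in_H1 G \<and>
     (\<exists>D1. weak_deriv (\<lambda>x. (1 + R) * \<eta>\<^sup>2 * F x + R * G x + x\<^sup>2 / 6) D1 \<and>
           (AE x in lebesgue. F x * D1 x = 0)) \<and>
     (\<exists>D2. weak_deriv (\<lambda>x. R\<^sub>\<mu> * \<eta>\<^sup>2 * F x + R\<^sub>\<mu> * G x + x\<^sup>2 / 6) D2 \<and>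
           (AE x in lebesgue. G x * D2 x = 0))"

definition even_ae :: "(real \<Rightarrow> real) \<Rightarrow> bool" where
  "even_ae f \<longleftrightarrow> (AE x in lebesgue. f (- x) = f x)"

definition even_SS_solution ::
  "real \<Rightarrow> real \<Rightarrow> real \<Rightarrow> (real \<Rightarrow> real) \<Rightarrow> (real \<Rightarrow> real) \<Rightarrow> bool" where
  "even_SS_solution R R\<^sub>\<mu> \<eta> F G \<longleftrightarrow> SS_solution R R\<^sub>\<mu> \<eta> F G \<and> even_ae F \<and> even_ae G"

(* Meant for the continuous representative of an element of H^1. *)
definition positivity_set :: "(real \<Rightarrow> real) \<Rightarrow> real set" where
  "positivity_set f = {x. f x > 0}"

definition R\<mu>_zero :: "real \<Rightarrow> real \<Rightarrow> real" where
  "R\<mu>_zero R \<eta> = R + \<eta>\<^sup>2 / (1 + \<eta>\<^sup>2)"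

definition R\<mu>_plus :: "real \<Rightarrow> real \<Rightarrow> real" where
  "R\<mu>_plus R \<eta> = R + ((1 + \<eta>\<^sup>2) / \<eta>\<^sup>2)\<^sup>2"

definition R\<mu>_minus :: "real \<Rightarrow> real \<Rightarrow> real" where
  "R\<mu>_minus R \<eta> = R ^ 3 * (1 + R) / (R ^ 3 + (\<eta>\<^sup>2 * (1 + R) + R)\<^sup>2)"

end

(* Uniqueness is a convexity argument. With p = eta^2 F and q = G, the functions
   U = A p + B q + x^2 and V = C p + D q + x^2 (A = 6 (1 + R), B = 6 R, C = D = 6 R_mu) are locally
   constant on {p > 0} and {q > 0}. For even solutions more is true: U is equal to one constant on
   {p > 0} and at least that constant elsewhere, and likewise for V. Testing these variational
   inequalities with the other solution gives a pointwise bound of a positive definite quadratic form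
   in the differences by a linear combination of the differences, which integrates to zero.

   For existence, every profile in the statement is a linear combination of the caps (r^2 - x^2)_+,
   and the symmetry (A, B, C, D, p, q) -> (D, C, B, A, q, p) exchanges the cases with R_mu above and
   below the threshold R_mu^0. *)
theory Submission
  imports Defs
begin

section \<open>Smooth bump functions\<close>

text \<open>The equations hold almost everywhere, whereas two solutions are compared point by point;
  each component is therefore replaced by its continuous representative, and local constancy becomes
  an equality between the end points of an interval of positivity. This alone leaves one constant
  for every connected component of a positivity set. Evenness removes the ambiguity: on the
  half-line \<open>B \<le> D\<close> makes \<open>p\<close> decreasing, \<open>A < C\<close> makes
  \<open>{q > 0}\<close> an interval, and reflection identifies the two halves. The condition
  \<open>B * C < A * D\<close>, which amounts to \<open>R\<^sub>\<mu> > 0\<close>, makes the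
  quadratic form definite and also excludes the one sign pattern that neither argument covers.

  In the regimes with two humps the radii solve a nonlinear system. A solution comes from the
  intermediate value theorem; its uniqueness is inherited from that of \<open>(F, G)\<close>,
  because every solution of the system yields an even solution whose positivity sets determine the
  radii. The outer thresholds are the parameters at which \<alpha> shrinks to 0, the middle one is
  that at which \<beta> = \<gamma>.\<close>

text \<open>Derivatives are peeled off at the front, so closure under sums, products and affine
  substitution is a plain induction on the order, and no formula for an n-th derivative is ever
  written down.\<close>

primrec smooth_upto :: "nat \<Rightarrow> (real \<Rightarrow> real) \<Rightarrow> bool" where
  "smooth_upto 0 f \<longleftrightarrow> True"
| "smooth_upto (Suc n) f \<longleftrightarrow> (\<forall>x. f differentiable (at x)) \<and> smooth_upto n (deriv f)"

lemma smooth_uptoI: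
  assumes "\<And>x. (f has_real_derivative g x) (at x)" and "smooth_upto n g"
  shows "smooth_upto (Suc n) f"
proof -
  have "deriv f = g"
    using assms(1) by (intro ext DERIV_imp_deriv)
  moreover have "f differentiable (at x)" for x
    using assms(1)[of x] real_differentiable_def by blast
  ultimately show ?thesis
    using assms(2) by simp
qed

lemma smooth_uptoD:
  assumes "smooth_upto (Suc n) f"
  shows "(f has_real_derivative deriv f x) (at x)" "smooth_upto n (deriv f)"
  using assms DERIV_deriv_iff_real_differentiable by auto

lemma smooth_upto_Suc_imp: "smooth_upto (Suc n) f \<Longrightarrow> smooth_upto n f"
  by (induction n arbitrary: f) auto

lemma smooth_upto_higher_deriv:
  "smooth_upto (Suc n) f \<Longrightarrow> ((deriv ^^ n) f) differentiable (at x)"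
  by (induction n arbitrary: f) (auto simp: funpow_Suc_right simp del: funpow.simps)

lemma smooth_upto_const: "smooth_upto n (\<lambda>x. c)"
  by (induction n arbitrary: c) (auto intro!: smooth_uptoI derivative_eq_intros simp del: smooth_upto.simps(2))

lemma smooth_upto_add:
  "smooth_upto n f \<Longrightarrow> smooth_upto n g \<Longrightarrow> smooth_upto n (\<lambda>x. f x + g x)"
proof (induction n arbitrary: f g)
  case (Suc n)
  show ?case
    by (intro smooth_uptoI[OF DERIV_add[OF smooth_uptoD(1)[OF Suc.prems(1)] smooth_uptoD(1)[OF Suc.prems(2)]]]
        Suc.IH smooth_uptoD(2) Suc.prems)
qed simp

lemma smooth_upto_mult:
  "smooth_upto n f \<Longrightarrow> smooth_upto n g \<Longrightarrow> smooth_upto n (\<lambda>x. f x * g x)"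
proof (induction n arbitrary: f g)
  case (Suc n)
  have d: "((\<lambda>x. f x * g x) has_real_derivative deriv f x * g x + f x * deriv g x) (at x)" for x
    using DERIV_mult[OF smooth_uptoD(1)[OF Suc.prems(1)] smooth_uptoD(1)[OF Suc.prems(2)], of x]
    by (simp add: algebra_simps)
  show ?case
    by (intro smooth_uptoI[OF d] smooth_upto_add Suc.IH smooth_uptoD Suc.prems smooth_upto_Suc_imp)
qed simp

lemma smooth_upto_cmult: "smooth_upto n f \<Longrightarrow> smooth_upto n (\<lambda>x. c * f x)"
  by (intro smooth_upto_mult smooth_upto_const)

lemma smooth_upto_diff:
  "smooth_upto n f \<Longrightarrow> smooth_upto n g \<Longrightarrow> smooth_upto n (\<lambda>x. f x - g x)"
  using smooth_upto_add[of n f "\<lambda>x. (-1) * g x"] smooth_upto_cmult[of n g "-1"] by simp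

lemma smooth_upto_affine:
  "smooth_upto n f \<Longrightarrow> smooth_upto n (\<lambda>x. f (c * x + d))"
proof (induction n arbitrary: f)
  case (Suc n)
  have d: "((\<lambda>x. f (c * x + d)) has_real_derivative c * deriv f (c * x + d)) (at x)" for x
  proof -
    have "((\<lambda>x. c * x + d) has_real_derivative c) (at x)"
      by (auto intro!: derivative_eq_intros)
    from DERIV_chain2[OF smooth_uptoD(1)[OF Suc.prems] this] show ?thesis
      by (simp add: mult.commute)
  qed
  show ?case
    by (intro smooth_uptoI[OF d] smooth_upto_cmult Suc.IH smooth_uptoD Suc.prems)
qed simp

section \<open>The flat function exp (-1/x) and approximate indicators\<close>

text \<open>The powers in the denominator close the family under differentiation up to linear
  combinations, so all members are proved smooth at once; \<open>bump 0\<close> is the classical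
  flat function.\<close>

definition bump :: "nat \<Rightarrow> real \<Rightarrow> real" where
  "bump k x = (if x \<le> 0 then 0 else exp (- (1 / x)) / x ^ k)"

lemma tendsto_bump_0: "(bump k \<longlongrightarrow> 0) (at 0)"
proof (rule filterlim_split_at)
  show "(bump k \<longlongrightarrow> 0) (at_left 0)"
    by (rule Lim_transform_eventually[OF tendsto_const])
      (auto simp: eventually_at_filter bump_def)
  have "((\<lambda>x. inverse x ^ k / exp (inverse x)) \<longlongrightarrow> (0::real)) (at_right 0)"
    by (rule filterlim_compose[OF tendsto_power_div_exp_0 filterlim_inverse_at_top_right])
  then show "(bump k \<longlongrightarrow> 0) (at_right 0)"
    by (rule Lim_transform_eventually)
      (auto simp: eventually_at_filter bump_def exp_minus field_simps power_inverse)
qed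

lemma has_real_derivative_bump:
  "(bump k has_real_derivative bump (k + 2) x - real k * bump (k + 1) x) (at x)"
proof (cases "x = 0")
  case True
  \<comment> \<open>At 0 the difference quotient is again a member of the family,
    \<open>bump (Suc k)\<close>, and tends to 0 there.\<close>
  have "((\<lambda>y. (bump k y - bump k 0) / (y - 0)) \<longlongrightarrow> 0) (at 0)"
    by (rule Lim_transform_eventually[OF tendsto_bump_0[of "Suc k"]])
      (auto simp: eventually_at_filter bump_def)
  then show ?thesis
    using True by (simp add: has_field_derivative_iff bump_def)
next
  case False
  show ?thesis
  proof (cases "x < 0")
    case True
    have "((\<lambda>x. 0) has_real_derivative 0) (at x)"
      by simp
    then have "(bump k has_real_derivative 0) (at x)"
      by (rule has_field_derivative_transform_within_open[of _ _ _ "{..<0}"])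
        (use True in \<open>auto simp: bump_def\<close>)
    then show ?thesis
      using True by (simp add: bump_def)
  next
    case False
    with \<open>x \<noteq> 0\<close> have x: "x > 0" by simp
    have "((\<lambda>x. exp (- (1 / x)) / x ^ k) has_real_derivative
        (exp (- (1 / x)) * (1 / x\<^sup>2) * x ^ k - exp (- (1 / x)) * (real k * x ^ (k - 1))) / (x ^ k * x ^ k)) (at x)"
      using x by (auto intro!: derivative_eq_intros simp: power2_eq_square divide_simps)
    also have "(exp (- (1 / x)) * (1 / x\<^sup>2) * x ^ k - exp (- (1 / x)) * (real k * x ^ (k - 1))) / (x ^ k * x ^ k)
        = bump (k + 2) x - real k * bump (k + 1) x"
      using x by (cases k) (auto simp: bump_def power2_eq_square divide_simps, auto simp: algebra_simps)
    finally show ?thesis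
      by (rule has_field_derivative_transform_within_open[of _ _ _ "{0<..}"])
        (use x in \<open>auto simp: bump_def\<close>)
  qed
qed

lemma smooth_upto_bump: "smooth_upto n (bump k)"
proof (induction n arbitrary: k)
  case (Suc n)
  show ?case
    by (intro smooth_uptoI[OF has_real_derivative_bump] smooth_upto_diff smooth_upto_cmult Suc.IH)
qed simp

text \<open>Scaling the argument by \<open>n\<close> keeps the support in \<open>{a..b}\<close> and
  drives both factors to 1 at every interior point, so the hats approximate the indicator of the
  open interval while bounded by 1.\<close>

definition hat :: "real \<Rightarrow> real \<Rightarrow> nat \<Rightarrow> real \<Rightarrow> real" where
  "hat a b n x = bump 0 (real n * (x - a)) * bump 0 (real n * (b - x))"

lemma smooth_upto_hat: "smooth_upto k (hat a b n)"
proof -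
  have "smooth_upto k (\<lambda>x. bump 0 (real n * x + - real n * a) * bump 0 (- real n * x + real n * b))"
    by (intro smooth_upto_mult smooth_upto_affine smooth_upto_bump)
  then show ?thesis
    by (simp add: hat_def[abs_def] algebra_simps)
qed

lemma hat_nonneg: "0 \<le> hat a b n x" and hat_le_1: "hat a b n x \<le> 1"
  by (auto simp: hat_def bump_def intro!: mult_le_one)

lemma hat_eq_0: "x \<notin> {a<..<b} \<Longrightarrow> hat a b n x = 0"
  by (auto simp: hat_def bump_def mult_le_0_iff not_less)

lemma hat_pos: "x \<in> {a<..<b} \<Longrightarrow> 0 < n \<Longrightarrow> 0 < hat a b n x"
  by (auto simp: hat_def bump_def mult_le_0_iff not_less intro!: mult_pos_pos)

lemma tendsto_hat: "(\<lambda>n. hat a b n x) \<longlonglongrightarrow> indicator {a<..<b} x"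
proof (cases "x \<in> {a<..<b}")
  case True
  have *: "(\<lambda>n. bump 0 (real n * c)) \<longlonglongrightarrow> 1" if "c > 0" for c
  proof -
    have "filterlim (\<lambda>n. real n * c) at_top sequentially"
      using that filterlim_tendsto_pos_mult_at_top[OF tendsto_const _ filterlim_real_sequentially, of c]
      by (simp add: mult.commute)
    then have "(\<lambda>n. exp (- inverse (real n * c))) \<longlonglongrightarrow> exp (- 0)"
      by (intro tendsto_intros tendsto_inverse_0_at_top)
    moreover have "\<forall>\<^sub>F n in sequentially. exp (- inverse (real n * c)) = bump 0 (real n * c)"
      using eventually_gt_at_top[of 0]
      by eventually_elim (use that in \<open>auto simp: bump_def mult_le_0_iff divide_inverse\<close>)
    ultimately show ?thesis
      using Lim_transform_eventually by fastforce
  qed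
  show ?thesis
    using tendsto_mult[OF *[of "x - a"] *[of "b - x"]] True by (simp add: hat_def)
qed (simp add: hat_eq_0)

section \<open>Weak derivatives and test functions\<close>

lemma test_functionD:
  assumes "test_function \<phi>"
  shows "(\<phi> has_real_derivative deriv \<phi> x) (at x)"
    and "continuous_on UNIV (deriv \<phi>)"
    and "\<exists>r>0. \<forall>x. \<bar>x\<bar> > r \<longrightarrow> \<phi> x = 0 \<and> deriv \<phi> x = 0"
proof -
  have d: "((deriv ^^ n) \<phi>) differentiable (at x)" for n x
    using assms by (simp add: test_function_def)
  show D: "(\<phi> has_real_derivative deriv \<phi> x) (at x)" for x
    using d[of 0 x] by (simp add: DERIV_deriv_iff_real_differentiable)
  have "deriv \<phi> differentiable (at x)" for x
    using d[of 1 x] by simp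
  then show "continuous_on UNIV (deriv \<phi>)"
    by (intro continuous_at_imp_continuous_on ballI differentiable_imp_continuous_within)
  have "bounded (closure {x. \<phi> x \<noteq> 0})"
    using assms by (auto simp: test_function_def compact_imp_bounded)
  then obtain r where r: "r > 0" "\<And>x. x \<in> closure {x. \<phi> x \<noteq> 0} \<Longrightarrow> \<bar>x\<bar> \<le> r"
    by (auto simp: bounded_pos)
  have zero: "\<phi> x = 0" if "\<bar>x\<bar> > r" for x
    using r(2)[of x] closure_subset[of "{x. \<phi> x \<noteq> 0}"] that by force
  have "deriv \<phi> x = 0" if "\<bar>x\<bar> > r" for x
  proof -
    have "((\<lambda>x. 0) has_real_derivative 0) (at x)"
      by simp
    then have "(\<phi> has_real_derivative 0) (at x)"
    proof (rule has_field_derivative_transform_within_open[of _ _ _ "- cball 0 r"])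
      show "x \<in> - cball 0 r"
        using that by simp
      show "0 = \<phi> y" if "y \<in> - cball 0 r" for y
        using zero[of y] that by simp
    qed auto
    then show ?thesis
      by (rule DERIV_imp_deriv)
  qed
  with zero \<open>r > 0\<close> show "\<exists>r>0. \<forall>x. \<bar>x\<bar> > r \<longrightarrow> \<phi> x = 0 \<and> deriv \<phi> x = 0"
    by blast
qed

lemma test_functionI:
  assumes "\<And>n. smooth_upto n \<phi>" and "\<And>x. x \<notin> {l..r} \<Longrightarrow> \<phi> x = 0"
  shows "test_function \<phi>"
  unfolding test_function_def
proof (intro conjI allI)
  show "((deriv ^^ n) \<phi>) differentiable (at x)" for n x
    using smooth_upto_higher_deriv assms(1) by blast
  have "{x. \<phi> x \<noteq> 0} \<subseteq> {l..r}"
    using assms(2) by blast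
  then show "compact (closure {x. \<phi> x \<noteq> 0})"
    using bounded_closed_interval bounded_subset compact_closure by blast
qed

text \<open>A continuous factor of bounded support is bounded, so a multiple of \<open>f\<close> on
  \<open>{-r..r}\<close> dominates the product. Applied to a test function and to its derivative,
  this permits splitting the integrals in a weak identity.\<close>

lemma locally_L1_integrable_mult:
  assumes "locally_L1 f" "continuous_on UNIV \<psi>" "\<And>x. \<bar>x\<bar> > r \<Longrightarrow> \<psi> x = 0"
  shows "integrable lebesgue (\<lambda>x. f x * \<psi> x)"
proof -
  let ?I = "indicator {-r..r} :: real \<Rightarrow> real"
  have f: "integrable lebesgue (\<lambda>x. ?I x * f x)"
    using assms(1) unfolding locally_L1_def set_integrable_def by (force dest: spec[of _ "{-r..r}"])
  have "compact (\<psi> ` {-r..r})"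
    using assms(2) by (intro compact_continuous_image) (auto intro: continuous_on_subset)
  then obtain K where "\<forall>y\<in>\<psi> ` {-r..r}. norm y \<le> K"
    using compact_imp_bounded bounded_iff by blast
  then have K: "\<And>x. x \<in> {-r..r} \<Longrightarrow> \<bar>\<psi> x\<bar> \<le> K"
    by auto
  have eq: "f x * \<psi> x = ?I x * f x * \<psi> x" for x
  proof (cases "\<bar>x\<bar> > r")
    case True
    then show ?thesis
      using assms(3) by simp
  next
    case False
    then have "x \<in> {-r..r}"
      by auto
    then show ?thesis
      by simp
  qed
  have \<psi>: "\<psi> \<in> borel_measurable lebesgue"
    using borel_measurable_continuous_onI[OF assms(2)] by (intro measurable_completion) simp
  show ?thesis
  proof (rule Bochner_Integration.integrable_bound[OF integrable_mult_right[OF f, of K]])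
    show "(\<lambda>x. f x * \<psi> x) \<in> borel_measurable lebesgue"
      unfolding eq by (rule borel_measurable_times[OF borel_measurable_integrable[OF f] \<psi>])
    show "AE x in lebesgue. norm (f x * \<psi> x) \<le> norm (K * (?I x * f x))"
    proof (rule AE_I2)
      fix x
      show "norm (f x * \<psi> x) \<le> norm (K * (?I x * f x))"
      proof (cases "x \<in> {-r..r}")
        case True
        have "\<bar>f x\<bar> * \<bar>\<psi> x\<bar> \<le> \<bar>f x\<bar> * \<bar>K\<bar>"
          using K[OF True] by (intro mult_left_mono) auto
        then show ?thesis
          using True by (simp add: abs_mult mult.commute)
      next
        case False
        then have "\<bar>x\<bar> > r"
          by auto
        then show ?thesis
          using assms(3) by simp
      qed
    qed
  qed
qed

lemma locally_L1_test_integrable: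
  assumes "locally_L1 f" "test_function \<phi>"
  shows "integrable lebesgue (\<lambda>x. f x * \<phi> x)" "integrable lebesgue (\<lambda>x. f x * deriv \<phi> x)"
proof -
  note \<phi> = test_functionD[OF assms(2)]
  obtain r where r: "\<And>x. \<bar>x\<bar> > r \<Longrightarrow> \<phi> x = 0" "\<And>x. \<bar>x\<bar> > r \<Longrightarrow> deriv \<phi> x = 0"
    using \<phi>(3) by blast
  have "continuous_on UNIV \<phi>"
    using \<phi>(1) DERIV_isCont by (intro continuous_at_imp_continuous_on) blast
  with assms(1) show "integrable lebesgue (\<lambda>x. f x * \<phi> x)"
    using r(1) by (rule locally_L1_integrable_mult)
  show "integrable lebesgue (\<lambda>x. f x * deriv \<phi> x)"
    using assms(1) \<phi>(2) r(2) by (rule locally_L1_integrable_mult)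
qed

lemma locally_L1_add: "locally_L1 f \<Longrightarrow> locally_L1 g \<Longrightarrow> locally_L1 (\<lambda>x. f x + g x)"
  by (auto simp: locally_L1_def)

lemma locally_L1_cmult: "locally_L1 f \<Longrightarrow> locally_L1 (\<lambda>x. c * f x)"
  by (auto simp: locally_L1_def)

lemma locally_L1_continuous:
  assumes "continuous_on UNIV f"
  shows "locally_L1 f"
  unfolding locally_L1_def
proof (intro allI impI)
  fix C :: "real set" assume "compact C"
  then have "integrable lborel (\<lambda>x. indicator C x *\<^sub>R f x)"
    using assms by (intro borel_integrable_compact) (auto intro: continuous_on_subset)
  then show "set_integrable lebesgue C f"
    unfolding set_integrable_def using integrable_completion borel_measurable_integrable by blast
qed

lemma weak_deriv_add:
  assumes "weak_deriv f f'" "weak_deriv g g'"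
  shows "weak_deriv (\<lambda>x. f x + g x) (\<lambda>x. f' x + g' x)"
  using assms unfolding weak_deriv_def
  by (auto simp: locally_L1_add distrib_right locally_L1_test_integrable)

lemma weak_deriv_cmult:
  assumes "weak_deriv f f'"
  shows "weak_deriv (\<lambda>x. c * f x) (\<lambda>x. c * f' x)"
  using assms unfolding weak_deriv_def
  by (auto simp: locally_L1_cmult mult.assoc)

lemma integral_lborel_lebesgue:
  fixes f :: "real \<Rightarrow> real"
  assumes "integrable lborel f"
  shows "integrable lebesgue f" "integral\<^sup>L lebesgue f = integral\<^sup>L lborel f"
  using assms borel_measurable_integrable[OF assms] by (auto simp: integrable_completion integral_completion)

section \<open>Functions whose weak derivative vanishes\<close>

text \<open>The rays form an intersection-stable generator of the Borel sets, and the Borel sets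
  over which \<open>h\<close> integrates to zero form a Dynkin system; the vanishing total integral
  takes care of complements.\<close>

lemma AE_zero_if_integral_rays_zero:
  fixes h :: "real \<Rightarrow> real"
  assumes h: "integrable lborel h" and total: "integral\<^sup>L lborel h = 0"
    and rays: "\<And>a. set_lebesgue_integral lborel {a<..} h = 0"
  shows "AE x in lborel. h x = 0"
proof -
  have si: "set_integrable lborel A h" if "A \<in> sets borel" for A
    using that h unfolding set_integrable_def by (intro integrable_mult_indicator) auto
  have "set_lebesgue_integral lborel A h = 0" if "A \<in> sets borel" for A
  proof -
    have sets: "sets borel = sigma_sets UNIV (range (greaterThan :: real \<Rightarrow> _))"
      by (subst borel_Ioi) simp
    have "Int_stable (range (greaterThan :: real \<Rightarrow> _))"
    proof (clarsimp simp: Int_stable_def)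
      show "{a<..} \<inter> {b<..} \<in> range greaterThan" for a b :: real
        by (rule range_eqI[of _ _ "max a b"]) auto
    qed
    moreover have "range (greaterThan :: real \<Rightarrow> _) \<subseteq> Pow UNIV"
      by simp
    moreover have "A \<in> sigma_sets UNIV (range greaterThan)"
      using that sets by simp
    ultimately show ?thesis
    proof (induction rule: sigma_sets_induct_disjoint)
      case (basic A)
      then show ?case using rays by auto
    next
      case empty
      show ?case by (simp add: set_lebesgue_integral_def)
    next
      case (compl A)
      have A: "A \<in> sets borel"
        using compl(1) sets by simp
      have "set_lebesgue_integral lborel (A \<union> (UNIV - A)) h
          = set_lebesgue_integral lborel A h + set_lebesgue_integral lborel (UNIV - A) h"
        using A by (intro set_integral_Un si) auto
      moreover have "A \<union> (UNIV - A) = UNIV"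
        by blast
      ultimately show ?case
        using total compl(2) by (simp add: set_lebesgue_integral_def)
    next
      case (union F)
      have F: "F i \<in> sets borel" for i
        using union(2) sets by auto
      have "set_lebesgue_integral lborel (\<Union>i. F i) h = (\<Sum>i. set_lebesgue_integral lborel (F i) h)"
        using F union(1) by (intro lebesgue_integral_countable_add si) (auto simp: disjoint_family_on_def)
      then show ?case
        using union(3) by simp
    qed
  qed
  then show ?thesis
    using h by (intro density_unique_real) (auto simp: set_lebesgue_integral_def)
qed

lemma continuous_antiderivative:
  fixes f :: "real \<Rightarrow> real"
  assumes "continuous_on UNIV f"
  obtains F where "\<And>x. (F has_real_derivative f x) (at x)"
proof -
  have "isCont f x" for x
    using assms by (simp add: continuous_on_eq_continuous_at)
  then obtain F where "\<And>x::real. (F has_vector_derivative f x) (at x)"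
    using einterval_antiderivative[of "-\<infinity>" \<infinity> f] by auto
  then show ?thesis
    using that has_real_derivative_iff_has_vector_derivative by blast
qed

lemma smooth_upto_imp_continuous:
  assumes "smooth_upto 1 f"
  shows "continuous_on UNIV f"
  using assms DERIV_isCont[OF smooth_uptoD(1)]
  by (auto intro!: continuous_at_imp_continuous_on differentiable_imp_continuous_within)

lemma integral_lborel_compact_support:
  fixes f :: "real \<Rightarrow> real"
  assumes "continuous_on UNIV f" "\<And>x. x \<notin> {l..r} \<Longrightarrow> f x = 0"
  shows "integrable lborel f"
proof -
  have "integrable lborel (\<lambda>x. indicator {l..r} x *\<^sub>R f x)"
    using assms(1) by (intro borel_integrable_compact) (auto intro: continuous_on_subset)
  moreover have "indicator {l..r} x *\<^sub>R f x = f x" for x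
    using assms(2)[of x] by (cases "x \<in> {l..r}") auto
  then have "(\<lambda>x. indicator {l..r} x *\<^sub>R f x) = f"
    by (rule ext)
  ultimately show ?thesis by simp
qed

text \<open>Mean zero is exactly what makes the antiderivative that vanishes to the left of
  \<open>l\<close> vanish to the right of \<open>r\<close> as well, so that it has compact
  support.\<close>

lemma test_function_antiderivative:
  assumes smooth: "\<And>n. smooth_upto n u" and supp: "\<And>x. x \<notin> {l..r} \<Longrightarrow> u x = 0"
    and mean: "integral\<^sup>L lborel u = 0" and "l \<le> r"
  obtains \<phi> where "test_function \<phi>" "deriv \<phi> = u" "\<And>x. x \<notin> {l..r} \<Longrightarrow> \<phi> x = 0"
proof -
  have cont: "continuous_on UNIV u"
    using smooth smooth_upto_imp_continuous by blast
  then obtain \<Phi> where \<Phi>: "\<And>x. (\<Phi> has_real_derivative u x) (at x)"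
    using continuous_antiderivative by blast
  have FTC: "(\<integral>x. u x * indicator {a..b} x \<partial>lborel) = \<Phi> b - \<Phi> a" if "a \<le> b" for a b
    using that \<Phi> cont by (intro integral_FTC_Icc_real) (auto simp: continuous_on_eq_continuous_at)
  have const: "\<Phi> x = \<Phi> l" if "x \<notin> {l..r}" for x
  proof -
    from that consider "x < l" | "x > r"
      by (auto simp: not_le)
    then show ?thesis
    proof cases
      case 1
      \<comment> \<open>At \<open>l\<close> itself the support hypothesis is silent, so this single
        point is discarded as a null set.\<close>
      then have "(\<lambda>y. u y * indicator {x..l} y) y = 0 \<or> y = l" for y
        using supp[of y] by (auto simp: indicator_def)
      then have "AE y in lborel. u y * indicator {x..l} y = 0"
        using AE_lborel_singleton[of l] by auto
      then have "(\<integral>y. u y * indicator {x..l} y \<partial>lborel) = 0"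
        by (rule integral_eq_zero_AE)
      then show ?thesis
        using FTC[of x l] 1 by simp
    next
      case 2
      then have "u y * indicator {l..x} y = u y" for y
        using supp[of y] by (cases "y \<in> {l..r}") (auto simp: indicator_def)
      then have "(\<integral>y. u y * indicator {l..x} y \<partial>lborel) = integral\<^sup>L lborel u"
        by (intro Bochner_Integration.integral_cong refl)
      then show ?thesis
        using FTC[of l x] 2 \<open>l \<le> r\<close> mean by simp
    qed
  qed
  define \<phi> where "\<phi> x = \<Phi> x - \<Phi> l" for x
  have D: "(\<phi> has_real_derivative u x) (at x)" for x
    unfolding \<phi>_def[abs_def] using \<Phi> by (auto intro!: derivative_eq_intros)
  have zero: "\<phi> x = 0" if "x \<notin> {l..r}" for x
    using const[OF that] by (simp add: \<phi>_def)
  have "test_function \<phi>"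
    using smooth_upto_Suc_imp[OF smooth_uptoI[OF D smooth]] zero by (rule test_functionI)
  moreover have "deriv \<phi> = u"
    using D DERIV_imp_deriv by blast
  ultimately show ?thesis
    using that zero by blast
qed

lemma integral_hat_pos:
  assumes "a < b"
  shows "integrable lborel (hat a b n)" "0 < n \<Longrightarrow> 0 < integral\<^sup>L lborel (hat a b n)"
proof -
  have "continuous_on UNIV (hat a b n)"
    using smooth_upto_hat smooth_upto_imp_continuous by blast
  then show int: "integrable lborel (hat a b n)"
    by (rule integral_lborel_compact_support[of _ a b]) (auto intro: hat_eq_0)
  assume n: "0 < n"
  have "integral\<^sup>L lborel (hat a b n) \<noteq> 0"
  proof
    assume "integral\<^sup>L lborel (hat a b n) = 0"
    then have "AE x in lborel. hat a b n x = 0"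
      using int by (subst (asm) integral_nonneg_eq_0_iff_AE) (auto simp: hat_nonneg)
    then have "AE x in lborel. x \<notin> {a<..<b}"
    proof eventually_elim
      case (elim x)
      show ?case
      proof
        assume "x \<in> {a<..<b}"
        from hat_pos[OF this n] elim show False by linarith
      qed
    qed
    then have "emeasure lborel {a<..<b} = 0"
      by (subst (asm) AE_iff_null_sets[symmetric]) auto
    then show False
      using assms by simp
  qed
  then show "0 < integral\<^sup>L lborel (hat a b n)"
    using Bochner_Integration.integral_nonneg[of lborel "hat a b n", OF hat_nonneg] by linarith
qed

text \<open>Du Bois-Reymond: a bump minus a suitable multiple of a fixed bump is the derivative of a test
  function, so \<open>w - c\<close> annihilates every bump; bumps increase to indicators of intervals.\<close>

lemma AE_const_if_weak_deriv_zero: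
  fixes S :: "real set"
  assumes w: "locally_L1 w" and S: "open S" "is_interval S"
    and zero: "\<And>\<phi> l r. \<lbrakk>test_function \<phi>; {l..r} \<subseteq> S; \<And>x. x \<notin> {l..r} \<Longrightarrow> \<phi> x = 0\<rbrakk>
      \<Longrightarrow> (\<integral>x. w x * deriv \<phi> x \<partial>lebesgue) = 0"
  obtains c where "AE x in lebesgue. x \<in> S \<longrightarrow> w x = c"
proof (cases "S = {}")
  case False
  then obtain s where "s \<in> S" by blast
  then obtain e where e: "e > 0" "cball s e \<subseteq> S"
    using S open_contains_cball by blast
  \<comment> \<open>A reference interval inside \<open>S\<close>: subtracting a multiple of its hat
    normalises every other hat to mean zero.\<close>
  define a0 b0 where "a0 = s - e" and "b0 = s + e"
  have ab0: "a0 < b0" "{a0..b0} \<subseteq> S"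
    using e by (auto simp: a0_def b0_def cball_eq_atLeastAtMost)
  define h0 where "h0 = hat a0 b0 1"
  define m0 where "m0 = integral\<^sup>L lborel h0"
  have m0: "m0 > 0"
    using integral_hat_pos[OF ab0(1)] by (simp add: m0_def h0_def)
  \<comment> \<open>Testing \<open>w = c\<close> against \<open>h0\<close> forces this
    value.\<close>
  define c where "c = (\<integral>x. w x * h0 x \<partial>lebesgue) / m0"
  define v where "v x = w x + - c * 1" for x
  have v: "locally_L1 v"
    unfolding v_def[abs_def] by (intro locally_L1_add locally_L1_cmult w locally_L1_continuous) simp
  have test_hat: "test_function (hat a b n)" for a b n
    by (rule test_functionI[of _ a b]) (auto intro: smooth_upto_hat hat_eq_0)
  have v_hat: "(\<integral>x. v x * hat a b n x \<partial>lebesgue) = 0" if "a < b" "{a..b} \<subseteq> S" for a b n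
  proof -
    define m where "m = integral\<^sup>L lborel (hat a b n) / m0"
    define u where "u x = hat a b n x - m * h0 x" for x
    \<comment> \<open>The two supports have a common hull inside \<open>S\<close> because
      \<open>S\<close> is an interval. This is where connectedness enters; on a disconnected set the
      constant could differ between components.\<close>
    have S': "{min a a0..max b b0} \<subseteq> S"
    proof
      fix x assume "x \<in> {min a a0..max b b0}"
      moreover have "min a a0 \<in> S" "max b b0 \<in> S"
        using that ab0 by (auto simp: min_def max_def)
      ultimately show "x \<in> S"
        using S(2) by (metis atLeastAtMost_iff mem_is_interval_1_I)
    qed
    have su: "smooth_upto k u" for k
      unfolding u_def[abs_def] h0_def by (intro smooth_upto_diff smooth_upto_cmult smooth_upto_hat)
    have supp: "u x = 0" if "x \<notin> {min a a0..max b b0}" for x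
    proof -
      have "x \<notin> {a<..<b}" "x \<notin> {a0<..<b0}"
        using that by auto
      then show ?thesis
        by (simp add: u_def h0_def hat_eq_0 del: greaterThanLessThan_iff)
    qed
    have mean: "integral\<^sup>L lborel u = 0"
      using integral_hat_pos[OF \<open>a < b\<close>, of n] integral_hat_pos[OF ab0(1), of 1] m0
      unfolding u_def[abs_def] h0_def[symmetric] by (simp add: m_def m0_def)
    have "min a a0 \<le> max b b0"
      using that(1) ab0 by auto
    from test_function_antiderivative[OF su supp mean this]
    obtain \<phi> where \<phi>: "test_function \<phi>" "deriv \<phi> = u" "\<And>x. x \<notin> {min a a0..max b b0} \<Longrightarrow> \<phi> x = 0"
      by blast
    have int: "integrable lebesgue (\<lambda>x. w x * hat a b n x)" "integrable lebesgue (\<lambda>x. w x * h0 x)"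
      unfolding h0_def by (intro locally_L1_test_integrable w test_hat)+
    have "0 = (\<integral>x. w x * u x \<partial>lebesgue)"
      using zero[OF \<phi>(1) S' \<phi>(3)] \<phi>(2) by simp
    also have "\<dots> = (\<integral>x. w x * hat a b n x - m * (w x * h0 x) \<partial>lebesgue)"
      by (simp add: u_def algebra_simps)
    also have "\<dots> = (\<integral>x. w x * hat a b n x \<partial>lebesgue) - m * (\<integral>x. w x * h0 x \<partial>lebesgue)"
      using int by simp
    also have "m * (\<integral>x. w x * h0 x \<partial>lebesgue) = c * integral\<^sup>L lborel (hat a b n)"
      by (simp add: m_def c_def)
    also have "integral\<^sup>L lborel (hat a b n) = integral\<^sup>L lebesgue (hat a b n)"
      using integral_lborel_lebesgue(2)[OF integral_hat_pos(1)[OF \<open>a < b\<close>]] by simp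
    also have "(\<integral>x. w x * hat a b n x \<partial>lebesgue) - c * integral\<^sup>L lebesgue (hat a b n)
        = (\<integral>x. w x * hat a b n x - c * hat a b n x \<partial>lebesgue)"
      using int integral_lborel_lebesgue(1)[OF integral_hat_pos(1)[OF \<open>a < b\<close>], of n]
      by simp
    also have "\<dots> = (\<integral>x. v x * hat a b n x \<partial>lebesgue)"
      by (simp add: v_def left_diff_distrib)
    finally show ?thesis by simp
  qed
  have v_int: "integrable lebesgue (\<lambda>x. v x * indicator {a<..<b} x)" for a b
  proof -
    have "set_integrable lebesgue {a..b} v"
      using v by (simp add: locally_L1_def)
    then have "set_integrable lebesgue {a<..<b} v"
      by (rule set_integrable_subset) auto
    then show ?thesis
      by (simp add: set_integrable_def mult.commute)
  qed
  have v_ind: "(\<integral>x. v x * indicator {a<..<b} x \<partial>lebesgue) = 0" if "a < b" "{a..b} \<subseteq> S" for a b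
  proof -
    have "(\<lambda>n. \<integral>x. v x * hat a b n x \<partial>lebesgue) \<longlonglongrightarrow> (\<integral>x. v x * indicator {a<..<b} x \<partial>lebesgue)"
    proof (rule integral_dominated_convergence)
      show "integrable lebesgue (\<lambda>x. \<bar>v x * indicator {a<..<b} x\<bar>)"
        using v_int by (rule integrable_abs)
      show "(\<lambda>x. v x * hat a b n x) \<in> borel_measurable lebesgue" for n
        by (rule borel_measurable_integrable[OF locally_L1_test_integrable(1)[OF v test_hat]])
      show "AE x in lebesgue. (\<lambda>n. v x * hat a b n x) \<longlonglongrightarrow> v x * indicator {a<..<b} x"
        by (intro AE_I2 tendsto_intros tendsto_hat)
      show "AE x in lebesgue. norm (v x * hat a b n x) \<le> \<bar>v x * indicator {a<..<b} x\<bar>" for n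
      proof (rule AE_I2)
        fix x
        show "norm (v x * hat a b n x) \<le> \<bar>v x * indicator {a<..<b} x\<bar>"
          using hat_le_1[of a b n x] hat_nonneg[of a b n x] hat_eq_0[of x a b n]
          by (cases "x \<in> {a<..<b}") (simp_all add: abs_mult mult_left_le del: greaterThanLessThan_iff)
      qed
    qed (rule borel_measurable_integrable[OF v_int])
    then have "(\<lambda>n. 0) \<longlonglongrightarrow> (\<integral>x. v x * indicator {a<..<b} x \<partial>lebesgue)"
      unfolding v_hat[OF that] .
    then show ?thesis
      by (simp add: LIMSEQ_const_iff)
  qed
  have v_AE: "AE x in lebesgue. x \<in> {k<..<l} \<longrightarrow> v x = 0" if "k < l" "{k..l} \<subseteq> S" for k l
  proof -
    have "(\<lambda>x. v x * indicator {k<..<l} x) \<in> borel_measurable (completion lborel)"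
      by (rule borel_measurable_integrable[OF v_int])
    \<comment> \<open>The criterion with rays concerns integrals over Borel sets, so
      \<open>v\<close> on the interval is replaced by a Borel function that agrees with it almost
      everywhere.\<close>
    from completion_ex_borel_measurable_real[OF this] obtain h where
      h: "h \<in> borel_measurable lborel" "AE x in lborel. v x * indicator {k<..<l} x = h x"
      by blast
    have h': "AE x in lebesgue. v x * indicator {k<..<l} x = h x"
      using h(2) by (rule AE_completion)
    have hm: "h \<in> borel_measurable lebesgue"
      using h(1) by (rule measurable_completion)
    have h_int: "integrable lborel h"
    proof -
      have "integrable lebesgue h"
        using v_int[of k l] borel_measurable_integrable[OF v_int[of k l]] hm h'
        by (subst (asm) integrable_cong_AE[where g = h]) auto
      then show ?thesis
        using integrable_completion[OF h(1)] by simp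
    qed
    have *: "set_lebesgue_integral lborel A h = (\<integral>x. v x * indicator ({k<..<l} \<inter> A) x \<partial>lebesgue)"
      if A: "A \<in> sets borel" for A
    proof -
      have "set_lebesgue_integral lborel A h = (\<integral>x. indicator A x * h x \<partial>lebesgue)"
        unfolding set_lebesgue_integral_def using A h(1) by (subst integral_completion) auto
      also have "\<dots> = (\<integral>x. v x * indicator ({k<..<l} \<inter> A) x \<partial>lebesgue)"
      proof (rule integral_cong_AE)
        have ind: "indicat_real A \<in> borel_measurable lebesgue"
          using A by (intro borel_measurable_indicator) auto
        show "(\<lambda>x. indicator A x * h x) \<in> borel_measurable lebesgue"
          using ind hm by (rule borel_measurable_times)
        show "(\<lambda>x. v x * indicator ({k<..<l} \<inter> A) x) \<in> borel_measurable lebesgue"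
          using borel_measurable_times[OF borel_measurable_integrable[OF v_int[of k l]] ind]
          by (simp add: indicator_inter_arith mult.assoc)
        show "AE x in lebesgue. indicator A x * h x = v x * indicator ({k<..<l} \<inter> A) x"
          using h' by eventually_elim (auto simp: indicator_def)
      qed
      finally show ?thesis .
    qed
    have "AE x in lborel. h x = 0"
    proof (rule AE_zero_if_integral_rays_zero[OF h_int])
      show "integral\<^sup>L lborel h = 0"
        using *[of UNIV] v_ind[OF that] by (simp add: set_lebesgue_integral_def)
      show "set_lebesgue_integral lborel {a<..} h = 0" for a
      proof -
        have eq: "{k<..<l} \<inter> {a<..} = {max k a<..<l}"
          by auto
        show ?thesis
              unfolding *[of "{a<..}", simplified] eq
        proof (cases "max k a < l")
          case True
          then show "(\<integral>x. v x * indicator {max k a<..<l} x \<partial>lebesgue) = 0"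
            using that by (intro v_ind) auto
        qed auto
      qed
    qed
    then have "AE x in lebesgue. h x = 0"
      by (rule AE_completion)
    with h' show ?thesis
      by eventually_elim auto
  qed
  \<comment> \<open>Exceptional null sets may only be united countably often; the rational intervals
    with closure in \<open>S\<close> suffice to cover the open set \<open>S\<close>.\<close>
  define Q where "Q = {(k, l). k \<in> \<rat> \<and> l \<in> \<rat> \<and> k < l \<and> {k..l} \<subseteq> S}"
  have "countable Q"
    by (rule countable_subset[of _ "\<rat> \<times> \<rat>"]) (auto simp: Q_def countable_rat)
  then have "AE x in lebesgue. \<forall>q\<in>Q. x \<in> {fst q<..<snd q} \<longrightarrow> v x = 0"
    by (subst AE_ball_countable) (use v_AE in \<open>auto simp: Q_def\<close>)
  then have "AE x in lebesgue. x \<in> S \<longrightarrow> w x = c"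
  proof eventually_elim
    case (elim x)
    show ?case
    proof
      assume "x \<in> S"
      then obtain e where e: "e > 0" "cball x e \<subseteq> S"
        using S open_contains_cball by blast
      obtain k l where kl: "k \<in> \<rat>" "x - e < k" "k < x" "l \<in> \<rat>" "x < l" "l < x + e"
        using Rats_dense_in_real[of "x - e" x] Rats_dense_in_real[of x "x + e"] e by auto
      then have "(k, l) \<in> Q"
        using e by (auto simp: Q_def cball_eq_atLeastAtMost)
      then show "w x = c"
        using bspec[OF elim, of "(k, l)"] kl by (simp add: v_def)
    qed
  qed
  then show ?thesis
    using that by blast
next
  case True
  then show ?thesis
    by (intro that[of 0]) simp
qed

section \<open>Continuous representatives\<close>

text \<open>The half-line formula is the inner integral that appears once Fubini has exchanged the
  order of integration for \<open>primitive\<close>.\<close>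

lemma integral_deriv_test_function:
  assumes "test_function \<phi>"
  shows "integrable lborel (deriv \<phi>)" "(\<integral>x. deriv \<phi> x \<partial>lborel) = 0"
    "(\<integral>x. deriv \<phi> x * indicator {t..} x \<partial>lborel) = - \<phi> t"
proof -
  note \<phi> = test_functionD[OF assms]
  obtain r where r: "r > 0" "\<And>x. \<bar>x\<bar> > r \<Longrightarrow> \<phi> x = 0" "\<And>x. \<bar>x\<bar> > r \<Longrightarrow> deriv \<phi> x = 0"
    using \<phi>(3) by blast
  have supp: "deriv \<phi> x = 0" if "x \<notin> {-r..r}" for x
    using that by (intro r(3)) auto
  show "integrable lborel (deriv \<phi>)"
    by (rule integral_lborel_compact_support[OF \<phi>(2) supp])
  have FTC: "(\<integral>x. deriv \<phi> x * indicator {a..b} x \<partial>lborel) = \<phi> b - \<phi> a" if "a \<le> b" for a b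
    using that \<phi>(1,2) by (intro integral_FTC_Icc_real) (auto simp: continuous_on_eq_continuous_at)
  \<comment> \<open>Strictly beyond both the support and \<open>t\<close>, so that
    \<open>\<phi>\<close> vanishes at \<open>M\<close> and at \<open>-M\<close>.\<close>
  define M where "M = max r \<bar>t\<bar> + 1"
  have M: "M > r" "M > t" "- M < t" "\<bar>M\<bar> > r"
    by (auto simp: M_def)
  have eqs: "deriv \<phi> x * indicator {t..} x = deriv \<phi> x * indicator {t..M} x"
    "deriv \<phi> x = deriv \<phi> x * indicator {-M..M} x" for x
  proof -
    show "deriv \<phi> x * indicator {t..} x = deriv \<phi> x * indicator {t..M} x"
    proof (cases "x > M")
      case True
      with M have "deriv \<phi> x = 0"
        by (intro r(3)) auto
      then show ?thesis by simp
    qed (auto simp: indicator_def)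
    show "deriv \<phi> x = deriv \<phi> x * indicator {-M..M} x"
    proof (cases "\<bar>x\<bar> > M")
      case True
      with M have "deriv \<phi> x = 0"
        by (intro r(3)) auto
      then show ?thesis by simp
    qed (auto simp: indicator_def)
  qed
  have "(\<integral>x. deriv \<phi> x * indicator {t..} x \<partial>lborel) = (\<integral>x. deriv \<phi> x * indicator {t..M} x \<partial>lborel)"
    by (intro Bochner_Integration.integral_cong refl eqs(1))
  then show "(\<integral>x. deriv \<phi> x * indicator {t..} x \<partial>lborel) = - \<phi> t"
    using FTC[of t M] M r(2)[of M] by simp
  have "(\<integral>x. deriv \<phi> x \<partial>lborel) = (\<integral>x. deriv \<phi> x * indicator {-M..M} x \<partial>lborel)"
    by (intro Bochner_Integration.integral_cong refl eqs(2))
  then show "(\<integral>x. deriv \<phi> x \<partial>lborel) = 0"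
    using FTC[of "-M" M] M r(1) r(2)[of M] r(2)[of "-M"] by simp
qed

section \<open>Oriented primitives of locally integrable functions\<close>

text \<open>The difference is 1 on (0, x] and -1 on (x, 0], the signed indicator of the segment from
  0 to \<open>x\<close>; a single integral over the line thus covers both signs of
  \<open>x\<close>.\<close>

definition prim_kernel :: "real \<Rightarrow> real \<Rightarrow> real" where
  "prim_kernel x t = indicator {..x} t - indicator {..0} t"

definition primitive :: "(real \<Rightarrow> real) \<Rightarrow> real \<Rightarrow> real" where
  "primitive g x = (\<integral>t. g t * prim_kernel x t \<partial>lborel)"

lemma prim_kernel_bound: "\<bar>x\<bar> \<le> r \<Longrightarrow> \<bar>g t * prim_kernel x t\<bar> \<le> \<bar>indicator {-r..r} t * g t\<bar>"
  by (cases "t \<le> x"; cases "t \<le> 0") (auto simp: prim_kernel_def)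

text \<open>Dominated convergence along a sequence tending to \<open>x\<close>: at each
  \<open>t \<noteq> x\<close> the kernels are eventually constant, and since the sequence is
  bounded, \<open>g\<close> on one compact interval dominates.\<close>

lemma continuous_primitive:
  assumes g: "g \<in> borel_measurable borel" "locally_L1 g"
  shows "continuous_on UNIV (primitive g)"
proof -
  have int: "integrable lborel (\<lambda>t. \<bar>indicator {-r..r} t * g t\<bar>)" for r
  proof -
    have "integrable lebesgue (\<lambda>t. indicator {-r..r} t * g t)"
      using g(2) unfolding locally_L1_def set_integrable_def by (force dest: spec[of _ "{-r..r}"])
    then show ?thesis
      using g(1) by (subst (asm) integrable_completion) auto
  qed
  have "isCont (primitive g) x" for x
    unfolding continuous_at_sequentially comp_def
  proof (intro allI impI)
    fix X :: "nat \<Rightarrow> real" assume X: "X \<longlonglongrightarrow> x"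
    then obtain r where r: "\<And>n. \<bar>X n\<bar> \<le> r"
      by (metis convergentI convergent_imp_Bseq BseqE real_norm_def)
    show "(\<lambda>n. primitive g (X n)) \<longlonglongrightarrow> primitive g x"
      unfolding primitive_def
    proof (rule integral_dominated_convergence[OF _ _ int[of r]])
      show "(\<lambda>t. g t * prim_kernel x t) \<in> borel_measurable lborel"
        "(\<lambda>t. g t * prim_kernel (X n) t) \<in> borel_measurable lborel" for n
        using g(1) by (auto simp: prim_kernel_def)
      show "AE t in lborel. norm (g t * prim_kernel (X n) t) \<le> \<bar>indicator {-r..r} t * g t\<bar>" for n
        using prim_kernel_bound[OF r] by simp
      have "AE t in lborel. t \<noteq> x"
        by (rule AE_lborel_singleton)
      then show "AE t in lborel. (\<lambda>n. g t * prim_kernel (X n) t) \<longlonglongrightarrow> g t * prim_kernel x t"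
      proof eventually_elim
        case (elim t)
        have "\<forall>\<^sub>F n in sequentially. prim_kernel x t = prim_kernel (X n) t"
        proof (cases "t < x")
          case True
          then show ?thesis
            using order_tendstoD(1)[OF X True] by (auto elim!: eventually_mono simp: prim_kernel_def)
        next
          case False
          then have "x < t" using elim by simp
          then show ?thesis
            using order_tendstoD(2)[OF X \<open>x < t\<close>] by (auto elim!: eventually_mono simp: prim_kernel_def)
        qed
        then have "(\<lambda>n. prim_kernel (X n) t) \<longlonglongrightarrow> prim_kernel x t"
          by (rule Lim_transform_eventually[OF tendsto_const])
        then show ?case
          by (intro tendsto_intros)
      qed
    qed
  qed
  then show ?thesis
    by (simp add: continuous_at_imp_continuous_on)
qed

text \<open>Fubini replaces the product rule, since \<open>primitive g\<close> need not be differentiable.\<close>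

lemma integral_primitive_by_parts:
  assumes g: "g \<in> borel_measurable borel" "locally_L1 g" and \<phi>: "test_function \<phi>"
  shows "(\<integral>x. primitive g x * deriv \<phi> x \<partial>lborel) = - (\<integral>t. g t * \<phi> t \<partial>lborel)"
proof -
  obtain r where r: "\<And>x. \<bar>x\<bar> > r \<Longrightarrow> \<phi> x = 0" "\<And>x. \<bar>x\<bar> > r \<Longrightarrow> deriv \<phi> x = 0"
    using test_functionD(3)[OF \<phi>] by blast
  \<comment> \<open>Fubini asks for global integrability, so \<open>g\<close> is cut off to an
    interval outside of which the test function vanishes.\<close>
  define h where "h t = indicator {-r..r} t * g t" for t
  have "integrable lebesgue h"
    using g(2) unfolding locally_L1_def set_integrable_def h_def[abs_def]
    by (force dest: spec[of _ "{-r..r}"])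
  then have h: "integrable lborel h"
    using g(1) unfolding h_def[abs_def] by (subst (asm) integrable_completion) auto
  note d = integral_deriv_test_function[OF \<phi>]
  have hm [measurable]: "h \<in> borel_measurable borel" and dm [measurable]: "deriv \<phi> \<in> borel_measurable borel"
    using borel_measurable_integrable[OF h] borel_measurable_integrable[OF d(1)] by auto
  have km [measurable]: "(\<lambda>(x, t). prim_kernel x t) \<in> borel_measurable (borel \<Otimes>\<^sub>M borel)"
    unfolding prim_kernel_def by (simp add: indicator_def)
  have "integrable (lborel \<Otimes>\<^sub>M lborel) (\<lambda>(x, t). deriv \<phi> x * h t)"
  proof (rule lborel_pair.Fubini_integrable)
    show "(\<lambda>(x, t). deriv \<phi> x * h t) \<in> borel_measurable (lborel \<Otimes>\<^sub>M lborel)"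
      by measurable
    show "integrable lborel (\<lambda>x. \<integral>y. norm (case (x, y) of (x, t) \<Rightarrow> deriv \<phi> x * h t) \<partial>lborel)"
      using d(1) by (simp add: abs_mult)
    show "AE x in lborel. integrable lborel (\<lambda>y. case (x, y) of (x, t) \<Rightarrow> deriv \<phi> x * h t)"
      using h by simp
  qed
  then have "integrable (lborel \<Otimes>\<^sub>M lborel) (\<lambda>(x, t). deriv \<phi> x * h t * prim_kernel x t)"
  proof (rule Bochner_Integration.integrable_bound)
    show "(\<lambda>(x, t). deriv \<phi> x * h t * prim_kernel x t) \<in> borel_measurable (lborel \<Otimes>\<^sub>M lborel)"
      by measurable
    show "AE p in lborel \<Otimes>\<^sub>M lborel. norm (case p of (x, t) \<Rightarrow> deriv \<phi> x * h t * prim_kernel x t)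
        \<le> norm (case p of (x, t) \<Rightarrow> deriv \<phi> x * h t)"
      by (rule AE_I2) (auto simp: prim_kernel_def indicator_def)
  qed
  from lborel_pair.Fubini_integral[OF this]
  have "(\<integral>t. (\<integral>x. deriv \<phi> x * h t * prim_kernel x t \<partial>lborel) \<partial>lborel)
      = (\<integral>x. (\<integral>t. deriv \<phi> x * h t * prim_kernel x t \<partial>lborel) \<partial>lborel)" .
  moreover have "(\<integral>x. deriv \<phi> x * h t * prim_kernel x t \<partial>lborel) = - (g t * \<phi> t)" for t
  proof -
    have int: "integrable lborel (\<lambda>x. deriv \<phi> x * indicator {t..} x)"
      using d(1) by (rule integrable_real_mult_indicator[rotated]) simp
    have "(\<integral>x. deriv \<phi> x * h t * prim_kernel x t \<partial>lborel)
        = (\<integral>x. h t * (deriv \<phi> x * indicator {t..} x - indicator {..0} t * deriv \<phi> x) \<partial>lborel)"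
      by (intro Bochner_Integration.integral_cong refl) (auto simp: prim_kernel_def indicator_def)
    also have "\<dots> = h t * (- \<phi> t)"
      using int d by simp
    also have "\<dots> = - (g t * \<phi> t)"
    proof (cases "\<bar>t\<bar> > r")
      case True
      then show ?thesis using r by simp
    next
      case False
      then have "t \<in> {-r..r}" by auto
      then show ?thesis by (simp add: h_def)
    qed
    finally show ?thesis .
  qed
  moreover have "(\<integral>t. deriv \<phi> x * h t * prim_kernel x t \<partial>lborel) = primitive g x * deriv \<phi> x" for x
  proof (cases "\<bar>x\<bar> > r")
    case True
    then show ?thesis using r by simp
  next
    case False
    then have "deriv \<phi> x * h t * prim_kernel x t = deriv \<phi> x * (g t * prim_kernel x t)" for t
      by (auto simp: h_def prim_kernel_def indicator_def)
    then have "(\<integral>t. deriv \<phi> x * h t * prim_kernel x t \<partial>lborel)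
        = (\<integral>t. deriv \<phi> x * (g t * prim_kernel x t) \<partial>lborel)"
      by (intro Bochner_Integration.integral_cong refl)
    then show ?thesis
      by (simp add: primitive_def mult.commute)
  qed
  ultimately show ?thesis
    by simp
qed

section \<open>From almost everywhere to everywhere\<close>

text \<open>A nonempty open exceptional set would contain a ball, which has positive
  measure.\<close>

lemma AE_everywhere_if_open:
  fixes P :: "real \<Rightarrow> bool"
  assumes "open {x. \<not> P x}" "AE x in lebesgue. P x"
  shows "P x"
proof (rule ccontr)
  assume "\<not> P x"
  then obtain e where e: "e > 0" "ball x e \<subseteq> {x. \<not> P x}"
    using assms(1) open_contains_ball by blast
  have "AE y in lebesgue. y \<notin> ball x e"
    using assms(2) by eventually_elim (use e in blast)
  then have "ball x e \<in> null_sets lebesgue"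
    by (subst (asm) AE_iff_null_sets[symmetric]) auto
  then have "emeasure lborel (ball x e) = 0"
    by (auto dest: null_setsD1)
  then show False
    using e by (simp add: ball_eq_greaterThanLessThan)
qed

lemma continuous_AE_eq_on:
  fixes f g :: "real \<Rightarrow> real"
  assumes "continuous_on UNIV f" "continuous_on UNIV g" "open S"
    and "AE x in lebesgue. x \<in> S \<longrightarrow> f x = g x" and "x \<in> S"
  shows "f x = g x"
proof -
  have "open {x. f x \<noteq> g x}"
    using assms(1,2) by (rule open_Collect_neq)
  moreover have "{x. \<not> (x \<in> S \<longrightarrow> f x = g x)} = S \<inter> {x. f x \<noteq> g x}"
    by auto
  ultimately show ?thesis
    using AE_everywhere_if_open[OF _ assms(4), of x] assms(3,5) by auto
qed

text \<open>The difference between \<open>F\<close> and the primitive of its weak derivative has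
  vanishing weak derivative, hence is constant almost everywhere; the representative is the
  primitive plus that constant.\<close>

lemma in_H1_continuous_rep:
  assumes "in_H1 F"
  obtains f where "continuous_on UNIV f" "AE x in lebesgue. F x = f x"
proof -
  obtain g where g: "in_L2 g" "weak_deriv F g"
    using assms by (auto simp: in_H1_def)
  \<comment> \<open>Fubini is applied on a product of Borel spaces, so a Borel version
    \<open>g0\<close> of the weak derivative is chosen.\<close>
  from g(1) have gm: "g \<in> borel_measurable (completion lborel)"
    by (simp add: in_L2_def)
  from completion_ex_borel_measurable_real[OF this] obtain g0 where
    g0: "g0 \<in> borel_measurable lborel" "AE x in lborel. g x = g0 x" by blast
  have g0': "AE x in lebesgue. g x = g0 x"
    using g0(2) by (rule AE_completion)
  have g0m: "g0 \<in> borel_measurable lebesgue"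
    using g0(1) by (rule measurable_completion)
  have L1: "locally_L1 F" "locally_L1 g"
    using g(2) by (auto simp: weak_deriv_def)
  have "locally_L1 g0"
    unfolding locally_L1_def
  proof (intro allI impI)
    fix C :: "real set" assume "compact C"
    then have "C \<in> sets borel"
      by (rule borel_compact)
    then have ind: "indicat_real C \<in> borel_measurable lebesgue"
      by (intro borel_measurable_indicator) auto
    have "integrable lebesgue (\<lambda>x. indicat_real C x * g x)"
      using L1(2) \<open>compact C\<close> by (simp add: locally_L1_def set_integrable_def)
    moreover have "AE x in lebesgue. indicat_real C x * g x = indicat_real C x * g0 x"
      using g0' by eventually_elim simp
    ultimately have "integrable lebesgue (\<lambda>x. indicat_real C x * g0 x)"
      by (subst (asm) integrable_cong_AE[OF borel_measurable_times[OF ind gm] borel_measurable_times[OF ind g0m]])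
    then show "set_integrable lebesgue C g0"
      by (simp add: set_integrable_def)
  qed
  moreover have "g0 \<in> borel_measurable borel"
    using g0(1) by simp
  ultimately have g0b: "g0 \<in> borel_measurable borel" "locally_L1 g0"
    by blast+
  let ?P = "primitive g0"
  note contP = continuous_primitive[OF g0b]
  have P: "locally_L1 ?P"
    using contP by (rule locally_L1_continuous)
  have w: "locally_L1 (\<lambda>x. F x + - 1 * ?P x)"
    by (intro locally_L1_add locally_L1_cmult L1 P)
  obtain c where c: "AE x in lebesgue. x \<in> UNIV \<longrightarrow> F x + - 1 * ?P x = c"
  proof (rule AE_const_if_weak_deriv_zero[OF w, of UNIV])
    fix \<phi> :: "real \<Rightarrow> real" assume \<phi>: "test_function \<phi>"
    have "(\<integral>x. F x * deriv \<phi> x \<partial>lebesgue) = - (\<integral>x. g x * \<phi> x \<partial>lebesgue)"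
      using g(2) \<phi> by (simp add: weak_deriv_def)
    also have "(\<integral>x. g x * \<phi> x \<partial>lebesgue) = (\<integral>x. g0 x * \<phi> x \<partial>lebesgue)"
      by (intro integral_cong_AE borel_measurable_integrable[OF locally_L1_test_integrable(1)] L1 g0b \<phi>)
        (use g0' in \<open>eventually_elim, simp\<close>)
    also have "\<dots> = (\<integral>x. g0 x * \<phi> x \<partial>lborel)"
    proof (rule integral_completion)
      have "continuous_on UNIV \<phi>"
        using test_functionD(1)[OF \<phi>] DERIV_isCont by (intro continuous_at_imp_continuous_on) blast
      then show "(\<lambda>x. g0 x * \<phi> x) \<in> borel_measurable lborel"
        using g0(1) borel_measurable_continuous_onI by (intro borel_measurable_times) auto
    qed
    also have "\<dots> = - (\<integral>x. ?P x * deriv \<phi> x \<partial>lborel)"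
      using integral_primitive_by_parts[OF g0b \<phi>] by simp
    also have "(\<integral>x. ?P x * deriv \<phi> x \<partial>lborel) = (\<integral>x. ?P x * deriv \<phi> x \<partial>lebesgue)"
      using borel_measurable_continuous_onI[OF contP]
        borel_measurable_continuous_onI[OF test_functionD(2)[OF \<phi>]]
      by (intro integral_completion[symmetric] borel_measurable_times) simp_all
    finally have "(\<integral>x. F x * deriv \<phi> x \<partial>lebesgue) = (\<integral>x. ?P x * deriv \<phi> x \<partial>lebesgue)"
      by simp
    then show "(\<integral>x. (F x + - 1 * ?P x) * deriv \<phi> x \<partial>lebesgue) = 0"
      using locally_L1_test_integrable(2)[OF L1(1) \<phi>] locally_L1_test_integrable(2)[OF P \<phi>]
      by (simp add: left_diff_distrib)
  qed (auto intro: open_UNIV is_interval_univ)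
  show ?thesis
  proof (rule that[of "\<lambda>x. ?P x + c"])
    show "continuous_on UNIV (\<lambda>x. ?P x + c)"
      using contP by (intro continuous_intros)
    show "AE x in lebesgue. F x = ?P x + c"
      using c by eventually_elim auto
  qed
qed

text \<open>Where the representative of \<open>F\<close> is positive, \<open>F * D = 0\<close>
  forces \<open>D = 0\<close> almost everywhere, so \<open>U\<close> is constant on the open
  interval; continuity carries the equality to the two end points.\<close>

lemma locally_constant_if_weak_deriv_zero:
  assumes U: "weak_deriv U D" and D: "AE x in lebesgue. F x * D x = 0"
    and u: "continuous_on UNIV u" "AE x in lebesgue. U x = u x"
    and f: "AE x in lebesgue. F x = f x"
    and "s \<le> t" and pos: "\<And>x. x \<in> {s..t} \<Longrightarrow> f x > 0"
  shows "u s = u t"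
proof (cases "s = t")
  case False
  let ?S = "{s<..<t}"
  have zero: "AE x in lebesgue. x \<in> ?S \<longrightarrow> D x = 0"
    using D f
  proof eventually_elim
    case (elim x)
    show ?case
    proof
      assume "x \<in> ?S"
      then have "f x > 0"
        by (intro pos) auto
      then show "D x = 0"
        using elim by simp
    qed
  qed
  obtain c where c: "AE x in lebesgue. x \<in> ?S \<longrightarrow> U x = c"
  proof (rule AE_const_if_weak_deriv_zero)
    show "locally_L1 U" "open ?S" "is_interval ?S"
      using U by (auto simp: weak_deriv_def is_interval_convex_1)
    fix \<phi> :: "real \<Rightarrow> real" and l r
    assume \<phi>: "test_function \<phi>" "{l..r} \<subseteq> ?S" "\<And>x. x \<notin> {l..r} \<Longrightarrow> \<phi> x = 0"
    have "AE x in lebesgue. D x * \<phi> x = 0"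
      using zero
    proof eventually_elim
      case (elim x)
      show ?case
      proof (cases "x \<in> {l..r}")
        case True
        with \<phi>(2) have "x \<in> ?S" by blast
        with elim show ?thesis by simp
      qed (use \<phi>(3) in simp)
    qed
    then have "(\<integral>x. D x * \<phi> x \<partial>lebesgue) = 0"
      by (rule integral_eq_zero_AE)
    then show "(\<integral>x. U x * deriv \<phi> x \<partial>lebesgue) = 0"
      using U \<phi>(1) by (simp add: weak_deriv_def)
  qed
  have ae: "AE x in lebesgue. x \<in> ?S \<longrightarrow> u x = c"
    using c u(2) by eventually_elim auto
  have uc: "u x = c" if "x \<in> ?S" for x
    by (rule continuous_AE_eq_on[OF u(1) continuous_on_const _ ae that]) simp
  have "u x = c" if "x \<in> closure ?S" for x
    using continuous_on_subset[OF u(1) subset_UNIV] uc that by (rule continuous_constant_on_closure)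
  moreover have "s < t"
    using False \<open>s \<le> t\<close> by simp
  ultimately show ?thesis
    by simp
qed simp

section \<open>The variational inequality for even solutions\<close>

text \<open>The zeros in \<open>{s..t}\<close> form a compact set. Later monotonicity arguments work
  under strict positivity up to this point, reach it by continuity, and restart from the value
  0.\<close>

lemma first_zero:
  fixes q :: "real \<Rightarrow> real"
  assumes "continuous_on UNIV q" "\<And>x. q x \<ge> 0" "s \<le> t" "q t = 0"
  obtains z where "s \<le> z" "z \<le> t" "q z = 0" "\<And>x. s \<le> x \<Longrightarrow> x < z \<Longrightarrow> q x > 0"
proof -
  let ?Z = "{s..t} \<inter> q -` {0}"
  have "closed (q -` {0})"
    using assms(1) by (intro continuous_closed_vimage) (auto simp: continuous_on_eq_continuous_at)
  then have "compact ?Z"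
    by (intro compact_Int_closed) auto
  moreover have "?Z \<noteq> {}"
    using assms(3,4) by auto
  ultimately obtain z where z: "z \<in> ?Z" "\<forall>x\<in>?Z. z \<le> x"
    using compact_attains_inf by blast
  show ?thesis
  proof (rule that[of z])
    show "q x > 0" if "s \<le> x" "x < z" for x
    proof -
      have "x \<notin> ?Z"
        using z(2) that(2) by (meson not_le)
      then have "q x \<noteq> 0"
        using that z(1) by auto
      then show ?thesis
        using assms(2)[of x] by simp
    qed
  qed (use z(1) in auto)
qed

lemma last_zero:
  fixes q :: "real \<Rightarrow> real"
  assumes "continuous_on UNIV q" "\<And>x. q x \<ge> 0" "s \<le> t" "q s = 0"
  obtains z where "s \<le> z" "z \<le> t" "q z = 0" "\<And>x. z < x \<Longrightarrow> x \<le> t \<Longrightarrow> q x > 0"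
proof -
  have "continuous_on UNIV (\<lambda>x. q (- x))"
    by (rule continuous_on_compose2[OF assms(1)]) (auto intro: continuous_intros)
  from first_zero[OF this, of "- t" "- s"] assms obtain z where
    z: "- t \<le> z" "z \<le> - s" "q (- z) = 0" "\<And>x. - t \<le> x \<Longrightarrow> x < z \<Longrightarrow> q (- x) > 0"
    by auto
  show ?thesis
  proof (rule that[of "- z"])
    show "q x > 0" if "- z < x" "x \<le> t" for x
      using z(4)[of "- x"] that by simp
  qed (use z in auto)
qed

lemma ge_at_right_end:
  fixes W :: "real \<Rightarrow> real"
  assumes "continuous_on UNIV W" "s \<le> z" "\<And>x. s \<le> x \<Longrightarrow> x < z \<Longrightarrow> W s \<le> W x"
  shows "W s \<le> W z"
proof (cases "s = z")
  case False
  then have "closure {s<..<z} = {s..z}"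
    using assms(2) by simp
  then show ?thesis
    using assms(2,3) continuous_on_subset[OF assms(1) subset_UNIV]
    by (intro continuous_ge_on_closure[of "{s<..<z}" W z "W s"]) auto
qed simp

lemma ge_at_left_end:
  fixes W :: "real \<Rightarrow> real"
  assumes "continuous_on UNIV W" "z \<le> t" "\<And>x. z < x \<Longrightarrow> x \<le> t \<Longrightarrow> W t \<le> W x"
  shows "W t \<le> W z"
proof -
  have "continuous_on UNIV (\<lambda>x. W (- x))"
    by (rule continuous_on_compose2[OF assms(1)]) (auto intro: continuous_intros)
  from ge_at_right_end[OF this, of "- t" "- z"] assms(2,3) show ?thesis
    by simp
qed

section \<open>Two-phase pairs on the half-line\<close>

text \<open>The integrated form of one equation: no derivative occurs, so the condition makes sense
  for functions that are merely continuous.\<close>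

definition stationary :: "real \<Rightarrow> real \<Rightarrow> (real \<Rightarrow> real) \<Rightarrow> (real \<Rightarrow> real) \<Rightarrow> bool" where
  "stationary A B p q \<longleftrightarrow>
     (\<forall>s t. s \<le> t \<longrightarrow> (\<forall>x\<in>{s..t}. p x > 0) \<longrightarrow> A * p s + B * q s + s\<^sup>2 = A * p t + B * q t + t\<^sup>2)"

text \<open>With four abstract coefficients the assumptions are invariant under exchanging the
  phases, so every one-sided argument serves for both. The determinant condition makes the linear
  system for \<open>(p, q)\<close> solvable where both phases are present.\<close>

locale two_phase =
  fixes A B C D :: real and p q :: "real \<Rightarrow> real"
  assumes pos: "A > 0" "B > 0" "C > 0" "D > 0" and det: "B * C < A * D"
    and cont: "continuous_on UNIV p" "continuous_on UNIV q"
    and nonneg: "\<And>x. p x \<ge> 0" "\<And>x. q x \<ge> 0"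
    and even: "\<And>x. p (- x) = p x" "\<And>x. q (- x) = q x"
    and stat: "stationary A B p q" "stationary D C q p"
    and nonzero: "\<exists>x. p x > 0" "\<exists>x. q x > 0"
begin

lemma swap: "two_phase D C B A q p"
  using pos det cont nonneg even stat nonzero by unfold_locales (auto simp: mult.commute)

lemma stat_p:
  assumes "s \<le> t" "\<And>x. s \<le> x \<Longrightarrow> x \<le> t \<Longrightarrow> p x > 0"
  shows "A * p s + B * q s + s\<^sup>2 = A * p t + B * q t + t\<^sup>2"
  using stat(1) assms by (simp add: stationary_def)

lemma stat_q:
  assumes "s \<le> t" "\<And>x. s \<le> x \<Longrightarrow> x \<le> t \<Longrightarrow> q x > 0"
  shows "C * p s + D * q s + s\<^sup>2 = C * p t + D * q t + t\<^sup>2"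
  using stat(2) assms by (simp add: stationary_def add_ac)

lemma zero_or_pos: "p x = 0 \<or> p x > 0" "q x = 0 \<or> q x > 0"
  using nonneg[of x] by auto

text \<open>Cramer's rule for the two stationarity identities. Where both phases are positive, the
  signs of \<open>D - B\<close> and \<open>A - C\<close> decide the monotonicity of \<open>p\<close>
  and \<open>q\<close>.\<close>

lemma mixed_slopes:
  assumes "s \<le> t" "\<And>x. s \<le> x \<Longrightarrow> x \<le> t \<Longrightarrow> p x > 0" "\<And>x. s \<le> x \<Longrightarrow> x \<le> t \<Longrightarrow> q x > 0"
  shows "(A * D - B * C) * (p s - p t) = (D - B) * (t\<^sup>2 - s\<^sup>2)"
    and "(A * D - B * C) * (q s - q t) = (A - C) * (t\<^sup>2 - s\<^sup>2)"
proof -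
  have p: "t\<^sup>2 - s\<^sup>2 = A * (p s - p t) + B * (q s - q t)"
    using stat_p[OF assms(1,2)] by (simp add: algebra_simps)
  have q: "t\<^sup>2 - s\<^sup>2 = C * (p s - p t) + D * (q s - q t)"
    using stat_q[OF assms(1,3)] by (simp add: algebra_simps)
  have "(D - B) * (t\<^sup>2 - s\<^sup>2) = D * (t\<^sup>2 - s\<^sup>2) - B * (t\<^sup>2 - s\<^sup>2)"
    by (simp add: algebra_simps)
  also have "\<dots> = D * (A * (p s - p t) + B * (q s - q t)) - B * (C * (p s - p t) + D * (q s - q t))"
    using p q by presburger
  finally show "(A * D - B * C) * (p s - p t) = (D - B) * (t\<^sup>2 - s\<^sup>2)"
    by (simp add: algebra_simps)
  have "(A - C) * (t\<^sup>2 - s\<^sup>2) = A * (t\<^sup>2 - s\<^sup>2) - C * (t\<^sup>2 - s\<^sup>2)"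
    by (simp add: algebra_simps)
  also have "\<dots> = A * (C * (p s - p t) + D * (q s - q t)) - C * (A * (p s - p t) + B * (q s - q t))"
    using p q by presburger
  finally show "(A * D - B * C) * (q s - q t) = (A - C) * (t\<^sup>2 - s\<^sup>2)"
    by (simp add: algebra_simps)
qed

lemma sq_mono: "0 \<le> s \<Longrightarrow> s \<le> t \<Longrightarrow> s\<^sup>2 \<le> (t::real)\<^sup>2"
  by (rule power_mono)

text \<open>Where \<open>p\<close> has a sign, \<open>B q + x\<^sup>2\<close> is monotone across every zero of \<open>q\<close>: it equals \<open>x\<^sup>2\<close> there and
  dominates it everywhere.\<close>

lemma Bq_mono:
  assumes DB: "B \<le> D" and "0 \<le> s" "s \<le> t"
    and sign: "(\<forall>x. s \<le> x \<longrightarrow> x \<le> t \<longrightarrow> p x > 0) \<or> (\<forall>x. s \<le> x \<longrightarrow> x \<le> t \<longrightarrow> p x = 0)"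
  shows "B * q s + s\<^sup>2 \<le> B * q t + t\<^sup>2"
proof -
  \<comment> \<open>The case without a zero of \<open>q\<close>. If \<open>p > 0\<close>, Cramer's
    rule makes \<open>p\<close> decrease, and stationarity turns this into growth of
    \<open>B * q x + x\<^sup>2\<close>. If \<open>p = 0\<close>, then
    \<open>D * q x + x\<^sup>2\<close> is constant, so \<open>q\<close> decreases, and
    \<open>B \<le> D\<close> leaves the growth of \<open>x\<^sup>2\<close> dominant.\<close>
  have base: "B * q s + s\<^sup>2 \<le> B * q r + r\<^sup>2"
    if r: "s \<le> r" "r \<le> t" and q: "\<And>x. s \<le> x \<Longrightarrow> x \<le> r \<Longrightarrow> q x > 0" for r
    using sign
  proof
    assume "\<forall>x. s \<le> x \<longrightarrow> x \<le> t \<longrightarrow> p x > 0"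
    then have p: "\<And>x. s \<le> x \<Longrightarrow> x \<le> r \<Longrightarrow> p x > 0"
      using r by auto
    have "(D - B) * (r\<^sup>2 - s\<^sup>2) \<ge> 0"
      using DB sq_mono[OF \<open>0 \<le> s\<close> r(1)] by simp
    moreover have "(A * D - B * C) * (p s - p r) = (D - B) * (r\<^sup>2 - s\<^sup>2)"
      by (rule mixed_slopes(1)) (use r p q in auto)
    ultimately have "(A * D - B * C) * (p s - p r) \<ge> 0"
      by argo
    then have "p s - p r \<ge> 0"
      using det by (simp add: zero_le_mult_iff)
    then have "A * p s \<ge> A * p r"
      using pos by simp
    then show ?thesis
      using stat_p[OF r(1) p] by linarith
  next
    assume "\<forall>x. s \<le> x \<longrightarrow> x \<le> t \<longrightarrow> p x = 0"
    then have "p s = 0" "p r = 0"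
      using r by auto
    then have "D * (q s - q r) = r\<^sup>2 - s\<^sup>2"
      using stat_q[OF r(1) q] by (simp add: algebra_simps)
    moreover have "r\<^sup>2 - s\<^sup>2 \<ge> 0"
      using sq_mono[OF \<open>0 \<le> s\<close> r(1)] by simp
    ultimately have "q s - q r \<ge> 0"
      using pos(4) by (metis zero_le_mult_iff not_le)
    then have "B * (q s - q r) \<le> D * (q s - q r)"
      using DB by (rule mult_right_mono[rotated])
    with \<open>D * (q s - q r) = r\<^sup>2 - s\<^sup>2\<close> show ?thesis
      by (simp add: algebra_simps)
  qed
  show ?thesis
  proof (cases "\<forall>x. s \<le> x \<longrightarrow> x \<le> t \<longrightarrow> q x > 0")
    case True
    then show ?thesis
      using base[of t] \<open>s \<le> t\<close> by simp
  next
    case False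
    then obtain z0 where z0: "s \<le> z0" "z0 \<le> t" "q z0 = 0"
      using zero_or_pos by blast
    obtain z where z: "s \<le> z" "z \<le> z0" "q z = 0" "\<And>x. s \<le> x \<Longrightarrow> x < z \<Longrightarrow> q x > 0"
      using first_zero[OF cont(2) nonneg(2) z0(1,3)] by blast
    have "continuous_on UNIV (\<lambda>x. B * q x + x\<^sup>2)"
      using cont by (intro continuous_intros)
    then have "B * q s + s\<^sup>2 \<le> B * q z + z\<^sup>2"
    proof (rule ge_at_right_end[OF _ z(1)])
      show "B * q s + s\<^sup>2 \<le> B * q x + x\<^sup>2" if "s \<le> x" "x < z" for x
        using base[of x] that z z0 by simp
    qed
    also have "\<dots> = z\<^sup>2"
      using z by simp
    also have "z\<^sup>2 \<le> t\<^sup>2"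
      using z z0 \<open>0 \<le> s\<close> by (intro sq_mono) auto
    also have "\<dots> \<le> B * q t + t\<^sup>2"
      using pos nonneg(2)[of t] by simp
    finally show ?thesis .
  qed
qed

text \<open>On \<open>{p > 0}\<close> stationarity makes \<open>A * p x\<close> a constant minus
  \<open>B * q x + x\<^sup>2\<close>, which grows by \<open>Bq_mono\<close>. A zero of
  \<open>p\<close> propagates to the right: from the last zero before \<open>t\<close> onwards, the
  same monotonicity gives \<open>p t \<le> 0\<close>.\<close>

lemma p_antimono:
  assumes DB: "B \<le> D" and "0 \<le> s" "s \<le> t"
  shows "p t \<le> p s"
proof -
  have base: "p t \<le> p r" if r: "s \<le> r" "r \<le> t" and p: "\<And>x. r \<le> x \<Longrightarrow> x \<le> t \<Longrightarrow> p x > 0" for r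
  proof -
    have "B * q r + r\<^sup>2 \<le> B * q t + t\<^sup>2"
      using r p \<open>0 \<le> s\<close> by (intro Bq_mono DB) auto
    then have "A * p t \<le> A * p r"
      using stat_p[OF r(2) p] by linarith
    then show ?thesis
      using pos by simp
  qed
  show ?thesis
  proof (cases "\<forall>x. s \<le> x \<longrightarrow> x \<le> t \<longrightarrow> p x > 0")
    case True
    then show ?thesis
      using base[of s] \<open>s \<le> t\<close> by simp
  next
    case False
    then obtain z0 where z0: "s \<le> z0" "z0 \<le> t" "p z0 = 0"
      using zero_or_pos by blast
    obtain z where z: "z0 \<le> z" "z \<le> t" "p z = 0" "\<And>x. z < x \<Longrightarrow> x \<le> t \<Longrightarrow> p x > 0"
      using last_zero[OF cont(1) nonneg(1) z0(2,3)] by blast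
    have "p t \<le> p z"
      using z z0 by (intro ge_at_left_end[OF cont(1) z(2)] base) auto
    then show ?thesis
      using z(3) nonneg(1)[of s] by simp
  qed
qed

lemma abs_eq: "p \<bar>x\<bar> = p x" "q \<bar>x\<bar> = q x"
  using even by (simp_all add: abs_if)

text \<open>Since \<open>p\<close> decreases, \<open>{p > 0}\<close> is an interval about 0, and the
  constant is the value at 0. Beyond the first zero \<open>p\<close> stays 0, and what remains is
  \<open>B * q x + x\<^sup>2\<close>, which increases by \<open>Bq_mono\<close>.\<close>

lemma variational_p:
  assumes DB: "B \<le> D"
  shows "\<exists>c. \<forall>x. c \<le> A * p x + B * q x + x\<^sup>2 \<and> (p x > 0 \<longrightarrow> A * p x + B * q x + x\<^sup>2 = c)"
proof -
  let ?U = "\<lambda>x. A * p x + B * q x + x\<^sup>2"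
  have contU: "continuous_on UNIV ?U"
    using cont by (intro continuous_intros)
  obtain x1 where "p x1 > 0"
    using nonzero by blast
  have "p x1 \<le> p 0"
    using p_antimono[OF DB, of 0 "\<bar>x1\<bar>"] by (simp add: abs_eq)
  have const: "?U x = ?U 0" if "0 \<le> x" "p x > 0" for x
    using stat_p[of 0 x] that p_antimono[OF DB, of _ x] by (metis order.strict_trans2)
  have ge: "?U 0 \<le> ?U x" if x: "0 \<le> x" "p x = 0" for x
  proof -
    obtain z where z: "0 \<le> z" "z \<le> x" "p z = 0" "\<And>y. 0 \<le> y \<Longrightarrow> y < z \<Longrightarrow> p y > 0"
      using first_zero[OF cont(1) nonneg(1) x] by blast
    have "?U 0 \<le> ?U z"
    proof (rule ge_at_right_end[OF contU z(1)])
      show "?U 0 \<le> ?U y" if "0 \<le> y" "y < z" for y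
        using const[of y] z(4)[of y] that by simp
    qed
    moreover have "p y = 0" if "z \<le> y" for y
      using p_antimono[OF DB z(1) that] z(3) nonneg(1)[of y] by simp
    then have "B * q z + z\<^sup>2 \<le> B * q x + x\<^sup>2"
      using z by (intro Bq_mono DB) auto
    ultimately show ?thesis
      using x z by simp
  qed
  have "?U 0 \<le> ?U \<bar>x\<bar> \<and> (p \<bar>x\<bar> > 0 \<longrightarrow> ?U \<bar>x\<bar> = ?U 0)" for x
    using const[of "\<bar>x\<bar>"] ge[of "\<bar>x\<bar>"] zero_or_pos(1)[of "\<bar>x\<bar>"] by auto
  then show ?thesis
    by (auto simp: abs_eq)
qed

text \<open>Inside the support of \<open>p\<close>, \<open>q\<close> cannot fall once it is
  positive; outside it cannot rise. Hence \<open>{q > 0}\<close> meets the half-line in an interval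
  and carries one constant. The zeros to its left lie where the first potential controls
  \<open>p\<close>, those to its right are separated from it by a zero of \<open>p\<close>; the
  lower bound has a different reason on each side.\<close>

lemma variational_q:
  assumes AC: "A < C"
  shows "\<exists>d. \<forall>x. d \<le> C * p x + D * q x + x\<^sup>2 \<and> (q x > 0 \<longrightarrow> C * p x + D * q x + x\<^sup>2 = d)"
proof -
  have DB: "B \<le> D"
  proof (rule ccontr)
    assume "\<not> B \<le> D"
    then have "A * D \<le> C * B"
      using AC pos by (intro mult_mono) auto
    then show False
      using det by (simp add: mult.commute)
  qed
  note anti = p_antimono[OF DB]
  have inc: "q s \<le> q t" if st: "0 \<le> s" "s \<le> t" "q s > 0" "p t > 0" for s t
  proof -
    have p: "p x > 0" if "s \<le> x" "x \<le> t" for x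
      using anti[of x t] that st by linarith
    have base: "q s \<le> q r" if r: "s \<le> r" "r \<le> t" and q: "\<And>x. s \<le> x \<Longrightarrow> x \<le> r \<Longrightarrow> q x > 0" for r
    proof -
      have pr: "\<And>x. s \<le> x \<Longrightarrow> x \<le> r \<Longrightarrow> p x > 0"
        using p r by simp
      have "(C - A) * (r\<^sup>2 - s\<^sup>2) \<ge> 0"
        using AC sq_mono[OF st(1) r(1)] by simp
      moreover have "(A * D - B * C) * (q s - q r) = (A - C) * (r\<^sup>2 - s\<^sup>2)"
        by (rule mixed_slopes(2)) (use r pr q in auto)
      ultimately have "(A * D - B * C) * (q r - q s) \<ge> 0"
        by argo
      then show ?thesis
        using det by (simp add: zero_le_mult_iff)
    qed
    show ?thesis
    proof (cases "\<forall>x. s \<le> x \<longrightarrow> x \<le> t \<longrightarrow> q x > 0")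
      case True
      then show ?thesis
        using base[of t] st by simp
    next
      case False
      then obtain z0 where z0: "s \<le> z0" "z0 \<le> t" "q z0 = 0"
        using zero_or_pos by blast
      obtain z where z: "s \<le> z" "z \<le> z0" "q z = 0" "\<And>x. s \<le> x \<Longrightarrow> x < z \<Longrightarrow> q x > 0"
        using first_zero[OF cont(2) nonneg(2) z0(1,3)] by blast
      have "q s \<le> q z"
        using z z0 by (intro ge_at_right_end[OF cont(2) z(1)] base) auto
      then show ?thesis
        using z(3) st(3) by simp
    qed
  qed
  have dec: "q t \<le> q s" if st: "0 \<le> s" "s \<le> t" "p s = 0" for s t
  proof -
    have p: "p x = 0" if "s \<le> x" for x
      using anti[OF st(1) that] st(3) nonneg(1)[of x] by simp
    have base: "q t \<le> q r" if r: "s \<le> r" "r \<le> t" and q: "\<And>x. r \<le> x \<Longrightarrow> x \<le> t \<Longrightarrow> q x > 0" for r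
    proof -
      have "D * q r + r\<^sup>2 = D * q t + t\<^sup>2"
        using stat_q[OF r(2) q] p[of r] p[of t] r st by simp
      moreover have "r\<^sup>2 \<le> t\<^sup>2"
        using st r by (intro sq_mono) auto
      ultimately have "D * q t \<le> D * q r"
        by linarith
      then show ?thesis
        using pos by simp
    qed
    show ?thesis
    proof (cases "\<forall>x. s \<le> x \<longrightarrow> x \<le> t \<longrightarrow> q x > 0")
      case True
      then show ?thesis
        using base[of s] st by simp
    next
      case False
      then obtain z0 where z0: "s \<le> z0" "z0 \<le> t" "q z0 = 0"
        using zero_or_pos by blast
      obtain z where z: "z0 \<le> z" "z \<le> t" "q z = 0" "\<And>x. z < x \<Longrightarrow> x \<le> t \<Longrightarrow> q x > 0"
        using last_zero[OF cont(2) nonneg(2) z0(2,3)] by blast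
      have "q t \<le> q z"
        using z z0 by (intro ge_at_left_end[OF cont(2) z(2)] base) auto
      then show ?thesis
        using z(3) nonneg(2)[of s] by simp
    qed
  qed
  have convex: "q r > 0" if "0 \<le> s" "s \<le> r" "r \<le> t" "q s > 0" "q t > 0" for s r t
    using zero_or_pos(1)[of r] inc[of s r] dec[of r t] that by linarith
  let ?V = "\<lambda>x. C * p x + D * q x + x\<^sup>2"
  have contV: "continuous_on UNIV ?V"
    using cont by (intro continuous_intros)
  obtain x1 where "q x1 > 0"
    using nonzero by blast
  define x0 where "x0 = \<bar>x1\<bar>"
  have x0: "0 \<le> x0" "q x0 > 0"
    using \<open>q x1 > 0\<close> by (auto simp: x0_def abs_eq)
  have const: "?V x = ?V x0" if "0 \<le> x" "q x > 0" for x
  proof (cases "x \<le> x0")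
    case True
    then show ?thesis
      using convex[of x _ x0] that x0 by (intro stat_q) auto
  next
    case False
    then show ?thesis
      using convex[of x0 _ x] that x0 by (intro stat_q[symmetric]) auto
  qed
  have ge: "?V x0 \<le> ?V x" if x: "0 \<le> x" "q x = 0" for x
  proof (cases "x \<le> x0")
    case True
    obtain z where z: "x \<le> z" "z \<le> x0" "q z = 0" "\<And>y. z < y \<Longrightarrow> y \<le> x0 \<Longrightarrow> q y > 0"
      using last_zero[OF cont(2) nonneg(2) True x(2)] by blast
    have "?V x0 \<le> ?V z"
    proof (rule ge_at_left_end[OF contV z(2)])
      show "?V x0 \<le> ?V y" if "z < y" "y \<le> x0" for y
        using const[of y] z(4)[of y] z(1) that x by simp
    qed
    \<comment> \<open>If \<open>p\<close> vanished at \<open>z\<close>, then \<open>q\<close> could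
      not rise beyond \<open>z\<close> and would not be positive at \<open>x0\<close>.\<close>
    moreover have "p z > 0"
      using dec[of z x0] z x x0 zero_or_pos(1)[of z] by linarith
    then have "p y > 0" if "x \<le> y" "y \<le> z" for y
      using anti[of y z] that x by linarith
    \<comment> \<open>Both end points are zeros of \<open>q\<close>, so the first potential compares
      \<open>p\<close> alone; replacing \<open>A\<close> by the larger \<open>C\<close> then tilts
      the equality in the wanted direction.\<close>
    then have eq: "A * p x + x\<^sup>2 = A * p z + z\<^sup>2"
      using stat_p[OF z(1)] x(2) z(3) by simp
    have "A * (p x - p z) \<le> C * (p x - p z)"
      using AC anti[OF x(1) z(1)] by (intro mult_right_mono) auto
    with eq have "C * p z + z\<^sup>2 \<le> C * p x + x\<^sup>2"
      by (simp add: algebra_simps)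
    ultimately show ?thesis
      using x z by simp
  next
    case False
    then have "x0 \<le> x" by simp
    obtain z where z: "x0 \<le> z" "z \<le> x" "q z = 0" "\<And>y. x0 \<le> y \<Longrightarrow> y < z \<Longrightarrow> q y > 0"
      using first_zero[OF cont(2) nonneg(2) \<open>x0 \<le> x\<close> x(2)] by blast
    have "?V x0 \<le> ?V z"
    proof (rule ge_at_right_end[OF contV z(1)])
      show "?V x0 \<le> ?V y" if "x0 \<le> y" "y < z" for y
        using const[of y] z(4)[of y] that x0 by simp
    qed
    \<comment> \<open>Otherwise \<open>q\<close> could not have come down from a positive value at
      \<open>x0\<close> to 0 at \<open>z\<close>.\<close>
    moreover have "p z = 0"
      using inc[of x0 z] z x0 zero_or_pos(1)[of z] by linarith
    moreover have "z\<^sup>2 \<le> x\<^sup>2"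
      using z x0 by (intro sq_mono) auto
    moreover have "C * p x \<ge> 0"
      using pos nonneg by simp
    ultimately show ?thesis
      using x z by simp
  qed
  have "?V x0 \<le> ?V \<bar>x\<bar> \<and> (q \<bar>x\<bar> > 0 \<longrightarrow> ?V \<bar>x\<bar> = ?V x0)" for x
    using const[of "\<bar>x\<bar>"] ge[of "\<bar>x\<bar>"] zero_or_pos(2)[of "\<bar>x\<bar>"] by auto
  then show ?thesis
    by (auto simp: abs_eq)
qed

end

text \<open>Each inequality has two sources: \<open>D < B\<close> is the hypothesis
  \<open>A < C\<close> of \<open>variational_q\<close> for the exchanged pair, and
  \<open>C \<le> A\<close> is the hypothesis \<open>B \<le> D\<close> of
  \<open>variational_p\<close> for it.\<close>

lemma (in two_phase) variational_both:
  obtains c d where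
    "\<And>x. c \<le> A * p x + B * q x + x\<^sup>2" "\<And>x. p x > 0 \<Longrightarrow> A * p x + B * q x + x\<^sup>2 = c"
    "\<And>x. d \<le> C * p x + D * q x + x\<^sup>2" "\<And>x. q x > 0 \<Longrightarrow> C * p x + D * q x + x\<^sup>2 = d"
proof -
  interpret sw: two_phase D C B A q p
    by (rule swap)
  have "\<exists>c. \<forall>x. c \<le> A * p x + B * q x + x\<^sup>2 \<and> (p x > 0 \<longrightarrow> A * p x + B * q x + x\<^sup>2 = c)"
    using variational_p sw.variational_q by (cases "B \<le> D") (simp_all add: add.commute)
  moreover have "\<exists>d. \<forall>x. d \<le> C * p x + D * q x + x\<^sup>2 \<and> (q x > 0 \<longrightarrow> C * p x + D * q x + x\<^sup>2 = d)"
    using variational_q sw.variational_p by (cases "A < C") (simp_all add: add.commute)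
  ultimately show ?thesis
    using that by blast
qed

section \<open>Uniqueness\<close>

text \<open>Equal masses make the integral of the linear combination \<open>L\<close> vanish, and
  the quadratic form bounds \<open>A * L\<close> from below by a nonnegative quantity. Thus
  \<open>L\<close> is nonnegative with integral zero, the form vanishes almost everywhere, and
  continuity gives equality everywhere.\<close>

lemma two_phase_unique:
  assumes tp: "two_phase A B C D p q" "two_phase A B C D p' q'"
    and int: "integrable lebesgue p" "integrable lebesgue q" "integrable lebesgue p'" "integrable lebesgue q'"
    and mass: "integral\<^sup>L lebesgue p = integral\<^sup>L lebesgue p'" "integral\<^sup>L lebesgue q = integral\<^sup>L lebesgue q'"
  shows "p = p'" "q = q'"
proof -
  interpret S: two_phase A B C D p q by (rule tp)
  interpret S': two_phase A B C D p' q' by (rule tp)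
  let ?U = "\<lambda>x. A * p x + B * q x + x\<^sup>2" and ?V = "\<lambda>x. C * p x + D * q x + x\<^sup>2"
  let ?U' = "\<lambda>x. A * p' x + B * q' x + x\<^sup>2" and ?V' = "\<lambda>x. C * p' x + D * q' x + x\<^sup>2"
  obtain c d where cd: "\<And>x. c \<le> ?U x" "\<And>x. p x > 0 \<Longrightarrow> ?U x = c" "\<And>x. d \<le> ?V x" "\<And>x. q x > 0 \<Longrightarrow> ?V x = d"
    by (rule S.variational_both) blast
  obtain c' d' where cd': "\<And>x. c' \<le> ?U' x" "\<And>x. p' x > 0 \<Longrightarrow> ?U' x = c'"
    "\<And>x. d' \<le> ?V' x" "\<And>x. q' x > 0 \<Longrightarrow> ?V' x = d'"
    by (rule S'.variational_both) blast
  \<comment> \<open>The weights \<open>C\<close> and \<open>B\<close> give both mixed terms of the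
    quadratic form the coefficient \<open>B * C\<close>, which makes it symmetric.\<close>
  define L where "L x = C * (c - c') * (p x - p' x) + B * (d - d') * (q x - q' x)" for x
  \<comment> \<open>Complementarity: either \<open>v > 0\<close> and the first factor vanishes, or
    \<open>v = 0\<close> and the factors have opposite signs.\<close>
  have comp: "(u - c) * (v - v') \<le> 0" if "c \<le> u" "v > 0 \<Longrightarrow> u = c" "0 \<le> v" "0 \<le> v'" for u c v v' :: real
    using that by (cases "v = 0") (auto simp: mult_le_0_iff)
  \<comment> \<open>Multiplying the form by \<open>A\<close> completes the square and exposes the
    determinant as the coefficient of the remainder.\<close>
  have Q: "C * (A * (p x - p' x) + B * (q x - q' x))\<^sup>2 + B * (A * D - B * C) * (q x - q' x)\<^sup>2 \<le> A * L x" for x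
  proof -
    have "(?U x - c) * (p x - p' x) \<le> 0" "(?U' x - c') * (p' x - p x) \<le> 0"
      "(?V x - d) * (q x - q' x) \<le> 0" "(?V' x - d') * (q' x - q x) \<le> 0"
      by (intro comp cd cd' S.nonneg S'.nonneg; assumption)+
    then have "C * ((?U x - c) * (p x - p' x) + (?U' x - c') * (p' x - p x)) \<le> 0"
      "B * ((?V x - d) * (q x - q' x) + (?V' x - d') * (q' x - q x)) \<le> 0"
      using S.pos by (simp_all add: mult_le_0_iff add_nonpos_nonpos)
    then have "C * ((?U x - ?U' x) * (p x - p' x)) + B * ((?V x - ?V' x) * (q x - q' x)) \<le> L x"
      unfolding L_def by (simp add: algebra_simps)
    then have "A * (C * ((?U x - ?U' x) * (p x - p' x)) + B * ((?V x - ?V' x) * (q x - q' x))) \<le> A * L x"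
      using S.pos by simp
    then show ?thesis
      by (simp add: algebra_simps power2_eq_square)
  qed
  have nonneg: "0 \<le> C * (A * (p x - p' x) + B * (q x - q' x))\<^sup>2" "0 \<le> B * (A * D - B * C) * (q x - q' x)\<^sup>2" for x
    using S.pos S.det by simp_all
  have L_nonneg: "0 \<le> L x" for x
  proof -
    have "0 \<le> A * L x"
      using Q[of x] nonneg[of x] by linarith
    then show ?thesis
      using S.pos by (simp add: zero_le_mult_iff)
  qed
  have intL: "integrable lebesgue L"
    unfolding L_def[abs_def] using int by (intro Bochner_Integration.integrable_add integrable_mult_right
        Bochner_Integration.integrable_diff)
  have "integral\<^sup>L lebesgue L = 0"
    unfolding L_def[abs_def] using int mass by simp
  then have "AE x in lebesgue. L x = 0"
    using intL L_nonneg by (subst (asm) integral_nonneg_eq_0_iff_AE) auto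
  then have "AE x in lebesgue. p x = p' x \<and> q x = q' x"
  proof eventually_elim
    case (elim x)
    then have "C * (A * (p x - p' x) + B * (q x - q' x))\<^sup>2 + B * (A * D - B * C) * (q x - q' x)\<^sup>2 \<le> 0"
      using Q[of x] by simp
    with nonneg[of x] have "C * (A * (p x - p' x) + B * (q x - q' x))\<^sup>2 = 0"
      "B * (A * D - B * C) * (q x - q' x)\<^sup>2 = 0"
      by linarith+
    then show ?case
      using S.pos S.det by simp
  qed
  then have ae: "AE x in lebesgue. x \<in> UNIV \<longrightarrow> p x = p' x" "AE x in lebesgue. x \<in> UNIV \<longrightarrow> q x = q' x"
    by (eventually_elim, simp)+
  show "p = p'"
    by (rule ext, rule continuous_AE_eq_on[OF S.cont(1) S'.cont(1) open_UNIV ae(1) UNIV_I])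
  show "q = q'"
    by (rule ext, rule continuous_AE_eq_on[OF S.cont(2) S'.cont(2) open_UNIV ae(2) UNIV_I])
qed

section \<open>From weak solutions to two-phase pairs\<close>

lemma AE_lebesgue_uminus:
  assumes "AE x in lebesgue. P (x::real)"
  shows "AE x in lebesgue. P (- x)"
proof -
  obtain N where N: "negligible N" "{x. \<not> P x} \<subseteq> N"
    using assms eventually_ae_filter_negligible by blast
  have "negligible (uminus ` N)"
    using N(1) by (intro negligible_differentiable_image_negligible) (auto intro!: derivative_intros simp: differentiable_on_def)
  moreover have "{x. \<not> P (- x)} \<subseteq> uminus ` N"
  proof
    fix x assume "x \<in> {x. \<not> P (- x)}"
    then have "- x \<in> N" using N(2) by auto
    then show "x \<in> uminus ` N" by force
  qed
  ultimately show ?thesis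
    using eventually_ae_filter_negligible by blast
qed

text \<open>The weight is at least 1, so weighted integrability dominates plain integrability.
  Nonnegativity passes from almost everywhere to everywhere because \<open>{x. f x < 0}\<close> is
  open, and unit mass excludes the zero function.\<close>

lemma in_K_rep:
  assumes "in_K w" "continuous_on UNIV f" "AE x in lebesgue. w x = f x"
  shows "\<And>x. f x \<ge> 0" "integrable lebesgue f" "integral\<^sup>L lebesgue f = 1" "\<exists>x. f x > 0"
proof -
  have w: "integrable (density lebesgue (\<lambda>x. ennreal (1 + x\<^sup>2))) w" "w \<in> borel_measurable lebesgue"
    "AE x in lebesgue. 0 \<le> w x" "(\<integral>x. \<bar>w x\<bar> \<partial>lebesgue) = 1"
    using assms(1) by (auto simp: in_K_def in_L2_def)
  have f0: "AE x in lebesgue. 0 \<le> f x"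
    using w(3) assms(3) by eventually_elim simp
  show f_nonneg: "f x \<ge> 0" for x
  proof (rule AE_everywhere_if_open[OF _ f0])
    have "{x. \<not> 0 \<le> f x} = {x. f x < 0}" by auto
    then show "open {x. \<not> 0 \<le> f x}"
      using assms(2) by (simp add: open_Collect_less)
  qed
  have fm: "f \<in> borel_measurable lebesgue"
    using borel_measurable_continuous_onI[OF assms(2)] by (intro measurable_completion) simp
  have pm: "(\<lambda>x::real. 1 + x\<^sup>2) \<in> borel_measurable lebesgue"
    by (intro measurable_completion) simp
  have "integrable lebesgue (\<lambda>x. (1 + x\<^sup>2) *\<^sub>R w x)"
    using w(1) by (subst (asm) integrable_density[OF w(2) pm]) auto
  then have "integrable lebesgue f"
  proof (rule Bochner_Integration.integrable_bound[OF _ fm])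
    show "AE x in lebesgue. norm (f x) \<le> norm ((1 + x\<^sup>2) *\<^sub>R w x)"
      using assms(3)
    proof eventually_elim
      case (elim x)
      have "1 * \<bar>f x\<bar> \<le> (1 + x\<^sup>2) * \<bar>f x\<bar>"
        by (intro mult_right_mono) auto
      then show ?case
        using elim by (simp add: abs_mult)
    qed
  qed
  then show "integrable lebesgue f" .
  have "integral\<^sup>L lebesgue f = (\<integral>x. \<bar>w x\<bar> \<partial>lebesgue)"
    using w(2) fm assms(3) f_nonneg by (intro integral_cong_AE) (auto elim!: eventually_mono)
  then show one: "integral\<^sup>L lebesgue f = 1"
    using w(4) by simp
  show "\<exists>x. f x > 0"
  proof (rule ccontr)
    assume "\<nexists>x. f x > 0"
    then have "f = (\<lambda>x. 0)"
      using f_nonneg by (auto simp: fun_eq_iff intro!: antisym simp: not_less)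
    then show False
      using one by simp
  qed
qed

lemma even_rep:
  assumes "even_ae w" "continuous_on UNIV f" "AE x in lebesgue. w x = f x"
  shows "f (- x) = f x"
proof (rule continuous_AE_eq_on[of "\<lambda>x. f (- x)" f UNIV x])
  show "continuous_on UNIV (\<lambda>x. f (- x))"
    by (rule continuous_on_compose2[OF assms(2)]) (auto intro: continuous_intros)
  have "AE x in lebesgue. w (- x) = w x"
    using assms(1) by (simp add: even_ae_def)
  then show "AE x in lebesgue. x \<in> UNIV \<longrightarrow> f (- x) = f x"
    using assms(3) AE_lebesgue_uminus[OF assms(3)] by eventually_elim simp
qed (use assms in auto)

text \<open>Multiplying both potentials by 6 normalises the quadratic term to
  \<open>x\<^sup>2\<close>; the determinant becomes \<open>36 * M\<close>, positive whatever
  \<open>R\<close> and \<open>\<eta>\<close> are.\<close>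

lemma even_SS_solution_two_phase:
  assumes par: "R > 0" "M > 0" "\<eta> > 0" and sol: "even_SS_solution R M \<eta> F G"
  obtains f g where "AE x in lebesgue. F x = f x" "AE x in lebesgue. G x = g x"
    "two_phase (6 * (1 + R)) (6 * R) (6 * M) (6 * M) (\<lambda>x. \<eta>\<^sup>2 * f x) g"
    "integrable lebesgue f" "integrable lebesgue g"
    "integral\<^sup>L lebesgue f = 1" "integral\<^sup>L lebesgue g = 1"
proof -
  have K: "in_K F" "in_K G" and H1: "in_H1 F" "in_H1 G" and even: "even_ae F" "even_ae G"
    using sol by (auto simp: even_SS_solution_def SS_solution_def)
  obtain D1 D2 where
    D1: "weak_deriv (\<lambda>x. (1 + R) * \<eta>\<^sup>2 * F x + R * G x + x\<^sup>2 / 6) D1" "AE x in lebesgue. F x * D1 x = 0" and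
    D2: "weak_deriv (\<lambda>x. M * \<eta>\<^sup>2 * F x + M * G x + x\<^sup>2 / 6) D2" "AE x in lebesgue. G x * D2 x = 0"
    using sol by (auto simp: even_SS_solution_def SS_solution_def)
  obtain f where f: "continuous_on UNIV f" "AE x in lebesgue. F x = f x"
    using in_H1_continuous_rep[OF H1(1)] by blast
  obtain g where g: "continuous_on UNIV g" "AE x in lebesgue. G x = g x"
    using in_H1_continuous_rep[OF H1(2)] by blast
  note fK = in_K_rep[OF K(1) f] and gK = in_K_rep[OF K(2) g]
  note fe = even_rep[OF even(1) f] and ge = even_rep[OF even(2) g]
  have "two_phase (6 * (1 + R)) (6 * R) (6 * M) (6 * M) (\<lambda>x. \<eta>\<^sup>2 * f x) g"
  proof
    show "6 * R * (6 * M) < 6 * (1 + R) * (6 * M)"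
      using par by simp
    show "continuous_on UNIV (\<lambda>x. \<eta>\<^sup>2 * f x)"
      using f by (intro continuous_intros)
    show "stationary (6 * (1 + R)) (6 * R) (\<lambda>x. \<eta>\<^sup>2 * f x) g"
      unfolding stationary_def
    proof (intro allI impI)
      fix s t :: real assume st: "s \<le> t" "\<forall>x\<in>{s..t}. \<eta>\<^sup>2 * f x > 0"
      have "(1 + R) * \<eta>\<^sup>2 * f s + R * g s + s\<^sup>2 / 6 = (1 + R) * \<eta>\<^sup>2 * f t + R * g t + t\<^sup>2 / 6"
      proof (rule locally_constant_if_weak_deriv_zero[OF D1 _ _ f(2) st(1)])
        show "continuous_on UNIV (\<lambda>x. (1 + R) * \<eta>\<^sup>2 * f x + R * g x + x\<^sup>2 / 6)"
          using f g by (intro continuous_intros) auto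
        show "AE x in lebesgue. (1 + R) * \<eta>\<^sup>2 * F x + R * G x + x\<^sup>2 / 6 = (1 + R) * \<eta>\<^sup>2 * f x + R * g x + x\<^sup>2 / 6"
          using f(2) g(2) by eventually_elim simp
        show "f x > 0" if "x \<in> {s..t}" for x
          using st(2) that par by (simp add: zero_less_mult_iff)
      qed
      then show "6 * (1 + R) * (\<eta>\<^sup>2 * f s) + 6 * R * g s + s\<^sup>2 = 6 * (1 + R) * (\<eta>\<^sup>2 * f t) + 6 * R * g t + t\<^sup>2"
        by (simp add: field_simps)
    qed
    show "stationary (6 * M) (6 * M) g (\<lambda>x. \<eta>\<^sup>2 * f x)"
      unfolding stationary_def
    proof (intro allI impI)
      fix s t :: real assume st: "s \<le> t" "\<forall>x\<in>{s..t}. g x > 0"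
      have "M * \<eta>\<^sup>2 * f s + M * g s + s\<^sup>2 / 6 = M * \<eta>\<^sup>2 * f t + M * g t + t\<^sup>2 / 6"
      proof (rule locally_constant_if_weak_deriv_zero[OF D2 _ _ g(2) st(1)])
        show "continuous_on UNIV (\<lambda>x. M * \<eta>\<^sup>2 * f x + M * g x + x\<^sup>2 / 6)"
          using f g by (intro continuous_intros) auto
        show "AE x in lebesgue. M * \<eta>\<^sup>2 * F x + M * G x + x\<^sup>2 / 6 = M * \<eta>\<^sup>2 * f x + M * g x + x\<^sup>2 / 6"
          using f(2) g(2) by eventually_elim simp
        show "g x > 0" if "x \<in> {s..t}" for x
          using st(2) that by simp
      qed
      then show "6 * M * g s + 6 * M * (\<eta>\<^sup>2 * f s) + s\<^sup>2 = 6 * M * g t + 6 * M * (\<eta>\<^sup>2 * f t) + t\<^sup>2"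
        by (simp add: field_simps)
    qed
    show "\<exists>x. 0 < \<eta>\<^sup>2 * f x"
      using fK(4) par by (simp add: zero_less_mult_iff)
  qed (use par fK gK fe ge g in auto)
  then show ?thesis
    using that f(2) g(2) fK gK by blast
qed

lemma even_SS_solution_unique:
  assumes par: "R > 0" "M > 0" "\<eta> > 0"
    and sol: "even_SS_solution R M \<eta> F G" "even_SS_solution R M \<eta> F' G'"
  shows "AE x in lebesgue. F x = F' x" "AE x in lebesgue. G x = G' x"
proof -
  obtain f g where fg: "AE x in lebesgue. F x = f x" "AE x in lebesgue. G x = g x"
    "two_phase (6 * (1 + R)) (6 * R) (6 * M) (6 * M) (\<lambda>x. \<eta>\<^sup>2 * f x) g"
    "integrable lebesgue f" "integrable lebesgue g"
    "integral\<^sup>L lebesgue f = 1" "integral\<^sup>L lebesgue g = 1"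
    by (rule even_SS_solution_two_phase[OF par sol(1)])
  obtain f' g' where fg': "AE x in lebesgue. F' x = f' x" "AE x in lebesgue. G' x = g' x"
    "two_phase (6 * (1 + R)) (6 * R) (6 * M) (6 * M) (\<lambda>x. \<eta>\<^sup>2 * f' x) g'"
    "integrable lebesgue f'" "integrable lebesgue g'"
    "integral\<^sup>L lebesgue f' = 1" "integral\<^sup>L lebesgue g' = 1"
    by (rule even_SS_solution_two_phase[OF par sol(2)])
  have eq: "(\<lambda>x. \<eta>\<^sup>2 * f x) = (\<lambda>x. \<eta>\<^sup>2 * f' x)" "g = g'"
    using two_phase_unique[OF fg(3) fg'(3)] fg fg' by auto
  have "f x = f' x" for x
    using fun_cong[OF eq(1), of x] par by simp
  then show "AE x in lebesgue. F x = F' x"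
    using fg(1) fg'(1) by auto
  show "AE x in lebesgue. G x = G' x"
    using fg(2) fg'(2) eq(2) by auto
qed

section \<open>Caps\<close>

text \<open>A class large enough for the caps and their discontinuous derivatives, closed under the
  operations that occur, and integrable against every continuous weight; membership in each of the
  function spaces follows from it.\<close>

definition tame :: "(real \<Rightarrow> real) \<Rightarrow> bool" where
  "tame f \<longleftrightarrow> f \<in> borel_measurable borel \<and> (\<exists>K r. \<forall>x. \<bar>f x\<bar> \<le> K \<and> (\<bar>x\<bar> > r \<longrightarrow> f x = 0))"

lemma tame_add:
  assumes "tame f" "tame g"
  shows "tame (\<lambda>x. f x + g x)"
proof -
  obtain K r L s where *: "\<And>x. \<bar>f x\<bar> \<le> K" "\<And>x. \<bar>x\<bar> > r \<Longrightarrow> f x = 0" "\<And>x. \<bar>g x\<bar> \<le> L" "\<And>x. \<bar>x\<bar> > s \<Longrightarrow> g x = 0"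
    using assms unfolding tame_def by metis
  have "\<bar>f x + g x\<bar> \<le> K + L \<and> (\<bar>x\<bar> > max r s \<longrightarrow> f x + g x = 0)" for x
    using *[of x] by (auto intro: abs_triangle_ineq[THEN order_trans])
  then show ?thesis
    using assms unfolding tame_def by (blast intro: borel_measurable_add)
qed

lemma tame_mult_continuous:
  assumes "tame f" "continuous_on UNIV h"
  shows "tame (\<lambda>x. h x * f x)"
proof -
  obtain K r where *: "\<And>x. \<bar>f x\<bar> \<le> K" "\<And>x. \<bar>x\<bar> > r \<Longrightarrow> f x = 0"
    using assms unfolding tame_def by metis
  have "compact (h ` {-r..r})"
    using assms(2) by (intro compact_continuous_image) (auto intro: continuous_on_subset)
  then obtain L where "\<forall>y\<in>h ` {-r..r}. norm y \<le> L"
    using compact_imp_bounded bounded_iff by blast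
  then have L: "\<bar>h x\<bar> \<le> L" if "\<bar>x\<bar> \<le> r" for x
    using that by (auto simp: abs_le_iff)
  have "\<bar>h x * f x\<bar> \<le> \<bar>L\<bar> * K \<and> (\<bar>x\<bar> > r \<longrightarrow> h x * f x = 0)" for x
  proof (cases "\<bar>x\<bar> \<le> r")
    case True
    then show ?thesis
      using L[OF True] *(1)[of x] unfolding abs_mult by (auto intro!: mult_mono)
  next
    case False
    then have "f x = 0"
      by (intro *(2)) simp
    then show ?thesis
      using *(1)[of x] by simp
  qed
  moreover have "(\<lambda>x. h x * f x) \<in> borel_measurable borel"
    using assms borel_measurable_continuous_onI unfolding tame_def by (blast intro: borel_measurable_times)
  ultimately show ?thesis
    unfolding tame_def by blast
qed

lemma tame_cmult: "tame f \<Longrightarrow> tame (\<lambda>x. c * f x)"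
  by (rule tame_mult_continuous) auto

lemma tame_integrable:
  assumes "tame f"
  shows "integrable lborel f"
proof -
  obtain K r where *: "\<And>x. \<bar>f x\<bar> \<le> K" "\<And>x. \<bar>x\<bar> > r \<Longrightarrow> f x = 0"
    using assms unfolding tame_def by metis
  have "integrable lborel (\<lambda>x. indicator {-r..r} x *\<^sub>R K)"
    by (intro borel_integrable_compact) auto
  then show ?thesis
  proof (rule Bochner_Integration.integrable_bound)
    show "f \<in> borel_measurable lborel"
      using assms by (simp add: tame_def)
    show "AE x in lborel. norm (f x) \<le> norm (indicator {-r..r} x *\<^sub>R K)"
    proof (rule AE_I2)
      fix x
      show "norm (f x) \<le> norm (indicator {-r..r} x *\<^sub>R K)"
      proof (cases "\<bar>x\<bar> > r")
        case False
        then have "x \<in> {-r..r}" by auto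
        then show ?thesis
          using *(1)[of x] by simp
      qed (simp add: *(2))
    qed
  qed
qed

lemma tame_square:
  assumes "tame f"
  shows "tame (\<lambda>x. (f x)\<^sup>2)"
proof -
  obtain K r where *: "\<And>x. \<bar>f x\<bar> \<le> K" "\<And>x. \<bar>x\<bar> > r \<Longrightarrow> f x = 0"
    using assms unfolding tame_def by metis
  have "\<bar>(f x)\<^sup>2\<bar> \<le> K\<^sup>2 \<and> (\<bar>x\<bar> > r \<longrightarrow> (f x)\<^sup>2 = 0)" for x
    using *[of x] power_mono[of "\<bar>f x\<bar>" K 2] by simp
  then show ?thesis
    using assms unfolding tame_def by (blast intro: borel_measurable_power)
qed

lemma tame_in_L2:
  assumes "tame f"
  shows "in_L2 f"
  unfolding in_L2_def
proof
  show "f \<in> borel_measurable lebesgue"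
    using assms by (intro measurable_completion) (simp add: tame_def)
  show "integrable lebesgue (\<lambda>x. (f x)\<^sup>2)"
    by (intro integral_lborel_lebesgue tame_integrable tame_square assms)
qed

lemma tame_locally_L1:
  assumes "tame f"
  shows "locally_L1 f"
  unfolding locally_L1_def set_integrable_def
proof (intro allI impI)
  fix S :: "real set" assume "compact S"
  then have "S \<in> sets borel"
    by (rule borel_compact)
  then have "integrable lborel (\<lambda>x. indicator S x *\<^sub>R f x)"
    using tame_integrable[OF assms] by (intro integrable_mult_indicator) simp_all
  then show "integrable lebesgue (\<lambda>x. indicator S x *\<^sub>R f x)"
    by (rule integral_lborel_lebesgue)
qed

lemma tame_in_K:
  assumes "tame f" "\<And>x. f x \<ge> 0" "integral\<^sup>L lborel f = 1"
  shows "in_K f"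
proof -
  note L2 = tame_in_L2[OF assms(1)]
  have pm: "(\<lambda>x::real. 1 + x\<^sup>2) \<in> borel_measurable lebesgue"
    by (intro measurable_completion) simp
  have "integrable lebesgue (\<lambda>x. (1 + x\<^sup>2) *\<^sub>R f x)"
    unfolding real_scaleR_def
    by (intro integral_lborel_lebesgue tame_integrable tame_mult_continuous assms continuous_intros)
  then have "integrable (density lebesgue (\<lambda>x. ennreal (1 + x\<^sup>2))) f"
    using L2 by (subst integrable_density[OF _ pm]) (auto simp: in_L2_def)
  then show ?thesis
    using L2 assms integral_lborel_lebesgue(2)[OF tame_integrable[OF assms(1)]]
    by (simp add: in_K_def)
qed

definition cap :: "real \<Rightarrow> real \<Rightarrow> real" where
  "cap r x = max 0 (r\<^sup>2 - x\<^sup>2)"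

definition cap_deriv :: "real \<Rightarrow> real \<Rightarrow> real" where
  "cap_deriv r x = (- 2 * x) * indicator {-r..r} x"

lemma cap_inside: "\<bar>x\<bar> \<le> r \<Longrightarrow> cap r x = r\<^sup>2 - x\<^sup>2"
  using power_mono[of "\<bar>x\<bar>" r 2] by (simp add: cap_def)

lemma cap_outside: "0 \<le> r \<Longrightarrow> r \<le> \<bar>x\<bar> \<Longrightarrow> cap r x = 0"
  using power_mono[of r "\<bar>x\<bar>" 2] by (simp add: cap_def)

lemma cap_0: "cap 0 x = 0"
  by (simp add: cap_outside)

lemma cap_even: "cap r (- x) = cap r x"
  by (simp add: cap_def)

lemma continuous_cap: "continuous_on UNIV (cap r)"
  unfolding cap_def by (intro continuous_intros)

lemma cap_eq_indicator: "0 \<le> r \<Longrightarrow> cap r x = (r\<^sup>2 - x\<^sup>2) * indicator {-r..r} x"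
proof (cases "\<bar>x\<bar> \<le> r")
  case True
  then have "x \<in> {-r..r}" by auto
  then show ?thesis
    using cap_inside[OF True] by simp
next
  case False
  assume "0 \<le> r"
  from False have "x \<notin> {-r..r}" by auto
  with False \<open>0 \<le> r\<close> show ?thesis
    by (simp add: cap_outside)
qed

lemma tame_cap:
  assumes "0 \<le> r"
  shows "tame (cap r)"
proof -
  have "\<bar>cap r x\<bar> \<le> r\<^sup>2 \<and> (\<bar>x\<bar> > r \<longrightarrow> cap r x = 0)" for x
    using assms cap_outside[of r x] by (auto simp: cap_def)
  then show ?thesis
    using borel_measurable_continuous_onI[OF continuous_cap] unfolding tame_def by blast
qed

lemma tame_cap_deriv: "tame (cap_deriv r)"
proof -
  have "tame (indicator {-r..r})"
    unfolding tame_def by (intro conjI exI[of _ 1] exI[of _ r]) (auto simp: indicator_def)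
  then show ?thesis
    unfolding cap_deriv_def[abs_def] by (rule tame_mult_continuous) (auto intro!: continuous_intros)
qed

lemma integral_cap:
  assumes "0 \<le> r"
  shows "integral\<^sup>L lborel (cap r) = 4 / 3 * r ^ 3"
proof -
  have "integral\<^sup>L lborel (cap r) = (\<integral>x. (r\<^sup>2 - x\<^sup>2) * indicator {-r..r} x \<partial>lborel)"
    using cap_eq_indicator[OF assms] by (intro Bochner_Integration.integral_cong refl)
  also have "\<dots> = (r\<^sup>2 * r - r ^ 3 / 3) - (r\<^sup>2 * (- r) - (- r) ^ 3 / 3)"
    using assms by (intro integral_FTC_Icc_real)
      (auto intro!: derivative_eq_intros continuous_intros simp: power2_eq_square)
  finally show ?thesis
    by (simp add: power2_eq_square power3_eq_cube)
qed

text \<open>Integration by parts over \<open>{-r..r}\<close>: the boundary terms drop because the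
  parabola vanishes at both ends, so the kinks leave no singular contribution.\<close>

lemma weak_deriv_cap:
  assumes "0 \<le> r"
  shows "weak_deriv (cap r) (cap_deriv r)"
  unfolding weak_deriv_def
proof (intro conjI allI impI)
  show L1: "locally_L1 (cap r)" "locally_L1 (cap_deriv r)"
    using tame_cap[OF assms] tame_cap_deriv by (auto intro: tame_locally_L1)
  fix \<phi> assume \<phi>: "test_function \<phi>"
  note \<phi>' = test_functionD[OF \<phi>]
  have cont: "isCont \<phi> x" "isCont (deriv \<phi>) x" for x
    using DERIV_isCont[OF \<phi>'(1)] \<phi>'(2) by (auto simp: continuous_on_eq_continuous_at)
  have meas: "\<phi> \<in> borel_measurable borel" "deriv \<phi> \<in> borel_measurable borel"
    using cont by (auto intro!: borel_measurable_continuous_onI continuous_at_imp_continuous_on)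
  have "(\<integral>x. cap r x * deriv \<phi> x \<partial>lebesgue) = (\<integral>x. cap r x * deriv \<phi> x \<partial>lborel)"
    using tame_cap[OF assms] meas by (intro integral_completion borel_measurable_times) (auto simp: tame_def)
  also have "\<dots> = (\<integral>x. ((r\<^sup>2 - x\<^sup>2) * deriv \<phi> x) * indicator {-r..r} x \<partial>lborel)"
    using cap_eq_indicator[OF assms] by (intro Bochner_Integration.integral_cong) auto
  also have "\<dots> = (r\<^sup>2 - r\<^sup>2) * \<phi> r - (r\<^sup>2 - (- r)\<^sup>2) * \<phi> (- r)
      - (\<integral>x. ((- 2 * x) * \<phi> x) * indicator {-r..r} x \<partial>lborel)"
    using assms cont \<phi>'(1)
    by (intro integral_by_parts) (auto intro!: derivative_eq_intros)
  also have "\<dots> = - (\<integral>x. cap_deriv r x * \<phi> x \<partial>lborel)"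
    by (simp add: cap_deriv_def mult_ac)
  also have "(\<integral>x. cap_deriv r x * \<phi> x \<partial>lborel) = (\<integral>x. cap_deriv r x * \<phi> x \<partial>lebesgue)"
    using tame_cap_deriv[of r] meas
    by (intro integral_completion[symmetric] borel_measurable_times) (auto simp: tame_def)
  finally show "(\<integral>x. cap r x * deriv \<phi> x \<partial>lebesgue) = - (\<integral>x. cap_deriv r x * \<phi> x \<partial>lebesgue)" .
qed

lemma weak_deriv_square: "weak_deriv (\<lambda>x. x\<^sup>2) (\<lambda>x. 2 * x)"
  unfolding weak_deriv_def
proof (intro conjI allI impI)
  show "locally_L1 (\<lambda>x. x\<^sup>2)" "locally_L1 (\<lambda>x. 2 * x)"
    by (auto intro!: locally_L1_continuous continuous_intros)
  fix \<phi> assume \<phi>: "test_function \<phi>"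
  note \<phi>' = test_functionD[OF \<phi>]
  obtain r where r: "r > 0" "\<And>x. \<bar>x\<bar> > r \<Longrightarrow> \<phi> x = 0" "\<And>x. \<bar>x\<bar> > r \<Longrightarrow> deriv \<phi> x = 0"
    using \<phi>'(3) by blast
  \<comment> \<open>One more than \<open>r\<close>, because \<open>\<phi>\<close> is only known to
    vanish strictly beyond \<open>r\<close>; here the boundary terms vanish through
    \<open>\<phi>\<close>.\<close>
  define s where "s = r + 1"
  have s: "\<phi> s = 0" "\<phi> (- s) = 0" "- s \<le> s"
    using r(1) by (auto intro!: r(2) simp: s_def)
  have supp: "\<phi> x = 0" "deriv \<phi> x = 0" if "x \<notin> {-s..s}" for x
    using that by (auto intro!: r simp: s_def)
  have cont: "isCont \<phi> x" "isCont (deriv \<phi>) x" for x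
    using DERIV_isCont[OF \<phi>'(1)] \<phi>'(2) by (auto simp: continuous_on_eq_continuous_at)
  have meas: "\<phi> \<in> borel_measurable borel" "deriv \<phi> \<in> borel_measurable borel"
    using cont by (auto intro!: borel_measurable_continuous_onI continuous_at_imp_continuous_on)
  have "(\<integral>x. x\<^sup>2 * deriv \<phi> x \<partial>lebesgue) = (\<integral>x. x\<^sup>2 * deriv \<phi> x \<partial>lborel)"
    using meas by (intro integral_completion borel_measurable_times) auto
  also have "\<dots> = (\<integral>x. (x\<^sup>2 * deriv \<phi> x) * indicator {-s..s} x \<partial>lborel)"
  proof (intro Bochner_Integration.integral_cong refl)
    show "x\<^sup>2 * deriv \<phi> x = (x\<^sup>2 * deriv \<phi> x) * indicator {-s..s} x" for x
      using supp(2)[of x] by (cases "x \<in> {-s..s}") (simp_all del: atLeastAtMost_iff)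
  qed
  also have "\<dots> = s\<^sup>2 * \<phi> s - (- s)\<^sup>2 * \<phi> (- s) - (\<integral>x. ((2 * x) * \<phi> x) * indicator {-s..s} x \<partial>lborel)"
    using s cont \<phi>'(1) by (intro integral_by_parts) (auto intro!: derivative_eq_intros)
  also have "(\<integral>x. ((2 * x) * \<phi> x) * indicator {-s..s} x \<partial>lborel) = (\<integral>x. 2 * x * \<phi> x \<partial>lborel)"
  proof (intro Bochner_Integration.integral_cong refl)
    show "((2 * x) * \<phi> x) * indicator {-s..s} x = 2 * x * \<phi> x" for x
      using supp(1)[of x] by (cases "x \<in> {-s..s}") (simp_all del: atLeastAtMost_iff)
  qed
  also have "\<dots> = (\<integral>x. 2 * x * \<phi> x \<partial>lebesgue)"
    using meas by (intro integral_completion[symmetric] borel_measurable_times) auto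
  finally show "(\<integral>x. x\<^sup>2 * deriv \<phi> x \<partial>lebesgue) = - (\<integral>x. 2 * x * \<phi> x \<partial>lebesgue)"
    using s by simp
qed

text \<open>Both components use the same three radii, so potentials are combinations of the same
  caps plus a square, and the equations reduce to a comparison of coefficients.\<close>

definition caps :: "real \<Rightarrow> real \<Rightarrow> real \<Rightarrow> real \<Rightarrow> real \<Rightarrow> real \<Rightarrow> real \<Rightarrow> real" where
  "caps a \<alpha> b \<beta> c \<gamma> x = a * cap \<alpha> x + b * cap \<beta> x + c * cap \<gamma> x"

lemma continuous_caps: "continuous_on UNIV (caps a \<alpha> b \<beta> c \<gamma>)"
  unfolding caps_def[abs_def]
  by (intro continuous_intros continuous_on_subset[OF continuous_cap subset_UNIV])

text \<open>A cap of radius \<open>r\<close> has integral \<open>4 / 3 * r ^ 3\<close>, which turns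
  unit mass into the value 3/4.\<close>

lemma caps_in_K:
  assumes "0 \<le> \<alpha>" "0 \<le> \<beta>" "0 \<le> \<gamma>"
    and "\<And>x. 0 \<le> caps a \<alpha> b \<beta> c \<gamma> x" "a * \<alpha> ^ 3 + b * \<beta> ^ 3 + c * \<gamma> ^ 3 = 3 / 4"
  shows "in_K (caps a \<alpha> b \<beta> c \<gamma>)"
proof (rule tame_in_K)
  show "tame (caps a \<alpha> b \<beta> c \<gamma>)"
    unfolding caps_def[abs_def] by (intro tame_add tame_cmult tame_cap assms)
  have "integral\<^sup>L lborel (caps a \<alpha> b \<beta> c \<gamma>) = a * (4 / 3 * \<alpha> ^ 3) + b * (4 / 3 * \<beta> ^ 3) + c * (4 / 3 * \<gamma> ^ 3)"
    using assms(1-3) by (simp add: caps_def[abs_def] tame_integrable tame_cap integral_cap)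
  then show "integral\<^sup>L lborel (caps a \<alpha> b \<beta> c \<gamma>) = 1"
    using assms(5) by simp
qed (rule assms)

lemma weak_deriv_caps:
  assumes "0 \<le> \<alpha>" "0 \<le> \<beta>" "0 \<le> \<gamma>"
  shows "weak_deriv (caps a \<alpha> b \<beta> c \<gamma>)
    (\<lambda>x. a * cap_deriv \<alpha> x + b * cap_deriv \<beta> x + c * cap_deriv \<gamma> x)"
  unfolding caps_def[abs_def] by (intro weak_deriv_add weak_deriv_cmult weak_deriv_cap assms)

lemma caps_in_H1:
  assumes "0 \<le> \<alpha>" "0 \<le> \<beta>" "0 \<le> \<gamma>"
  shows "in_H1 (caps a \<alpha> b \<beta> c \<gamma>)"
  unfolding in_H1_def
proof (intro conjI exI)
  show "in_L2 (caps a \<alpha> b \<beta> c \<gamma>)"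
    unfolding caps_def[abs_def] by (intro tame_in_L2 tame_add tame_cmult tame_cap assms)
  show "weak_deriv (caps a \<alpha> b \<beta> c \<gamma>) (\<lambda>x. a * cap_deriv \<alpha> x + b * cap_deriv \<beta> x + c * cap_deriv \<gamma> x)"
    by (rule weak_deriv_caps[OF assms])
  show "in_L2 (\<lambda>x. a * cap_deriv \<alpha> x + b * cap_deriv \<beta> x + c * cap_deriv \<gamma> x)"
    by (intro tame_in_L2 tame_add tame_cmult tame_cap_deriv)
qed

text \<open>Each cap contributes \<open>- 2 * x\<close> times an indicator, so the derivative of a
  potential is \<open>2 * x\<close> times the difference between 1/6 and the sum of the active
  coefficients. The equations ask that this sum be 1/6 where the component is positive; 0 is exempt
  owing to the factor \<open>x\<close>.\<close>

lemma caps_even_SS_solution: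
  fixes f1 f2 f3 g1 g2 g3 \<alpha> \<beta> \<gamma> R M \<eta> :: real
  defines "F \<equiv> caps f1 \<alpha> f2 \<beta> f3 \<gamma>" and "G \<equiv> caps g1 \<alpha> g2 \<beta> g3 \<gamma>"
  assumes r: "0 \<le> \<alpha>" "0 \<le> \<beta>" "0 \<le> \<gamma>"
    and nonneg: "\<And>x. 0 \<le> F x" "\<And>x. 0 \<le> G x"
    and mass: "f1 * \<alpha> ^ 3 + f2 * \<beta> ^ 3 + f3 * \<gamma> ^ 3 = 3 / 4" "g1 * \<alpha> ^ 3 + g2 * \<beta> ^ 3 + g3 * \<gamma> ^ 3 = 3 / 4"
    and F: "\<And>x. F x > 0 \<Longrightarrow> x \<noteq> 0 \<Longrightarrow>
      ((1 + R) * \<eta>\<^sup>2 * f1 + R * g1) * indicator {-\<alpha>..\<alpha>} x + ((1 + R) * \<eta>\<^sup>2 * f2 + R * g2) * indicator {-\<beta>..\<beta>} x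
      + ((1 + R) * \<eta>\<^sup>2 * f3 + R * g3) * indicator {-\<gamma>..\<gamma>} x = 1 / 6"
    and G: "\<And>x. G x > 0 \<Longrightarrow> x \<noteq> 0 \<Longrightarrow>
      M * (\<eta>\<^sup>2 * f1 + g1) * indicator {-\<alpha>..\<alpha>} x + M * (\<eta>\<^sup>2 * f2 + g2) * indicator {-\<beta>..\<beta>} x
      + M * (\<eta>\<^sup>2 * f3 + g3) * indicator {-\<gamma>..\<gamma>} x = 1 / 6"
  shows "even_SS_solution R M \<eta> F G"
proof -
  have K: "in_K F" "in_K G" and H1: "in_H1 F" "in_H1 G"
    using nonneg mass unfolding F_def G_def by (auto intro!: caps_in_K caps_in_H1 r)
  have main: "\<exists>D. weak_deriv (\<lambda>x. a * F x + b * G x + x\<^sup>2 / 6) D \<and> (AE x in lebesgue. w x * D x = 0)"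
    if w: "\<And>x. 0 \<le> w x" "\<And>x. w x > 0 \<Longrightarrow> x \<noteq> 0 \<Longrightarrow>
      (a * f1 + b * g1) * indicator {-\<alpha>..\<alpha>} x + (a * f2 + b * g2) * indicator {-\<beta>..\<beta>} x
      + (a * f3 + b * g3) * indicator {-\<gamma>..\<gamma>} x = 1 / 6" for a b and w :: "real \<Rightarrow> real"
  proof -
    define D where "D x = a * (f1 * cap_deriv \<alpha> x + f2 * cap_deriv \<beta> x + f3 * cap_deriv \<gamma> x)
        + b * (g1 * cap_deriv \<alpha> x + g2 * cap_deriv \<beta> x + g3 * cap_deriv \<gamma> x) + (1 / 6) * (2 * x)" for x
    have "weak_deriv (\<lambda>x. a * F x + b * G x + (1 / 6) * x\<^sup>2) D"
      unfolding D_def[abs_def] F_def G_def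
      by (intro weak_deriv_add weak_deriv_cmult weak_deriv_caps weak_deriv_square r)
    moreover have "w x * D x = 0" for x
    proof -
      have "D x = 2 * x * (1 / 6 - ((a * f1 + b * g1) * indicator {-\<alpha>..\<alpha>} x
          + (a * f2 + b * g2) * indicator {-\<beta>..\<beta>} x + (a * f3 + b * g3) * indicator {-\<gamma>..\<gamma>} x))"
        by (simp add: D_def cap_deriv_def algebra_simps)
      then show ?thesis
        using w[of x] by (cases "w x = 0"; cases "x = 0") auto
    qed
    ultimately show ?thesis
      by auto
  qed
  have "\<exists>D. weak_deriv (\<lambda>x. (1 + R) * \<eta>\<^sup>2 * F x + R * G x + x\<^sup>2 / 6) D \<and> (AE x in lebesgue. F x * D x = 0)"
    by (rule main) (use nonneg F in auto)
  moreover have "\<exists>D. weak_deriv (\<lambda>x. M * \<eta>\<^sup>2 * F x + M * G x + x\<^sup>2 / 6) D \<and> (AE x in lebesgue. G x * D x = 0)"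
  proof (rule main)
    fix x assume "G x > 0" "x \<noteq> 0"
    from G[OF this] show "(M * \<eta>\<^sup>2 * f1 + M * g1) * indicator {-\<alpha>..\<alpha>} x
        + (M * \<eta>\<^sup>2 * f2 + M * g2) * indicator {-\<beta>..\<beta>} x + (M * \<eta>\<^sup>2 * f3 + M * g3) * indicator {-\<gamma>..\<gamma>} x = 1 / 6"
      by (simp add: algebra_simps)
  qed (rule nonneg)
  moreover have "even_ae F" "even_ae G"
    by (auto simp: even_ae_def F_def G_def caps_def cap_even)
  ultimately show ?thesis
    using K H1 by (simp add: even_SS_solution_def SS_solution_def)
qed

lemma caps_scale: "caps (a / k) \<alpha> (b / k) \<beta> (c / k) \<gamma> x = caps a \<alpha> b \<beta> c \<gamma> x / k"
  by (simp add: caps_def add_divide_distrib)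

lemma sq_less: "0 \<le> (x::real) \<Longrightarrow> x < y \<Longrightarrow> x\<^sup>2 < y\<^sup>2"
  by (rule power_strict_mono) auto

section \<open>Profiles with two humps and with one hump\<close>

text \<open>On \<open>\<bar>x\<bar> \<le> \<alpha>\<close> the relation \<open>d = c + e\<close>
  cancels the quadratic part of \<open>q\<close> and \<open>vanish\<close> cancels the constant
  part, which opens the gap between the humps. Elsewhere signs are read off from one cap at a time,
  with \<open>b < a\<close> keeping \<open>p\<close> above its value at \<alpha>.\<close>

lemma two_hump_profile:
  fixes a b c d e \<alpha> \<beta> \<gamma> :: real
  defines "p \<equiv> caps (- b) \<alpha> a \<beta> 0 \<gamma>" and "q \<equiv> caps e \<alpha> (- d) \<beta> c \<gamma>"
  assumes ord: "0 \<le> \<alpha>" "\<alpha> < \<beta>" "\<beta> < \<gamma>" and coef: "0 < a" "b < a" "0 < c" "0 < e" "d = c + e"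
    and vanish: "c * \<gamma>\<^sup>2 - d * \<beta>\<^sup>2 + e * \<alpha>\<^sup>2 = 0"
  shows "p x > 0 \<longleftrightarrow> \<bar>x\<bar> < \<beta>" "p x \<ge> 0" "q x > 0 \<longleftrightarrow> \<alpha> < \<bar>x\<bar> \<and> \<bar>x\<bar> < \<gamma>" "q x \<ge> 0"
    and "\<bar>x\<bar> \<le> \<alpha> \<Longrightarrow> p x = a * (\<beta>\<^sup>2 - x\<^sup>2) - b * (\<alpha>\<^sup>2 - x\<^sup>2)"
    and "\<alpha> \<le> \<bar>x\<bar> \<Longrightarrow> \<bar>x\<bar> \<le> \<beta> \<Longrightarrow> p x = a * (\<beta>\<^sup>2 - x\<^sup>2)"
    and "\<alpha> \<le> \<bar>x\<bar> \<Longrightarrow> \<bar>x\<bar> \<le> \<beta> \<Longrightarrow> q x = e * (x\<^sup>2 - \<alpha>\<^sup>2)"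
    and "\<beta> \<le> \<bar>x\<bar> \<Longrightarrow> \<bar>x\<bar> \<le> \<gamma> \<Longrightarrow> q x = c * (\<gamma>\<^sup>2 - x\<^sup>2)"
proof -
  have p1: "p x = a * (\<beta>\<^sup>2 - x\<^sup>2) - b * (\<alpha>\<^sup>2 - x\<^sup>2)" if "\<bar>x\<bar> \<le> \<alpha>"
    using that ord by (simp add: p_def caps_def cap_inside)
  have p2: "p x = a * (\<beta>\<^sup>2 - x\<^sup>2)" if "\<alpha> \<le> \<bar>x\<bar>" "\<bar>x\<bar> \<le> \<beta>"
    using that ord by (simp add: p_def caps_def cap_inside cap_outside)
  have p3: "p x = 0" if "\<beta> \<le> \<bar>x\<bar>"
    using that ord by (simp add: p_def caps_def cap_outside)
  have q1: "q x = 0" if "\<bar>x\<bar> \<le> \<alpha>"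
  proof -
    have "q x = e * (\<alpha>\<^sup>2 - x\<^sup>2) - d * (\<beta>\<^sup>2 - x\<^sup>2) + c * (\<gamma>\<^sup>2 - x\<^sup>2)"
      using that ord by (simp add: q_def caps_def cap_inside)
    then show ?thesis
      using vanish coef(5) by (simp add: algebra_simps)
  qed
  have q2: "q x = e * (x\<^sup>2 - \<alpha>\<^sup>2)" if "\<alpha> \<le> \<bar>x\<bar>" "\<bar>x\<bar> \<le> \<beta>"
  proof -
    have "q x = - d * (\<beta>\<^sup>2 - x\<^sup>2) + c * (\<gamma>\<^sup>2 - x\<^sup>2)"
      using that ord by (simp add: q_def caps_def cap_inside cap_outside)
    then show ?thesis
      using vanish coef(5) by (simp add: algebra_simps)
  qed
  have q3: "q x = c * (\<gamma>\<^sup>2 - x\<^sup>2)" if "\<beta> \<le> \<bar>x\<bar>" "\<bar>x\<bar> \<le> \<gamma>"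
    using that ord by (simp add: q_def caps_def cap_inside cap_outside)
  have q4: "q x = 0" if "\<gamma> \<le> \<bar>x\<bar>"
    using that ord by (simp add: q_def caps_def cap_outside)
  have sq: "\<bar>x\<bar> < r \<Longrightarrow> x\<^sup>2 < r\<^sup>2" for r
    using sq_less[of "\<bar>x\<bar>" r] by simp
  have sq': "0 \<le> r \<Longrightarrow> r < \<bar>x\<bar> \<Longrightarrow> r\<^sup>2 < x\<^sup>2" for r
    using sq_less[of r "\<bar>x\<bar>"] by simp
  have pp: "p x > 0" if "\<bar>x\<bar> < \<beta>"
  proof (cases "\<bar>x\<bar> \<le> \<alpha>")
    case True
    have "a * (\<beta>\<^sup>2 - \<alpha>\<^sup>2) > 0"
      using coef ord sq_less[of \<alpha> \<beta>] by simp
    moreover have "(a - b) * (\<alpha>\<^sup>2 - x\<^sup>2) \<ge> 0"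
      using coef power_mono[OF True, of 2] by simp
    ultimately show ?thesis
      using p1[OF True] by (simp add: algebra_simps)
  next
    case False
    then show ?thesis
      using p2 sq[OF that] coef that by simp
  qed
  show "p x > 0 \<longleftrightarrow> \<bar>x\<bar> < \<beta>"
    using pp p3 by linarith
  show "p x \<ge> 0"
    using pp p3 by linarith
  have qp: "q x > 0" if "\<alpha> < \<bar>x\<bar>" "\<bar>x\<bar> < \<gamma>"
  proof (cases "\<bar>x\<bar> \<le> \<beta>")
    case True
    then show ?thesis
      using q2 sq'[OF ord(1) that(1)] coef that by simp
  next
    case False
    then show ?thesis
      using q3 sq[OF that(2)] coef that by simp
  qed
  show "q x > 0 \<longleftrightarrow> \<alpha> < \<bar>x\<bar> \<and> \<bar>x\<bar> < \<gamma>"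
    using qp q1 q4 by linarith
  show "q x \<ge> 0"
    using qp q1 q4 by linarith
qed (use assms in \<open>auto simp: p_def q_def caps_def cap_inside cap_outside algebra_simps\<close>)

text \<open>The limiting shape without gap: \<open>cap 0\<close> is the zero function, so the
  coefficients \<open>- b\<close> and \<open>e\<close> at radius 0 are arbitrary and the candidates
  of the two-hump regimes can be reused. The inequality \<open>above\<close> says that
  \<open>q\<close> is positive at 0.\<close>

lemma one_hump_profile:
  fixes a b c d e \<beta> \<gamma> :: real
  defines "p \<equiv> caps (- b) 0 a \<beta> 0 \<gamma>" and "q \<equiv> caps e 0 (- d) \<beta> c \<gamma>"
  assumes ord: "0 < \<beta>" "\<beta> \<le> \<gamma>" and coef: "0 < a" "0 < c" and above: "d * \<beta>\<^sup>2 < c * \<gamma>\<^sup>2"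
  shows "p x > 0 \<longleftrightarrow> \<bar>x\<bar> < \<beta>" "p x \<ge> 0" "q x > 0 \<longleftrightarrow> \<bar>x\<bar> < \<gamma>" "q x \<ge> 0"
    and "\<bar>x\<bar> \<le> \<beta> \<Longrightarrow> p x = a * (\<beta>\<^sup>2 - x\<^sup>2)"
    and "\<bar>x\<bar> \<le> \<beta> \<Longrightarrow> q x = c * (\<gamma>\<^sup>2 - x\<^sup>2) - d * (\<beta>\<^sup>2 - x\<^sup>2)"
    and "\<beta> \<le> \<bar>x\<bar> \<Longrightarrow> \<bar>x\<bar> \<le> \<gamma> \<Longrightarrow> q x = c * (\<gamma>\<^sup>2 - x\<^sup>2)"
proof -
  have p2: "p x = a * (\<beta>\<^sup>2 - x\<^sup>2)" if "\<bar>x\<bar> \<le> \<beta>"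
    using that by (simp add: p_def caps_def cap_0 cap_inside)
  have p3: "p x = 0" if "\<beta> \<le> \<bar>x\<bar>"
    using that ord by (simp add: p_def caps_def cap_0 cap_outside)
  have q2: "q x = c * (\<gamma>\<^sup>2 - x\<^sup>2) - d * (\<beta>\<^sup>2 - x\<^sup>2)" if "\<bar>x\<bar> \<le> \<beta>"
    using that ord by (simp add: q_def caps_def cap_0 cap_inside)
  have q3: "q x = c * (\<gamma>\<^sup>2 - x\<^sup>2)" if "\<beta> \<le> \<bar>x\<bar>" "\<bar>x\<bar> \<le> \<gamma>"
    using that ord by (simp add: q_def caps_def cap_0 cap_inside cap_outside)
  have q4: "q x = 0" if "\<gamma> \<le> \<bar>x\<bar>"
    using that ord by (simp add: q_def caps_def cap_0 cap_outside)
  have sq: "\<bar>x\<bar> < r \<Longrightarrow> x\<^sup>2 < r\<^sup>2" for r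
    using sq_less[of "\<bar>x\<bar>" r] by simp
  have pp: "p x > 0" if "\<bar>x\<bar> < \<beta>"
    using p2 sq[OF that] coef that by simp
  show "p x > 0 \<longleftrightarrow> \<bar>x\<bar> < \<beta>"
    using pp p3 by linarith
  show "p x \<ge> 0"
    using pp p3 by linarith
  have qp: "q x > 0" if x: "\<bar>x\<bar> < \<gamma>"
  proof (cases "\<bar>x\<bar> < \<beta>")
    case True
    \<comment> \<open>in the variable \<open>x\<^sup>2\<close>, \<open>q\<close> is affine on \<open>[0, \<beta>\<^sup>2]\<close>, hence the interpolant of its end values\<close>
    have "0 < (\<beta>\<^sup>2 - x\<^sup>2) * (c * \<gamma>\<^sup>2 - d * \<beta>\<^sup>2)"
      using sq[OF True] above by simp
    moreover have "0 \<le> x\<^sup>2 * (c * (\<gamma>\<^sup>2 - \<beta>\<^sup>2))"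
      using coef ord by simp
    ultimately have "0 < (\<beta>\<^sup>2 - x\<^sup>2) * (c * \<gamma>\<^sup>2 - d * \<beta>\<^sup>2) + x\<^sup>2 * (c * (\<gamma>\<^sup>2 - \<beta>\<^sup>2))"
      by linarith
    also have "\<dots> = \<beta>\<^sup>2 * (c * (\<gamma>\<^sup>2 - x\<^sup>2) - d * (\<beta>\<^sup>2 - x\<^sup>2))"
      by algebra
    also have "\<dots> = \<beta>\<^sup>2 * q x"
      using q2 True by simp
    finally show ?thesis
      by (simp add: zero_less_mult_iff)
  next
    case False
    then show ?thesis
      using q3 sq[OF x] coef x by simp
  qed
  show "q x > 0 \<longleftrightarrow> \<bar>x\<bar> < \<gamma>"
    using qp q4 by linarith
  show "q x \<ge> 0"
    using qp q4 by linarith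
qed (use assms in \<open>auto simp: p_def q_def caps_def cap_0 cap_inside cap_outside\<close>)

section \<open>Solving for the radii\<close>

text \<open>With \<open>\<alpha> = t \<beta>\<close>, the last equation gives \<open>\<gamma> / \<beta>\<close> in terms of \<open>t\<close>, and the ratio of the first two
  becomes a scalar equation for \<open>t \<in> [0, 1)\<close>.\<close>

lemma ex_two_hump_radii:
  fixes a b c d e m n :: real
  assumes coef: "0 < a" "b < a" "0 < c" "0 < e" "d = c + e" and mn: "0 < m" "0 < n"
    and threshold: "n * a \<le> m * (c * sqrt (d / c) ^ 3 - d)"
  obtains \<alpha> \<beta> \<gamma> where "0 \<le> \<alpha>" "\<alpha> < \<beta>" "\<beta> < \<gamma>" "a * \<beta> ^ 3 - b * \<alpha> ^ 3 = m"
    "c * \<gamma> ^ 3 - d * \<beta> ^ 3 + e * \<alpha> ^ 3 = n" "c * \<gamma>\<^sup>2 - d * \<beta>\<^sup>2 + e * \<alpha>\<^sup>2 = 0"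
proof -
  define \<sigma> where "\<sigma> t = sqrt ((d - e * t\<^sup>2) / c)" for t
  \<comment> \<open>Dividing the two cubic equations by \<beta>^3 and eliminating it; the ratio is
    cross-multiplied so that no denominator occurs.\<close>
  define \<psi> where "\<psi> t = m * (c * \<sigma> t ^ 3 - d + e * t ^ 3) - n * (a - b * t ^ 3)" for t
  have one: "\<sigma> 1 = 1"
    using coef by (simp add: \<sigma>_def)
  \<comment> \<open>At \<open>t = 1\<close> all three radii coincide and the outer component has no
    mass left.\<close>
  have \<psi>1: "\<psi> 1 < 0"
    using coef mn by (simp add: \<psi>_def one)
  \<comment> \<open>The threshold is the sign condition at \<open>t = 0\<close>, with equality when
    \<alpha> = 0 solves the system.\<close>
  have \<psi>0: "\<psi> 0 \<ge> 0"
    using threshold by (simp add: \<psi>_def \<sigma>_def)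
  have "continuous_on {0..1} \<psi>"
    unfolding \<psi>_def[abs_def] \<sigma>_def using coef by (intro continuous_intros) auto
  then obtain t where t: "0 \<le> t" "t \<le> 1" "\<psi> t = 0"
    using IVT2'[of \<psi> 1 0 0] \<psi>0 \<psi>1 by auto
  with \<psi>1 have t1: "t < 1"
    by (cases "t = 1") auto
  have t2: "t\<^sup>2 < 1" "t ^ 3 < 1"
    using t t1 by (auto simp: power_less_one_iff)
  have pos: "0 < a - b * t ^ 3"
  proof (cases "b \<le> 0")
    case True
    then have "b * t ^ 3 \<le> 0"
      using t by (simp add: mult_le_0_iff)
    then show ?thesis
      using coef by simp
  next
    case False
    then have "b * t ^ 3 \<le> b * 1"
      using t2 by (intro mult_left_mono) auto
    then show ?thesis
      using coef by simp
  qed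
  have arg: "(d - e * t\<^sup>2) / c = 1 + e * (1 - t\<^sup>2) / c"
    using coef by (simp add: field_simps)
  moreover have "e * (1 - t\<^sup>2) / c > 0"
    using coef t2 by simp
  ultimately have arg1: "(d - e * t\<^sup>2) / c > 1"
    by simp
  then have \<sigma>1: "\<sigma> t > 1" and \<sigma>2: "(\<sigma> t)\<^sup>2 = (d - e * t\<^sup>2) / c"
    by (simp_all add: \<sigma>_def)
  \<comment> \<open>The first cubic equation with \<alpha> = t \<beta>, solved for \<beta>.\<close>
  define \<beta> where "\<beta> = root 3 (m / (a - b * t ^ 3))"
  have \<beta>: "\<beta> > 0" "\<beta> ^ 3 = m / (a - b * t ^ 3)"
    using pos mn by (simp_all add: \<beta>_def real_root_pow_pos)
  show ?thesis
  proof (rule that[of "\<beta> * t" \<beta> "\<beta> * \<sigma> t"])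
    show "0 \<le> \<beta> * t" "\<beta> * t < \<beta>" "\<beta> < \<beta> * \<sigma> t"
      using \<beta>(1) t t1 \<sigma>1 by simp_all
    have "a * \<beta> ^ 3 - b * (\<beta> * t) ^ 3 = \<beta> ^ 3 * (a - b * t ^ 3)"
      by (simp add: algebra_simps)
    then show "a * \<beta> ^ 3 - b * (\<beta> * t) ^ 3 = m"
      using \<beta>(2) pos by simp
    have "c * (\<beta> * \<sigma> t) ^ 3 - d * \<beta> ^ 3 + e * (\<beta> * t) ^ 3 = \<beta> ^ 3 * (c * \<sigma> t ^ 3 - d + e * t ^ 3)"
      by (simp add: algebra_simps)
    also have "\<dots> = m * (c * \<sigma> t ^ 3 - d + e * t ^ 3) / (a - b * t ^ 3)"
      by (simp add: \<beta>(2))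
    also have "m * (c * \<sigma> t ^ 3 - d + e * t ^ 3) = n * (a - b * t ^ 3)"
      using t(3) by (simp add: \<psi>_def)
    finally show "c * (\<beta> * \<sigma> t) ^ 3 - d * \<beta> ^ 3 + e * (\<beta> * t) ^ 3 = n"
      using pos by simp
    have "c * (\<beta> * \<sigma> t)\<^sup>2 - d * \<beta>\<^sup>2 + e * (\<beta> * t)\<^sup>2 = \<beta>\<^sup>2 * (c * (\<sigma> t)\<^sup>2 - d + e * t\<^sup>2)"
      by (simp add: algebra_simps)
    then show "c * (\<beta> * \<sigma> t)\<^sup>2 - d * \<beta>\<^sup>2 + e * (\<beta> * t)\<^sup>2 = 0"
      using \<sigma>2 coef by simp
  qed
qed

lemma cube_eq_iff_root: "0 < (k::real) \<Longrightarrow> 0 < b \<and> b ^ 3 = k \<longleftrightarrow> b = root 3 k"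
  by (metis less_imp_le real_root_gt_zero real_root_pos_unique real_root_pow_pos zero_less_numeral)

lemma cubes_eq_iff_roots:
  assumes "0 < (k::real)" "k < l"
  shows "0 < b \<and> b < c \<and> b ^ 3 = k \<and> c ^ 3 = l \<longleftrightarrow> b = root 3 k \<and> c = root 3 l"
proof -
  have "root 3 k < root 3 l"
    using assms by simp
  then show ?thesis
    using cube_eq_iff_root[of k b] cube_eq_iff_root[of l c] assms by (metis order.strict_trans)
qed

text \<open>From \<open>sqrt K < \<rho>\<close>, the cube of \<open>sqrt K * \<beta>\<close> lies
  below that of \<gamma>. This turns a threshold on the parameters into positivity of the outer
  component at 0.\<close>

lemma square_less_if_cube_ratio:
  fixes \<beta> \<gamma> K \<rho> :: real
  assumes "0 < \<beta>" "0 < \<gamma>" "0 < K" "0 < \<rho>" "K < \<rho>\<^sup>2" "\<gamma> ^ 3 = \<beta> ^ 3 * (K * \<rho>)"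
  shows "K * \<beta>\<^sup>2 < \<gamma>\<^sup>2"
proof -
  have "sqrt K < \<rho>"
    using assms(3-5) by (simp add: real_less_lsqrt)
  then have "\<beta> ^ 3 * (K * sqrt K) < \<gamma> ^ 3"
    unfolding assms(6) using assms(1-4) by simp
  also have "\<beta> ^ 3 * (K * sqrt K) = (sqrt K * \<beta>) ^ 3"
    using assms(3) by (simp add: power_mult_distrib power3_eq_cube)
  finally have "sqrt K * \<beta> < \<gamma>"
    by (rule power_less_imp_less_base) (use assms(2) in simp)
  then have "(sqrt K * \<beta>)\<^sup>2 < \<gamma>\<^sup>2"
    by (intro sq_less) (use assms(1,3) in simp)
  then show ?thesis
    using assms(3) by (simp add: power_mult_distrib)
qed

section \<open>The explicit solutions\<close>

text \<open>The clauses common to all regimes. Continuity upgrades uniqueness almost everywhere to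
  equality of functions, which is what the comparison of positivity sets relies on.\<close>

definition regular_solution :: "real \<Rightarrow> real \<Rightarrow> real \<Rightarrow> (real \<Rightarrow> real) \<Rightarrow> (real \<Rightarrow> real) \<Rightarrow> bool" where
  "regular_solution R M \<eta> F G \<longleftrightarrow> even_SS_solution R M \<eta> F G \<and>
     continuous_on UNIV F \<and> continuous_on UNIV G \<and>
     (\<forall>x. x \<notin> positivity_set F \<longrightarrow> F x = 0) \<and> (\<forall>x. x \<notin> positivity_set G \<longrightarrow> G x = 0)"

text \<open>The five explicit descriptions are named so that each regime can be treated separately.
  The equivalence in the radii states existence and uniqueness of the solution of the defining
  equations at once.\<close>

definition profile_i :: "real \<Rightarrow> real \<Rightarrow> real \<Rightarrow> (real \<Rightarrow> real) \<Rightarrow> (real \<Rightarrow> real) \<Rightarrow> bool" where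
  "profile_i R R\<^sub>\<mu> \<eta> F G \<longleftrightarrow>
      (\<exists>\<beta>. (\<forall>b. (0 < b \<and> b ^ 3 = 9 * \<eta>\<^sup>2 * R\<^sub>\<mu> / (2 * (R\<^sub>\<mu> - R))) \<longleftrightarrow> b = \<beta>) \<and>
        positivity_set F = {-\<beta><..<\<beta>} \<and> positivity_set G = {-\<beta><..<\<beta>} \<and>
        (\<forall>x \<in> {-\<beta><..<\<beta>}.
           F x = (R\<^sub>\<mu> - R) / (6 * \<eta>\<^sup>2 * R\<^sub>\<mu>) * (\<beta>\<^sup>2 - x\<^sup>2) \<and>
           G x = (R\<^sub>\<mu> - R) / (6 * \<eta>\<^sup>2 * R\<^sub>\<mu>) * (\<beta>\<^sup>2 - x\<^sup>2)))"

definition profile_ii :: "real \<Rightarrow> real \<Rightarrow> real \<Rightarrow> (real \<Rightarrow> real) \<Rightarrow> (real \<Rightarrow> real) \<Rightarrow> bool" where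
  "profile_ii R R\<^sub>\<mu> \<eta> F G \<longleftrightarrow>
      (\<exists>\<beta> \<gamma>. (\<forall>b c. (0 < b \<and> b < c \<and>
                  b ^ 3 = 9 * \<eta>\<^sup>2 * R\<^sub>\<mu> / (2 * (R\<^sub>\<mu> - R)) \<and>
                  c ^ 3 = 9 * R\<^sub>\<mu> / 2 * (1 + \<eta>\<^sup>2)) \<longleftrightarrow> b = \<beta> \<and> c = \<gamma>) \<and>
        positivity_set F = {-\<beta><..<\<beta>} \<and> positivity_set G = {-\<gamma><..<\<gamma>} \<and>
        (\<forall>x. \<bar>x\<bar> \<le> \<beta> \<longrightarrow> \<eta>\<^sup>2 * F x = (R\<^sub>\<mu> - R) / (6 * R\<^sub>\<mu>) * (\<beta>\<^sup>2 - x\<^sup>2)) \<and>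
        (\<forall>x. \<bar>x\<bar> \<le> \<beta> \<longrightarrow>
           G x = \<gamma>\<^sup>2 / (6 * R\<^sub>\<mu>) + (R - R\<^sub>\<mu>) / (6 * R\<^sub>\<mu>) * \<beta>\<^sup>2
                 - (1 + R - R\<^sub>\<mu>) / (6 * R\<^sub>\<mu>) * x\<^sup>2) \<and>
        (\<forall>x. \<beta> \<le> \<bar>x\<bar> \<and> \<bar>x\<bar> \<le> \<gamma> \<longrightarrow> G x = 1 / (6 * R\<^sub>\<mu>) * (\<gamma>\<^sup>2 - x\<^sup>2)))"

definition profile_iii :: "real \<Rightarrow> real \<Rightarrow> real \<Rightarrow> (real \<Rightarrow> real) \<Rightarrow> (real \<Rightarrow> real) \<Rightarrow> bool" where
  "profile_iii R R\<^sub>\<mu> \<eta> F G \<longleftrightarrow>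
      (\<exists>\<alpha> \<beta> \<gamma>. (\<forall>a b c. (0 \<le> a \<and> a < b \<and> b < c \<and>
                  (R\<^sub>\<mu> - R) * b ^ 3 - R * (R\<^sub>\<mu> - R - 1) / (1 + R) * a ^ 3 = 9 * \<eta>\<^sup>2 * R\<^sub>\<mu> / 2 \<and>
                  c ^ 3 - (R\<^sub>\<mu> - R) * b ^ 3 + (R\<^sub>\<mu> - R - 1) * a ^ 3 = 9 * R\<^sub>\<mu> / 2 \<and>
                  c\<^sup>2 - (R\<^sub>\<mu> - R) * b\<^sup>2 + (R\<^sub>\<mu> - R - 1) * a\<^sup>2 = 0)
                \<longleftrightarrow> a = \<alpha> \<and> b = \<beta> \<and> c = \<gamma>) \<and>
        positivity_set F = {-\<beta><..<\<beta>} \<and>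
        positivity_set G = {-\<gamma><..<-\<alpha>} \<union> {\<alpha><..<\<gamma>} \<and>
        (\<forall>x. \<bar>x\<bar> \<le> \<alpha> \<longrightarrow>
           \<eta>\<^sup>2 * F x = (R\<^sub>\<mu> - R) / (6 * R\<^sub>\<mu>) * \<beta>\<^sup>2
                      + R * (1 + R - R\<^sub>\<mu>) / (6 * R\<^sub>\<mu> * (1 + R)) * \<alpha>\<^sup>2 - x\<^sup>2 / (6 * (1 + R))) \<and>
        (\<forall>x. \<alpha> \<le> \<bar>x\<bar> \<and> \<bar>x\<bar> \<le> \<beta> \<longrightarrow>
           \<eta>\<^sup>2 * F x = (R\<^sub>\<mu> - R) / (6 * R\<^sub>\<mu>) * (\<beta>\<^sup>2 - x\<^sup>2)) \<and>
        (\<forall>x. \<alpha> \<le> \<bar>x\<bar> \<and> \<bar>x\<bar> \<le> \<beta> \<longrightarrow>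
           G x = (1 + R - R\<^sub>\<mu>) / (6 * R\<^sub>\<mu>) * (\<alpha>\<^sup>2 - x\<^sup>2)) \<and>
        (\<forall>x. \<beta> \<le> \<bar>x\<bar> \<and> \<bar>x\<bar> \<le> \<gamma> \<longrightarrow> G x = 1 / (6 * R\<^sub>\<mu>) * (\<gamma>\<^sup>2 - x\<^sup>2)))"

definition profile_iv :: "real \<Rightarrow> real \<Rightarrow> real \<Rightarrow> (real \<Rightarrow> real) \<Rightarrow> (real \<Rightarrow> real) \<Rightarrow> bool" where
  "profile_iv R R\<^sub>\<mu> \<eta> F G \<longleftrightarrow>
      (\<exists>\<alpha> \<beta> \<gamma>. (\<forall>a b c. (0 \<le> a \<and> a < b \<and> b < c \<and>
                  (1 + R - R\<^sub>\<mu>) * b ^ 3 - (R - R\<^sub>\<mu>) * a ^ 3 = 9 * R\<^sub>\<mu> / 2 \<and>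
                  R\<^sub>\<mu> * c ^ 3 - R * (1 + R - R\<^sub>\<mu>) * b ^ 3 + (1 + R) * (R - R\<^sub>\<mu>) * a ^ 3
                    = 9 / 2 * R\<^sub>\<mu> * (1 + R) * \<eta>\<^sup>2 \<and>
                  R\<^sub>\<mu> * c\<^sup>2 - R * (1 + R - R\<^sub>\<mu>) * b\<^sup>2 + (1 + R) * (R - R\<^sub>\<mu>) * a\<^sup>2 = 0)
                \<longleftrightarrow> a = \<alpha> \<and> b = \<beta> \<and> c = \<gamma>) \<and>
        positivity_set F = {-\<gamma><..<-\<alpha>} \<union> {\<alpha><..<\<gamma>} \<and>
        positivity_set G = {-\<beta><..<\<beta>} \<and>
        (\<forall>x. \<alpha> \<le> \<bar>x\<bar> \<and> \<bar>x\<bar> \<le> \<beta> \<longrightarrow>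
           \<eta>\<^sup>2 * F x = (R\<^sub>\<mu> - R) / (6 * R\<^sub>\<mu>) * (\<alpha>\<^sup>2 - x\<^sup>2)) \<and>
        (\<forall>x. \<beta> \<le> \<bar>x\<bar> \<and> \<bar>x\<bar> \<le> \<gamma> \<longrightarrow> \<eta>\<^sup>2 * F x = 1 / (6 * (1 + R)) * (\<gamma>\<^sup>2 - x\<^sup>2)) \<and>
        (\<forall>x. \<bar>x\<bar> \<le> \<alpha> \<longrightarrow>
           G x = (R\<^sub>\<mu> - R) / (6 * R\<^sub>\<mu>) * \<alpha>\<^sup>2 + (1 + R - R\<^sub>\<mu>) / (6 * R\<^sub>\<mu>) * \<beta>\<^sup>2
                 - x\<^sup>2 / (6 * R\<^sub>\<mu>)) \<and>
        (\<forall>x. \<alpha> \<le> \<bar>x\<bar> \<and> \<bar>x\<bar> \<le> \<beta> \<longrightarrow>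
           G x = (1 + R - R\<^sub>\<mu>) / (6 * R\<^sub>\<mu>) * (\<beta>\<^sup>2 - x\<^sup>2)))"

definition profile_v :: "real \<Rightarrow> real \<Rightarrow> real \<Rightarrow> (real \<Rightarrow> real) \<Rightarrow> (real \<Rightarrow> real) \<Rightarrow> bool" where
  "profile_v R R\<^sub>\<mu> \<eta> F G \<longleftrightarrow>
      (\<exists>\<beta> \<gamma>. (\<forall>b c. (0 < b \<and> b < c \<and>
                  b ^ 3 = 9 / 2 * (R\<^sub>\<mu> / (1 + R - R\<^sub>\<mu>)) \<and>
                  c ^ 3 = 9 / 2 * ((1 + R) * \<eta>\<^sup>2 + R)) \<longleftrightarrow> b = \<beta> \<and> c = \<gamma>) \<and>
        positivity_set F = {-\<gamma><..<\<gamma>} \<and> positivity_set G = {-\<beta><..<\<beta>} \<and>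
        (\<forall>x. \<bar>x\<bar> \<le> \<beta> \<longrightarrow>
           \<eta>\<^sup>2 * F x = \<gamma>\<^sup>2 / (6 * (1 + R))
                      - R * (1 + R - R\<^sub>\<mu>) / (6 * (1 + R) * R\<^sub>\<mu>) * \<beta>\<^sup>2
                      - (R\<^sub>\<mu> - R) / (6 * R\<^sub>\<mu>) * x\<^sup>2) \<and>
        (\<forall>x. \<beta> \<le> \<bar>x\<bar> \<and> \<bar>x\<bar> \<le> \<gamma> \<longrightarrow> \<eta>\<^sup>2 * F x = 1 / (6 * (1 + R)) * (\<gamma>\<^sup>2 - x\<^sup>2)) \<and>
        (\<forall>x. \<bar>x\<bar> \<le> \<beta> \<longrightarrow> G x = (1 + R - R\<^sub>\<mu>) / (6 * R\<^sub>\<mu>) * (\<beta>\<^sup>2 - x\<^sup>2)))"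

section \<open>Candidate pairs and their verification\<close>

text \<open>Each coefficient is a jump of a slope in the variable \<open>x\<^sup>2\<close>. Where
  both phases are present, \<open>\<eta>\<^sup>2 * F\<close> and \<open>G\<close> fall with slopes
  \<open>(M - R) / (6 * M)\<close> and \<open>(1 + R - M) / (6 * M)\<close>; alone, with
  \<open>1 / (6 * (1 + R))\<close> and \<open>1 / (6 * M)\<close>. The coefficient at a radius is
  the slope just inside minus the slope just outside. The form \<open>0 / \<eta>\<^sup>2\<close>
  keeps the common denominator for \<open>caps_scale\<close>.\<close>

definition F_inner :: "real \<Rightarrow> real \<Rightarrow> real \<Rightarrow> real \<Rightarrow> real \<Rightarrow> real \<Rightarrow> real \<Rightarrow> real" where
  "F_inner R M \<eta> \<alpha> \<beta> \<gamma> =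
     caps (- (R * (M - R - 1) / (6 * M * (1 + R))) / \<eta>\<^sup>2) \<alpha> ((M - R) / (6 * M) / \<eta>\<^sup>2) \<beta> (0 / \<eta>\<^sup>2) \<gamma>"

definition G_outer :: "real \<Rightarrow> real \<Rightarrow> real \<Rightarrow> real \<Rightarrow> real \<Rightarrow> real \<Rightarrow> real" where
  "G_outer R M \<alpha> \<beta> \<gamma> =
     caps ((M - R - 1) / (6 * M)) \<alpha> (- ((M - R) / (6 * M))) \<beta> (1 / (6 * M)) \<gamma>"

definition G_inner :: "real \<Rightarrow> real \<Rightarrow> real \<Rightarrow> real \<Rightarrow> real \<Rightarrow> real \<Rightarrow> real" where
  "G_inner R M \<alpha> \<beta> \<gamma> = caps (- ((R - M) / (6 * M))) \<alpha> ((1 + R - M) / (6 * M)) \<beta> 0 \<gamma>"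

definition F_outer :: "real \<Rightarrow> real \<Rightarrow> real \<Rightarrow> real \<Rightarrow> real \<Rightarrow> real \<Rightarrow> real \<Rightarrow> real" where
  "F_outer R M \<eta> \<alpha> \<beta> \<gamma> =
     caps ((R - M) / (6 * M) / \<eta>\<^sup>2) \<alpha> (- (R * (1 + R - M) / (6 * (1 + R) * M)) / \<eta>\<^sup>2) \<beta>
       (1 / (6 * (1 + R)) / \<eta>\<^sup>2) \<gamma>"

lemma regular_solutionI:
  assumes "even_SS_solution R M \<eta> F G" "continuous_on UNIV F" "continuous_on UNIV G"
    and "\<And>x. 0 \<le> F x" "\<And>x. 0 \<le> G x"
  shows "regular_solution R M \<eta> F G"
  using assms by (auto simp: regular_solution_def positivity_set_def intro: antisym simp: not_less)

lemma regular_solution_unique: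
  assumes "R > 0" "M > 0" "\<eta> > 0" "regular_solution R M \<eta> F G" "regular_solution R M \<eta> F' G'"
  shows "F = F'" "G = G'"
proof -
  have sol: "even_SS_solution R M \<eta> F G" "even_SS_solution R M \<eta> F' G'"
    and cont: "continuous_on UNIV F" "continuous_on UNIV F'" "continuous_on UNIV G" "continuous_on UNIV G'"
    using assms(4,5) by (auto simp: regular_solution_def)
  note ae = even_SS_solution_unique[OF assms(1-3) sol]
  have ae': "AE x in lebesgue. x \<in> UNIV \<longrightarrow> F x = F' x" "AE x in lebesgue. x \<in> UNIV \<longrightarrow> G x = G' x"
    using ae by auto
  show "F = F'"
    by (rule ext, rule continuous_AE_eq_on[OF cont(1,2) open_UNIV ae'(1) UNIV_I])
  show "G = G'"
    by (rule ext, rule continuous_AE_eq_on[OF cont(3,4) open_UNIV ae'(2) UNIV_I])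
qed

lemma combination_divide: "a / k * u + b / k * v + c / k * w = (a * u + b * v + c * w) / (k::real)"
  by (simp add: add_divide_distrib)

lemma alternating_divide: "a / k * u - b / k * v + c / k * w = (a * u - b * v + c * w) / (k::real)"
  by (simp add: diff_divide_distrib add_divide_distrib)

lemma difference_divide: "a / k * u - b / k * v = (a * u - b * v) / (k::real)"
  by (simp add: diff_divide_distrib)

text \<open>Weak inequalities between the radii let one statement cover \<alpha> = 0 and \<beta> =
  \<gamma>. The restriction \<open>x \<noteq> 0\<close> on \<open>G\<close> serves the case \<alpha>
  = 0, where \<open>G\<close> is positive at 0 although \<open>\<alpha> < \<bar>x\<bar>\<close>
  fails there.\<close>

lemma regular_inner_F:
  fixes R M \<eta> \<alpha> \<beta> \<gamma> :: real
  assumes par: "R > 0" "M > 0" "\<eta> > 0" and r: "0 \<le> \<alpha>" "\<alpha> \<le> \<beta>" "\<beta> \<le> \<gamma>"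
    and mass: "(M - R) / (6 * M) * \<beta> ^ 3 - R * (M - R - 1) / (6 * M * (1 + R)) * \<alpha> ^ 3 = 3 / 4 * \<eta>\<^sup>2"
      "1 / (6 * M) * \<gamma> ^ 3 - (M - R) / (6 * M) * \<beta> ^ 3 + (M - R - 1) / (6 * M) * \<alpha> ^ 3 = 3 / 4"
    and F: "\<And>x. F_inner R M \<eta> \<alpha> \<beta> \<gamma> x > 0 \<longleftrightarrow> \<bar>x\<bar> < \<beta>" "\<And>x. F_inner R M \<eta> \<alpha> \<beta> \<gamma> x \<ge> 0"
    and G: "\<And>x. G_outer R M \<alpha> \<beta> \<gamma> x > 0 \<Longrightarrow> x \<noteq> 0 \<Longrightarrow> \<alpha> < \<bar>x\<bar> \<and> \<bar>x\<bar> < \<gamma>" "\<And>x. G_outer R M \<alpha> \<beta> \<gamma> x \<ge> 0"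
  shows "regular_solution R M \<eta> (F_inner R M \<eta> \<alpha> \<beta> \<gamma>) (G_outer R M \<alpha> \<beta> \<gamma>)"
proof (rule regular_solutionI)
  let ?f1 = "- (R * (M - R - 1) / (6 * M * (1 + R))) / \<eta>\<^sup>2" and ?f2 = "(M - R) / (6 * M) / \<eta>\<^sup>2"
  let ?g1 = "(M - R - 1) / (6 * M)" and ?g2 = "- ((M - R) / (6 * M))" and ?g3 = "1 / (6 * M)"
  show "even_SS_solution R M \<eta> (F_inner R M \<eta> \<alpha> \<beta> \<gamma>) (G_outer R M \<alpha> \<beta> \<gamma>)"
    unfolding F_inner_def G_outer_def
  proof (rule caps_even_SS_solution)
    show "0 \<le> \<alpha>" "0 \<le> \<beta>" "0 \<le> \<gamma>"
      using r by auto
    show "0 \<le> caps ?f1 \<alpha> ?f2 \<beta> (0 / \<eta>\<^sup>2) \<gamma> x" "0 \<le> caps ?g1 \<alpha> ?g2 \<beta> ?g3 \<gamma> x" for x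
      using F(2)[of x] G(2)[of x] by (simp_all add: F_inner_def G_outer_def)
    have "- (R * (M - R - 1) / (6 * M * (1 + R))) * \<alpha> ^ 3 + (M - R) / (6 * M) * \<beta> ^ 3 + 0 * \<gamma> ^ 3 = 3 / 4 * \<eta>\<^sup>2"
      using mass(1) by simp
    then show "?f1 * \<alpha> ^ 3 + ?f2 * \<beta> ^ 3 + 0 / \<eta>\<^sup>2 * \<gamma> ^ 3 = 3 / 4"
      unfolding combination_divide using par by simp
    show "?g1 * \<alpha> ^ 3 + ?g2 * \<beta> ^ 3 + ?g3 * \<gamma> ^ 3 = 3 / 4"
      using mass(2) by simp
    \<comment> \<open>In the first potential the \<alpha>-terms cancel, and on
      \<open>{F > 0}\<close> the other two sum to 1/6. In the second the \<beta>-terms cancel and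
      the \<gamma>-term alone is 1/6; its \<alpha>-indicator is 0 on \<open>{G > 0}\<close> away
      from 0.\<close>
    have c1: "(1 + R) * \<eta>\<^sup>2 * ?f1 + R * ?g1 = 0"
      and c2: "((1 + R) * \<eta>\<^sup>2 * ?f2 + R * ?g2) + ((1 + R) * \<eta>\<^sup>2 * (0 / \<eta>\<^sup>2) + R * ?g3) = 1 / 6"
      and c3: "M * (\<eta>\<^sup>2 * ?f2 + ?g2) = 0" and c4: "M * (\<eta>\<^sup>2 * (0 / \<eta>\<^sup>2) + ?g3) = 1 / 6"
      using par by (simp_all add: divide_simps) (simp_all add: algebra_simps)
    show "((1 + R) * \<eta>\<^sup>2 * ?f1 + R * ?g1) * indicator {-\<alpha>..\<alpha>} x + ((1 + R) * \<eta>\<^sup>2 * ?f2 + R * ?g2) * indicator {-\<beta>..\<beta>} x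
        + ((1 + R) * \<eta>\<^sup>2 * (0 / \<eta>\<^sup>2) + R * ?g3) * indicator {-\<gamma>..\<gamma>} x = 1 / 6"
      if "0 < caps ?f1 \<alpha> ?f2 \<beta> (0 / \<eta>\<^sup>2) \<gamma> x" for x
    proof -
      have "\<bar>x\<bar> < \<beta>"
        using that F(1)[of x] by (simp add: F_inner_def)
      then have "x \<in> {-\<beta>..\<beta>}" "x \<in> {-\<gamma>..\<gamma>}"
        using r by auto
      then show ?thesis
        unfolding c1 using c2 by simp
    qed
    show "M * (\<eta>\<^sup>2 * ?f1 + ?g1) * indicator {-\<alpha>..\<alpha>} x + M * (\<eta>\<^sup>2 * ?f2 + ?g2) * indicator {-\<beta>..\<beta>} x
        + M * (\<eta>\<^sup>2 * (0 / \<eta>\<^sup>2) + ?g3) * indicator {-\<gamma>..\<gamma>} x = 1 / 6"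
      if "0 < caps ?g1 \<alpha> ?g2 \<beta> ?g3 \<gamma> x" "x \<noteq> 0" for x
    proof -
      have "\<alpha> < \<bar>x\<bar>" "\<bar>x\<bar> < \<gamma>"
        using that G(1)[of x] by (auto simp: G_outer_def)
      then have "x \<notin> {-\<alpha>..\<alpha>}" "x \<in> {-\<gamma>..\<gamma>}"
        by auto
      then show ?thesis
        unfolding c3 c4 by simp
    qed
  qed
qed (use F G in \<open>auto simp: F_inner_def G_outer_def continuous_caps\<close>)

text \<open>Now \<open>F\<close> reaches out to \<gamma>: in the first potential the \<beta>-terms
  cancel and the \<gamma>-term alone is 1/6, in the second the \<alpha>-terms cancel and the
  \<beta>- and \<gamma>-terms sum to 1/6.\<close>

lemma regular_inner_G:
  fixes R M \<eta> \<alpha> \<beta> \<gamma> :: real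
  assumes par: "R > 0" "M > 0" "\<eta> > 0" and r: "0 \<le> \<alpha>" "\<alpha> \<le> \<beta>" "\<beta> \<le> \<gamma>"
    and mass: "(1 + R - M) / (6 * M) * \<beta> ^ 3 - (R - M) / (6 * M) * \<alpha> ^ 3 = 3 / 4"
      "1 / (6 * (1 + R)) * \<gamma> ^ 3 - R * (1 + R - M) / (6 * (1 + R) * M) * \<beta> ^ 3 + (R - M) / (6 * M) * \<alpha> ^ 3
        = 3 / 4 * \<eta>\<^sup>2"
    and G: "\<And>x. G_inner R M \<alpha> \<beta> \<gamma> x > 0 \<longleftrightarrow> \<bar>x\<bar> < \<beta>" "\<And>x. G_inner R M \<alpha> \<beta> \<gamma> x \<ge> 0"
    and F: "\<And>x. F_outer R M \<eta> \<alpha> \<beta> \<gamma> x > 0 \<Longrightarrow> x \<noteq> 0 \<Longrightarrow> \<alpha> < \<bar>x\<bar> \<and> \<bar>x\<bar> < \<gamma>" "\<And>x. F_outer R M \<eta> \<alpha> \<beta> \<gamma> x \<ge> 0"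
  shows "regular_solution R M \<eta> (F_outer R M \<eta> \<alpha> \<beta> \<gamma>) (G_inner R M \<alpha> \<beta> \<gamma>)"
proof (rule regular_solutionI)
  let ?f1 = "(R - M) / (6 * M) / \<eta>\<^sup>2" and ?f2 = "- (R * (1 + R - M) / (6 * (1 + R) * M)) / \<eta>\<^sup>2"
    and ?f3 = "1 / (6 * (1 + R)) / \<eta>\<^sup>2"
  let ?g1 = "- ((R - M) / (6 * M))" and ?g2 = "(1 + R - M) / (6 * M)"
  show "even_SS_solution R M \<eta> (F_outer R M \<eta> \<alpha> \<beta> \<gamma>) (G_inner R M \<alpha> \<beta> \<gamma>)"
    unfolding F_outer_def G_inner_def
  proof (rule caps_even_SS_solution)
    show "0 \<le> \<alpha>" "0 \<le> \<beta>" "0 \<le> \<gamma>"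
      using r by auto
    show "0 \<le> caps ?f1 \<alpha> ?f2 \<beta> ?f3 \<gamma> x" "0 \<le> caps ?g1 \<alpha> ?g2 \<beta> 0 \<gamma> x" for x
      using F(2)[of x] G(2)[of x] by (simp_all add: F_outer_def G_inner_def)
    have "(R - M) / (6 * M) * \<alpha> ^ 3 + - (R * (1 + R - M) / (6 * (1 + R) * M)) * \<beta> ^ 3 + 1 / (6 * (1 + R)) * \<gamma> ^ 3
        = 3 / 4 * \<eta>\<^sup>2"
      using mass(2) by simp
    then show "?f1 * \<alpha> ^ 3 + ?f2 * \<beta> ^ 3 + ?f3 * \<gamma> ^ 3 = 3 / 4"
      unfolding combination_divide using par by simp
    show "?g1 * \<alpha> ^ 3 + ?g2 * \<beta> ^ 3 + 0 * \<gamma> ^ 3 = 3 / 4"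
      using mass(1) by simp
    have c1: "(1 + R) * \<eta>\<^sup>2 * ?f2 + R * ?g2 = 0" and c2: "(1 + R) * \<eta>\<^sup>2 * ?f3 + R * 0 = 1 / 6"
      and c3: "M * (\<eta>\<^sup>2 * ?f1 + ?g1) = 0" and c4: "M * (\<eta>\<^sup>2 * ?f2 + ?g2) + M * (\<eta>\<^sup>2 * ?f3 + 0) = 1 / 6"
      using par by (simp_all add: divide_simps) (simp_all add: algebra_simps)
    show "((1 + R) * \<eta>\<^sup>2 * ?f1 + R * ?g1) * indicator {-\<alpha>..\<alpha>} x + ((1 + R) * \<eta>\<^sup>2 * ?f2 + R * ?g2) * indicator {-\<beta>..\<beta>} x
        + ((1 + R) * \<eta>\<^sup>2 * ?f3 + R * 0) * indicator {-\<gamma>..\<gamma>} x = 1 / 6"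
      if "0 < caps ?f1 \<alpha> ?f2 \<beta> ?f3 \<gamma> x" "x \<noteq> 0" for x
    proof -
      have "\<alpha> < \<bar>x\<bar>" "\<bar>x\<bar> < \<gamma>"
        using that F(1)[of x] by (auto simp: F_outer_def)
      then have "x \<notin> {-\<alpha>..\<alpha>}" "x \<in> {-\<gamma>..\<gamma>}"
        by auto
      then show ?thesis
        unfolding c1 c2 by simp
    qed
    show "M * (\<eta>\<^sup>2 * ?f1 + ?g1) * indicator {-\<alpha>..\<alpha>} x + M * (\<eta>\<^sup>2 * ?f2 + ?g2) * indicator {-\<beta>..\<beta>} x
        + M * (\<eta>\<^sup>2 * ?f3 + 0) * indicator {-\<gamma>..\<gamma>} x = 1 / 6"
      if "0 < caps ?g1 \<alpha> ?g2 \<beta> 0 \<gamma> x" for x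
    proof -
      have "\<bar>x\<bar> < \<beta>"
        using that G(1)[of x] by (simp add: G_inner_def)
      then have "x \<in> {-\<beta>..\<beta>}" "x \<in> {-\<gamma>..\<gamma>}"
        using r by auto
      then show ?thesis
        unfolding c3 using c4 by simp
    qed
  qed
qed (use F G in \<open>auto simp: F_outer_def G_inner_def continuous_caps\<close>)

lemma F_inner_scale: "F_inner R M \<eta> \<alpha> \<beta> \<gamma> x =
    caps (- (R * (M - R - 1) / (6 * M * (1 + R)))) \<alpha> ((M - R) / (6 * M)) \<beta> 0 \<gamma> x / \<eta>\<^sup>2"
  unfolding F_inner_def by (rule caps_scale)

lemma F_outer_scale: "F_outer R M \<eta> \<alpha> \<beta> \<gamma> x =
    caps ((R - M) / (6 * M)) \<alpha> (- (R * (1 + R - M) / (6 * (1 + R) * M))) \<beta> (1 / (6 * (1 + R))) \<gamma> x / \<eta>\<^sup>2"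
  unfolding F_outer_def by (rule caps_scale)

lemma interval_determines_radius:
  fixes b \<beta> :: real
  assumes "0 < b" "0 < \<beta>" "{-b<..<b} = {-\<beta><..<\<beta>}"
  shows "b = \<beta>"
  using assms greaterThanLessThan_eq_iff[of "-b" b "-\<beta>" \<beta>] by simp

text \<open>Intersecting with the positive half-line leaves a single nonempty interval, whose end
  points are determined; this includes the punctured case \<open>a = 0\<close>.\<close>

lemma annulus_determines_radii:
  fixes a c \<alpha> \<gamma> :: real
  assumes "0 \<le> a" "a < c" "0 \<le> \<alpha>" "\<alpha> < \<gamma>"
    and "{-c<..<-a} \<union> {a<..<c} = {-\<gamma><..<-\<alpha>} \<union> {\<alpha><..<\<gamma>}"
  shows "a = \<alpha>" "c = \<gamma>"
proof -
  have "{a<..<c} = ({-c<..<-a} \<union> {a<..<c}) \<inter> {0<..}"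
    using assms(1,2) by auto
  also have "\<dots> = {\<alpha><..<\<gamma>}"
    unfolding assms(5) using assms(3,4) by auto
  finally show "a = \<alpha>" "c = \<gamma>"
    using assms greaterThanLessThan_eq_iff[of a c \<alpha> \<gamma>] by auto
qed

lemma positivity_set_interval:
  assumes "\<And>x. 0 < f x \<longleftrightarrow> \<bar>x\<bar> < r"
  shows "positivity_set f = {-r<..<r}"
  unfolding positivity_set_def assms by (auto simp: abs_less_iff)

lemma positivity_set_annulus:
  assumes "0 \<le> a" "\<And>x. 0 < f x \<longleftrightarrow> a < \<bar>x\<bar> \<and> \<bar>x\<bar> < c"
  shows "positivity_set f = {-c<..<-a} \<union> {a<..<c}"
  unfolding positivity_set_def assms(2) using assms(1) by (auto simp: abs_if split: if_splits)

section \<open>The five regimes\<close>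

text \<open>Here \<open>a / c = K\<close>, so the threshold of \<open>ex_two_hump_radii\<close>
  reads \<open>1 \<le> \<eta>\<^sup>2 * (sqrt K - 1)\<close>, that is
  \<open>\<rho> \<le> sqrt K\<close>; squaring gives exactly
  \<open>R\<mu>_plus R \<eta> \<le> M\<close>.\<close>

lemma profile_iii_solution:
  assumes par: "R > 0" "M > 0" "\<eta> > 0" and M: "M \<ge> R\<mu>_plus R \<eta>"
  obtains F G where "regular_solution R M \<eta> F G" "profile_iii R M \<eta> F G"
proof -
  define \<rho> where "\<rho> = (1 + \<eta>\<^sup>2) / \<eta>\<^sup>2"
  define K where "K = M - R"
  have \<rho>: "\<rho> = 1 + 1 / \<eta>\<^sup>2"
    using par by (simp add: \<rho>_def field_simps)
  then have \<rho>1: "\<rho> > 1"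
    using par by simp
  have K: "\<rho>\<^sup>2 \<le> K"
    using M by (simp add: R\<mu>_plus_def K_def \<rho>_def)
  have "1 < \<rho>\<^sup>2"
    using \<rho>1 by (simp add: one_less_power)
  with K have K1: "K > 1"
    by simp
  have sqrtK: "\<rho> \<le> sqrt K"
    using K \<rho>1 by (simp add: real_le_rsqrt)
  define a where "a = (M - R) / (6 * M)"
  define b where "b = R * (M - R - 1) / (6 * M * (1 + R))"
  define c where "c = 1 / (6 * M)"
  define e where "e = (M - R - 1) / (6 * M)"
  have "R * (M - R - 1) < (M - R) * (1 + R)"
    using K1 par by (simp add: K_def algebra_simps)
  then have ba: "b < a"
    using par by (simp add: a_def b_def divide_simps)
  have coef: "0 < a" "b < a" "0 < c" "0 < e" "a = c + e"
    using ba K1 par by (simp_all add: a_def c_def e_def K_def add_divide_distrib[symmetric])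
  define sys where "sys u v w \<longleftrightarrow> 0 \<le> u \<and> u < v \<and> v < w \<and>
      (M - R) * v ^ 3 - R * (M - R - 1) / (1 + R) * u ^ 3 = 9 * \<eta>\<^sup>2 * M / 2 \<and>
      w ^ 3 - (M - R) * v ^ 3 + (M - R - 1) * u ^ 3 = 9 * M / 2 \<and>
      w\<^sup>2 - (M - R) * v\<^sup>2 + (M - R - 1) * u\<^sup>2 = 0" for u v w
  have m1: "a * v ^ 3 - b * u ^ 3 = ((M - R) * v ^ 3 - R * (M - R - 1) / (1 + R) * u ^ 3) / (6 * M)" for u v
  proof -
    have "b = R * (M - R - 1) / (1 + R) / (6 * M)"
      by (simp add: b_def mult.commute)
    then show ?thesis
      unfolding a_def by (simp only: difference_divide)
  qed
  have m2: "c * w ^ n - a * v ^ n + e * u ^ n = (w ^ n - (M - R) * v ^ n + (M - R - 1) * u ^ n) / (6 * M)" for u v w n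
    unfolding a_def c_def e_def by (simp only: alternating_divide mult_1_left)
  have sys_iff: "sys u v w \<longleftrightarrow> 0 \<le> u \<and> u < v \<and> v < w \<and> a * v ^ 3 - b * u ^ 3 = 3 / 4 * \<eta>\<^sup>2 \<and>
      c * w ^ 3 - a * v ^ 3 + e * u ^ 3 = 3 / 4 \<and> c * w\<^sup>2 - a * v\<^sup>2 + e * u\<^sup>2 = 0" for u v w
  proof -
    have "r / (6 * M) = 3 / 4 * \<eta>\<^sup>2 \<longleftrightarrow> r = 9 * \<eta>\<^sup>2 * M / 2" "r / (6 * M) = 3 / 4 \<longleftrightarrow> r = 9 * M / 2"
      "r / (6 * M) = 0 \<longleftrightarrow> r = 0" for r
      using par by (auto simp: field_simps)
    note eqs = this
    show ?thesis
      unfolding sys_def m1 m2 eqs ..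
  qed
  let ?F = "F_inner R M \<eta>" and ?G = "G_outer R M"
  have pF: "?F u v w x = caps (- b) u a v 0 w x / \<eta>\<^sup>2" for u v w x
    by (simp add: F_inner_scale a_def b_def)
  have pG: "?G u v w = caps e u (- a) v c w" for u v w
    by (simp add: G_outer_def a_def c_def e_def)
  \<comment> \<open>Proved for every solution of the system and not only for a constructed one,
    because uniqueness of the radii is deduced from it.\<close>
  have sol: "regular_solution R M \<eta> (?F u v w) (?G u v w) \<and> positivity_set (?F u v w) = {-v<..<v} \<and>
      positivity_set (?G u v w) = {-w<..<-u} \<union> {u<..<w}" if s: "sys u v w" for u v w
  proof -
    have ord: "0 \<le> u" "u < v" "v < w" and mass: "a * v ^ 3 - b * u ^ 3 = 3 / 4 * \<eta>\<^sup>2"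
      "c * w ^ 3 - a * v ^ 3 + e * u ^ 3 = 3 / 4" and van: "c * w\<^sup>2 - a * v\<^sup>2 + e * u\<^sup>2 = 0"
      using s unfolding sys_iff by blast+
    note prof = two_hump_profile(1-4)[OF ord coef van]
    have F: "?F u v w x > 0 \<longleftrightarrow> \<bar>x\<bar> < v" "?F u v w x \<ge> 0" for x
      using prof(1,2)[of x] par by (simp_all add: pF zero_less_divide_iff)
    have G: "?G u v w x > 0 \<longleftrightarrow> u < \<bar>x\<bar> \<and> \<bar>x\<bar> < w" "?G u v w x \<ge> 0" for x
      using prof(3,4)[of x] by (simp_all add: pG)
    have "regular_solution R M \<eta> (?F u v w) (?G u v w)"
    proof (rule regular_inner_F[OF par])
      show "\<And>x. 0 < ?G u v w x \<Longrightarrow> x \<noteq> 0 \<Longrightarrow> u < \<bar>x\<bar> \<and> \<bar>x\<bar> < w"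
        using G(1) by blast
    qed (use ord in simp, use ord in simp, use ord in simp,
        fact mass(1)[unfolded a_def b_def], fact mass(2)[unfolded a_def c_def e_def], fact F, fact F, fact G)
    moreover have "positivity_set (?F u v w) = {-v<..<v}"
      using F(1) by (rule positivity_set_interval)
    moreover have "positivity_set (?G u v w) = {-w<..<-u} \<union> {u<..<w}"
      using ord(1) G(1) by (rule positivity_set_annulus)
    ultimately show ?thesis by blast
  qed
  have "3 / 4 * a \<le> 3 / 4 * \<eta>\<^sup>2 * (c * sqrt (a / c) ^ 3 - a)"
  proof -
    have ac: "a / c = K" "a = c * K"
      using par by (simp_all add: a_def c_def K_def)
    have "sqrt K ^ 3 = K * sqrt K"
      using K1 by (simp add: power3_eq_cube)
    then have "c * sqrt (a / c) ^ 3 - a = a * (sqrt K - 1)"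
      unfolding ac(1) using ac(2) by (simp add: algebra_simps)
    moreover have "1 \<le> \<eta>\<^sup>2 * (sqrt K - 1)"
    proof -
      have "\<eta>\<^sup>2 * (1 / \<eta>\<^sup>2) \<le> \<eta>\<^sup>2 * (sqrt K - 1)"
        using sqrtK \<rho> by (intro mult_left_mono) auto
      then show ?thesis
        using par by simp
    qed
    then have "a * 1 \<le> a * (\<eta>\<^sup>2 * (sqrt K - 1))"
      using coef(1) by (intro mult_left_mono) auto
    ultimately show ?thesis
      by (simp add: algebra_simps)
  qed
  then obtain \<alpha> \<beta> \<gamma> where "0 \<le> \<alpha>" "\<alpha> < \<beta>" "\<beta> < \<gamma>" "a * \<beta> ^ 3 - b * \<alpha> ^ 3 = 3 / 4 * \<eta>\<^sup>2"
    "c * \<gamma> ^ 3 - a * \<beta> ^ 3 + e * \<alpha> ^ 3 = 3 / 4" "c * \<gamma>\<^sup>2 - a * \<beta>\<^sup>2 + e * \<alpha>\<^sup>2 = 0"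
    using ex_two_hump_radii[OF coef, of "3 / 4 * \<eta>\<^sup>2" "3 / 4"] par by auto
  note rad = this
  have s: "sys \<alpha> \<beta> \<gamma>"
    unfolding sys_iff using rad by blast
  \<comment> \<open>Two solutions of the system yield the same pair of functions, hence the same
    positivity sets, hence the same radii.\<close>
  have uniq: "sys u v w \<longleftrightarrow> u = \<alpha> \<and> v = \<beta> \<and> w = \<gamma>" for u v w
  proof
    assume s': "sys u v w"
    note S = sol[OF s] and S' = sol[OF s']
    have ord: "0 \<le> u" "u < v" "v < w"
      using s' unfolding sys_def by blast+
    have "?F u v w = ?F \<alpha> \<beta> \<gamma>" "?G u v w = ?G \<alpha> \<beta> \<gamma>"
      using regular_solution_unique[OF par] S S' by blast+
    then have eq: "{-v<..<v} = {-\<beta><..<\<beta>}" "{-w<..<-u} \<union> {u<..<w} = {-\<gamma><..<-\<alpha>} \<union> {\<alpha><..<\<gamma>}"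
      using S S' by simp_all
    have "v = \<beta>"
      using interval_determines_radius[OF _ _ eq(1)] ord rad by simp
    then show "u = \<alpha> \<and> v = \<beta> \<and> w = \<gamma>"
      using annulus_determines_radii[OF _ _ _ _ eq(2)] ord rad by simp
  qed (use s in simp)
  note form = two_hump_profile(5-8)[OF rad(1-3) coef rad(6)]
  have "profile_iii R M \<eta> (?F \<alpha> \<beta> \<gamma>) (?G \<alpha> \<beta> \<gamma>)"
    unfolding profile_iii_def
  proof (intro exI conjI)
    show "\<forall>u v w. (0 \<le> u \<and> u < v \<and> v < w \<and>
      (M - R) * v ^ 3 - R * (M - R - 1) / (1 + R) * u ^ 3 = 9 * \<eta>\<^sup>2 * M / 2 \<and>
      w ^ 3 - (M - R) * v ^ 3 + (M - R - 1) * u ^ 3 = 9 * M / 2 \<and>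
      w\<^sup>2 - (M - R) * v\<^sup>2 + (M - R - 1) * u\<^sup>2 = 0) \<longleftrightarrow> u = \<alpha> \<and> v = \<beta> \<and> w = \<gamma>"
      using uniq unfolding sys_def by blast
    show "positivity_set (?F \<alpha> \<beta> \<gamma>) = {-\<beta><..<\<beta>}" "positivity_set (?G \<alpha> \<beta> \<gamma>) = {-\<gamma><..<-\<alpha>} \<union> {\<alpha><..<\<gamma>}"
      using sol[OF s] by auto
    have ab: "a - b = 1 / (6 * (1 + R))"
      using par by (simp add: a_def b_def divide_simps) (simp add: algebra_simps)
    show "\<forall>x. \<bar>x\<bar> \<le> \<alpha> \<longrightarrow> \<eta>\<^sup>2 * ?F \<alpha> \<beta> \<gamma> x = (M - R) / (6 * M) * \<beta>\<^sup>2
        + R * (1 + R - M) / (6 * M * (1 + R)) * \<alpha>\<^sup>2 - x\<^sup>2 / (6 * (1 + R))"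
    proof (intro allI impI)
      fix x assume "\<bar>x\<bar> \<le> \<alpha>"
      have "\<eta>\<^sup>2 * ?F \<alpha> \<beta> \<gamma> x = a * (\<beta>\<^sup>2 - x\<^sup>2) - b * (\<alpha>\<^sup>2 - x\<^sup>2)"
        using form(1)[OF \<open>\<bar>x\<bar> \<le> \<alpha>\<close>] par by (simp add: pF)
      also have "\<dots> = a * \<beta>\<^sup>2 + (- b) * \<alpha>\<^sup>2 - (a - b) * x\<^sup>2"
        by (simp add: algebra_simps)
      also have "- b = R * (1 + R - M) / (6 * M * (1 + R))"
        unfolding b_def minus_divide_left by (simp add: algebra_simps)
      finally show "\<eta>\<^sup>2 * ?F \<alpha> \<beta> \<gamma> x = (M - R) / (6 * M) * \<beta>\<^sup>2
          + R * (1 + R - M) / (6 * M * (1 + R)) * \<alpha>\<^sup>2 - x\<^sup>2 / (6 * (1 + R))"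
        unfolding ab by (simp add: a_def)
    qed
    show "\<forall>x. \<alpha> \<le> \<bar>x\<bar> \<and> \<bar>x\<bar> \<le> \<beta> \<longrightarrow> \<eta>\<^sup>2 * ?F \<alpha> \<beta> \<gamma> x = (M - R) / (6 * M) * (\<beta>\<^sup>2 - x\<^sup>2)"
      using form(2) par by (simp add: pF a_def)
    have ee: "(1 + R - M) / (6 * M) = - e"
      unfolding e_def minus_divide_left by simp
    show "\<forall>x. \<alpha> \<le> \<bar>x\<bar> \<and> \<bar>x\<bar> \<le> \<beta> \<longrightarrow> ?G \<alpha> \<beta> \<gamma> x = (1 + R - M) / (6 * M) * (\<alpha>\<^sup>2 - x\<^sup>2)"
      unfolding ee using form(3) by (simp add: pG algebra_simps)
    show "\<forall>x. \<beta> \<le> \<bar>x\<bar> \<and> \<bar>x\<bar> \<le> \<gamma> \<longrightarrow> ?G \<alpha> \<beta> \<gamma> x = 1 / (6 * M) * (\<gamma>\<^sup>2 - x\<^sup>2)"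
      using form(4) by (simp add: pG c_def)
  qed
  then show ?thesis
    using that sol[OF s] by blast
qed

text \<open>The phases are exchanged: now \<open>d / c = K\<close> with
  \<open>K = R * (1 + R - M) / M\<close>, and clearing denominators in
  \<open>M \<le> R\<mu>_minus R \<eta>\<close> gives \<open>\<rho>\<^sup>2 \<le> K\<close>. The
  threshold of \<open>ex_two_hump_radii\<close> is again \<open>\<rho> \<le> sqrt K\<close>.\<close>

lemma profile_iv_solution:
  assumes par: "R > 0" "M > 0" "\<eta> > 0" and M: "M \<le> R\<mu>_minus R \<eta>"
  obtains F G where "regular_solution R M \<eta> F G" "profile_iv R M \<eta> F G"
proof -
  define X where "X = \<eta>\<^sup>2 * (1 + R) + R"
  define \<rho> where "\<rho> = X / R"
  define K where "K = R * (1 + R - M) / M"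
  have \<rho>: "\<rho> = 1 + \<eta>\<^sup>2 * (1 + R) / R"
    using par by (simp add: \<rho>_def X_def field_simps)
  then have \<rho>1: "\<rho> > 1"
    using par by simp
  have "0 < R ^ 3 + X\<^sup>2"
    using par by (intro add_pos_nonneg) auto
  then have "M * (R ^ 3 + X\<^sup>2) \<le> R ^ 3 * (1 + R)"
    using M by (simp add: R\<mu>_minus_def X_def pos_le_divide_eq)
  then have "M * X\<^sup>2 \<le> R\<^sup>2 * (R * (1 + R - M))"
    by (simp add: algebra_simps power2_eq_square power3_eq_cube)
  then have K: "\<rho>\<^sup>2 \<le> K"
    using par by (simp add: \<rho>_def K_def power_divide divide_simps mult.commute)
  have "1 < \<rho>\<^sup>2"
    using \<rho>1 by (simp add: one_less_power)
  with K have K1: "K > 1"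
    by simp
  \<comment> \<open>\<open>K > 1\<close> says \<open>M < R * (1 + R - M)\<close>, which rearranges
    to this product; it yields \<open>M < R\<close> and so the sign of \<open>b\<close>.\<close>
  then have "0 < (1 + R) * (R - M)"
    using par by (simp add: K_def field_simps)
  then have MR: "M < R"
    using par by (simp add: zero_less_mult_iff)
  have sqrtK: "\<rho> \<le> sqrt K"
    using K \<rho>1 by (simp add: real_le_rsqrt)
  define a where "a = (1 + R - M) / (6 * M)"
  define b where "b = (R - M) / (6 * M)"
  define c where "c = 1 / (6 * (1 + R))"
  define d where "d = R * (1 + R - M) / (6 * (1 + R) * M)"
  have ab: "a - b = 1 / (6 * M)"
    using par by (simp add: a_def b_def divide_simps)
  have cd: "d = c + b"
    using par by (simp add: b_def c_def d_def divide_simps) (simp add: algebra_simps)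
  have coef: "0 < a" "b < a" "0 < c" "0 < b" "d = c + b"
    using MR par cd by (simp_all add: a_def b_def c_def divide_strict_right_mono)
  define sys where "sys u v w \<longleftrightarrow> 0 \<le> u \<and> u < v \<and> v < w \<and>
      (1 + R - M) * v ^ 3 - (R - M) * u ^ 3 = 9 * M / 2 \<and>
      M * w ^ 3 - R * (1 + R - M) * v ^ 3 + (1 + R) * (R - M) * u ^ 3 = 9 / 2 * M * (1 + R) * \<eta>\<^sup>2 \<and>
      M * w\<^sup>2 - R * (1 + R - M) * v\<^sup>2 + (1 + R) * (R - M) * u\<^sup>2 = 0" for u v w
  have m1: "a * v ^ 3 - b * u ^ 3 = ((1 + R - M) * v ^ 3 - (R - M) * u ^ 3) / (6 * M)" for u v
    unfolding a_def b_def by (rule difference_divide)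
  have m2: "c * w ^ n - d * v ^ n + b * u ^ n
      = (M * w ^ n - R * (1 + R - M) * v ^ n + (1 + R) * (R - M) * u ^ n) / (6 * M * (1 + R))" for u v w n
  proof -
    have "b = (1 + R) * (R - M) / (6 * M * (1 + R))" "c = M / (6 * M * (1 + R))"
      using par by (simp_all add: b_def c_def)
    moreover have "d = R * (1 + R - M) / (6 * M * (1 + R))"
      by (simp add: d_def mult_ac)
    ultimately show ?thesis
      by (simp only: alternating_divide)
  qed
  have sys_iff: "sys u v w \<longleftrightarrow> 0 \<le> u \<and> u < v \<and> v < w \<and> a * v ^ 3 - b * u ^ 3 = 3 / 4 \<and>
      c * w ^ 3 - d * v ^ 3 + b * u ^ 3 = 3 / 4 * \<eta>\<^sup>2 \<and> c * w\<^sup>2 - d * v\<^sup>2 + b * u\<^sup>2 = 0" for u v w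
  proof -
    have eq1: "r / (6 * M) = 3 / 4 \<longleftrightarrow> r = 9 * M / 2" for r
      using par by (auto simp: field_simps)
    have eq2: "r / (6 * M * t) = 3 / 4 * \<eta>\<^sup>2 \<longleftrightarrow> r = 9 / 2 * M * t * \<eta>\<^sup>2" "r / (6 * M * t) = 0 \<longleftrightarrow> r = 0"
      if "t > 0" for r t
      using par that by (auto simp: field_simps)
    have "0 < 1 + R"
      using par by simp
    note eq2 = eq2[OF this]
    show ?thesis
      unfolding sys_def m1 m2 eq1 eq2 ..
  qed
  let ?F = "F_outer R M \<eta>" and ?G = "G_inner R M"
  have pF: "?F u v w x = caps b u (- d) v c w x / \<eta>\<^sup>2" for u v w x
    by (simp add: F_outer_scale b_def c_def d_def)
  have pG: "?G u v w = caps (- b) u a v 0 w" for u v w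
    by (simp add: G_inner_def a_def b_def)
  have sol: "regular_solution R M \<eta> (?F u v w) (?G u v w) \<and>
      positivity_set (?F u v w) = {-w<..<-u} \<union> {u<..<w} \<and> positivity_set (?G u v w) = {-v<..<v}"
    if s: "sys u v w" for u v w
  proof -
    have ord: "0 \<le> u" "u < v" "v < w" and mass: "a * v ^ 3 - b * u ^ 3 = 3 / 4"
      "c * w ^ 3 - d * v ^ 3 + b * u ^ 3 = 3 / 4 * \<eta>\<^sup>2" and van: "c * w\<^sup>2 - d * v\<^sup>2 + b * u\<^sup>2 = 0"
      using s unfolding sys_iff by blast+
    note prof = two_hump_profile(1-4)[OF ord coef van]
    have G: "?G u v w x > 0 \<longleftrightarrow> \<bar>x\<bar> < v" "?G u v w x \<ge> 0" for x
      using prof(1,2)[of x] by (simp_all add: pG)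
    have F: "?F u v w x > 0 \<longleftrightarrow> u < \<bar>x\<bar> \<and> \<bar>x\<bar> < w" "?F u v w x \<ge> 0" for x
      using prof(3,4)[of x] par by (simp_all add: pF zero_less_divide_iff)
    have "regular_solution R M \<eta> (?F u v w) (?G u v w)"
    proof (rule regular_inner_G[OF par])
      show "\<And>x. 0 < ?F u v w x \<Longrightarrow> x \<noteq> 0 \<Longrightarrow> u < \<bar>x\<bar> \<and> \<bar>x\<bar> < w"
        using F(1) by blast
    qed (use ord in simp, use ord in simp, use ord in simp,
        fact mass(1)[unfolded a_def b_def], fact mass(2)[unfolded b_def c_def d_def], fact G, fact G, fact F)
    moreover have "positivity_set (?G u v w) = {-v<..<v}"
      using G(1) by (rule positivity_set_interval)
    moreover have "positivity_set (?F u v w) = {-w<..<-u} \<union> {u<..<w}"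
      using ord(1) F(1) by (rule positivity_set_annulus)
    ultimately show ?thesis by blast
  qed
  have "3 / 4 * \<eta>\<^sup>2 * a \<le> 3 / 4 * (c * sqrt (d / c) ^ 3 - d)"
  proof -
    have dc: "d / c = K" "d = c * K"
      using par by (simp_all add: c_def d_def K_def)
    have "R * t / (6 * r * M) * (r / R) = t / (6 * M)" if "r \<noteq> 0" for r t
      using par that by simp
    from this[of "1 + R"] par have da: "d * ((1 + R) / R) = a"
      by (simp add: a_def d_def)
    have "sqrt K ^ 3 = K * sqrt K"
      using K1 by (simp add: power3_eq_cube)
    then have eq: "c * sqrt (d / c) ^ 3 - d = d * (sqrt K - 1)"
      unfolding dc(1) using dc(2) by (simp add: algebra_simps)
    have "\<eta>\<^sup>2 * a = d * (\<eta>\<^sup>2 * (1 + R) / R)"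
      unfolding da[symmetric] by simp
    also have "\<dots> \<le> d * (sqrt K - 1)"
      using sqrtK \<rho> coef by (intro mult_left_mono) auto
    finally show ?thesis
      unfolding eq by (simp add: mult.commute)
  qed
  then obtain \<alpha> \<beta> \<gamma> where rad: "0 \<le> \<alpha>" "\<alpha> < \<beta>" "\<beta> < \<gamma>" "a * \<beta> ^ 3 - b * \<alpha> ^ 3 = 3 / 4"
    "c * \<gamma> ^ 3 - d * \<beta> ^ 3 + b * \<alpha> ^ 3 = 3 / 4 * \<eta>\<^sup>2" "c * \<gamma>\<^sup>2 - d * \<beta>\<^sup>2 + b * \<alpha>\<^sup>2 = 0"
    using ex_two_hump_radii[OF coef, of "3 / 4" "3 / 4 * \<eta>\<^sup>2"] par by auto
  have s: "sys \<alpha> \<beta> \<gamma>"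
    unfolding sys_iff using rad by blast
  have uniq: "sys u v w \<longleftrightarrow> u = \<alpha> \<and> v = \<beta> \<and> w = \<gamma>" for u v w
  proof
    assume s': "sys u v w"
    note S = sol[OF s] and S' = sol[OF s']
    have ord: "0 \<le> u" "u < v" "v < w"
      using s' unfolding sys_def by blast+
    have "?F u v w = ?F \<alpha> \<beta> \<gamma>" "?G u v w = ?G \<alpha> \<beta> \<gamma>"
      using regular_solution_unique[OF par] S S' by blast+
    then have eq: "{-v<..<v} = {-\<beta><..<\<beta>}" "{-w<..<-u} \<union> {u<..<w} = {-\<gamma><..<-\<alpha>} \<union> {\<alpha><..<\<gamma>}"
      using S S' by simp_all
    have "v = \<beta>"
      using interval_determines_radius[OF _ _ eq(1)] ord rad by simp
    then show "u = \<alpha> \<and> v = \<beta> \<and> w = \<gamma>"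
      using annulus_determines_radii[OF _ _ _ _ eq(2)] ord rad by simp
  qed (use s in simp)
  note form = two_hump_profile(5-8)[OF rad(1-3) coef rad(6)]
  have bb: "(M - R) / (6 * M) = - b"
    unfolding b_def minus_divide_left by simp
  have "profile_iv R M \<eta> (?F \<alpha> \<beta> \<gamma>) (?G \<alpha> \<beta> \<gamma>)"
    unfolding profile_iv_def
  proof (intro exI conjI)
    show "\<forall>u v w. (0 \<le> u \<and> u < v \<and> v < w \<and>
      (1 + R - M) * v ^ 3 - (R - M) * u ^ 3 = 9 * M / 2 \<and>
      M * w ^ 3 - R * (1 + R - M) * v ^ 3 + (1 + R) * (R - M) * u ^ 3 = 9 / 2 * M * (1 + R) * \<eta>\<^sup>2 \<and>
      M * w\<^sup>2 - R * (1 + R - M) * v\<^sup>2 + (1 + R) * (R - M) * u\<^sup>2 = 0) \<longleftrightarrow> u = \<alpha> \<and> v = \<beta> \<and> w = \<gamma>"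
      using uniq unfolding sys_def by blast
    show "positivity_set (?F \<alpha> \<beta> \<gamma>) = {-\<gamma><..<-\<alpha>} \<union> {\<alpha><..<\<gamma>}" "positivity_set (?G \<alpha> \<beta> \<gamma>) = {-\<beta><..<\<beta>}"
      using sol[OF s] by auto
    show "\<forall>x. \<alpha> \<le> \<bar>x\<bar> \<and> \<bar>x\<bar> \<le> \<beta> \<longrightarrow> \<eta>\<^sup>2 * ?F \<alpha> \<beta> \<gamma> x = (M - R) / (6 * M) * (\<alpha>\<^sup>2 - x\<^sup>2)"
      unfolding bb using form(3) par by (simp add: pF algebra_simps)
    show "\<forall>x. \<beta> \<le> \<bar>x\<bar> \<and> \<bar>x\<bar> \<le> \<gamma> \<longrightarrow> \<eta>\<^sup>2 * ?F \<alpha> \<beta> \<gamma> x = 1 / (6 * (1 + R)) * (\<gamma>\<^sup>2 - x\<^sup>2)"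
      using form(4) par by (simp add: pF c_def)
    show "\<forall>x. \<bar>x\<bar> \<le> \<alpha> \<longrightarrow> ?G \<alpha> \<beta> \<gamma> x = (M - R) / (6 * M) * \<alpha>\<^sup>2 + (1 + R - M) / (6 * M) * \<beta>\<^sup>2 - x\<^sup>2 / (6 * M)"
    proof (intro allI impI)
      fix x assume "\<bar>x\<bar> \<le> \<alpha>"
      have "?G \<alpha> \<beta> \<gamma> x = a * (\<beta>\<^sup>2 - x\<^sup>2) - b * (\<alpha>\<^sup>2 - x\<^sup>2)"
        using form(1)[OF \<open>\<bar>x\<bar> \<le> \<alpha>\<close>] by (simp add: pG)
      also have "\<dots> = (- b) * \<alpha>\<^sup>2 + a * \<beta>\<^sup>2 - (a - b) * x\<^sup>2"
        by (simp add: algebra_simps)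
      finally show "?G \<alpha> \<beta> \<gamma> x = (M - R) / (6 * M) * \<alpha>\<^sup>2 + (1 + R - M) / (6 * M) * \<beta>\<^sup>2 - x\<^sup>2 / (6 * M)"
        unfolding ab bb by (simp add: a_def)
    qed
    show "\<forall>x. \<alpha> \<le> \<bar>x\<bar> \<and> \<bar>x\<bar> \<le> \<beta> \<longrightarrow> ?G \<alpha> \<beta> \<gamma> x = (1 + R - M) / (6 * M) * (\<beta>\<^sup>2 - x\<^sup>2)"
      using form(2) by (simp add: pG a_def)
  qed
  then show ?thesis
    using that sol[OF s] by blast
qed

text \<open>With \<alpha> = 0 the mass of \<open>F\<close> fixes \<beta> and the sum of the two mass
  conditions fixes \<gamma>. The quadratic equation for the radii gives way to the inequality
  \<open>above\<close>, which says that \<open>G\<close> is positive at 0.\<close>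

lemma regular_inner_F_one_hump:
  assumes par: "R > 0" "M > 0" "\<eta> > 0" and "R < M" and ord: "0 < \<beta>" "\<beta> \<le> \<gamma>"
    and cubes: "\<beta> ^ 3 = 9 * \<eta>\<^sup>2 * M / (2 * (M - R))" "\<gamma> ^ 3 = 9 * M / 2 * (1 + \<eta>\<^sup>2)"
    and above: "(M - R) * \<beta>\<^sup>2 < \<gamma>\<^sup>2"
  defines "F \<equiv> F_inner R M \<eta> 0 \<beta> \<gamma>" and "G \<equiv> G_outer R M 0 \<beta> \<gamma>"
  shows "regular_solution R M \<eta> F G" "positivity_set F = {-\<beta><..<\<beta>}" "positivity_set G = {-\<gamma><..<\<gamma>}"
    and "\<bar>x\<bar> \<le> \<beta> \<Longrightarrow> \<eta>\<^sup>2 * F x = (M - R) / (6 * M) * (\<beta>\<^sup>2 - x\<^sup>2)"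
    and "\<bar>x\<bar> \<le> \<beta> \<Longrightarrow> G x = 1 / (6 * M) * (\<gamma>\<^sup>2 - x\<^sup>2) - (M - R) / (6 * M) * (\<beta>\<^sup>2 - x\<^sup>2)"
    and "\<beta> \<le> \<bar>x\<bar> \<Longrightarrow> \<bar>x\<bar> \<le> \<gamma> \<Longrightarrow> G x = 1 / (6 * M) * (\<gamma>\<^sup>2 - x\<^sup>2)"
proof -
  define a where "a = (M - R) / (6 * M)"
  define b where "b = R * (M - R - 1) / (6 * M * (1 + R))"
  define c where "c = 1 / (6 * M)"
  define e where "e = (M - R - 1) / (6 * M)"
  have pF: "F x = caps (- b) 0 a \<beta> 0 \<gamma> x / \<eta>\<^sup>2" for x
    by (simp add: F_def F_inner_scale a_def b_def)
  have pG: "G = caps e 0 (- a) \<beta> c \<gamma>"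
    by (simp add: G_def G_outer_def a_def c_def e_def)
  have coef: "0 < a" "0 < c"
    using par \<open>R < M\<close> by (simp_all add: a_def c_def)
  have "a * \<beta>\<^sup>2 < c * \<gamma>\<^sup>2"
    using above par by (simp add: a_def c_def divide_strict_right_mono)
  note profp = one_hump_profile(1,2,5)[where b = b, OF ord coef this]
    and profq = one_hump_profile(3,4,6,7)[where e = e, OF ord coef this]
  have F: "F x > 0 \<longleftrightarrow> \<bar>x\<bar> < \<beta>" "F x \<ge> 0" for x
    using profp(1,2)[of x] par by (simp_all add: pF zero_less_divide_iff)
  have G: "G x > 0 \<longleftrightarrow> \<bar>x\<bar> < \<gamma>" "G x \<ge> 0" for x
    using profq(1,2)[of x] by (simp_all add: pG)
  have mass: "a * \<beta> ^ 3 = 3 / 4 * \<eta>\<^sup>2" "c * \<gamma> ^ 3 = 3 / 4 * (1 + \<eta>\<^sup>2)"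
  proof -
    have "N / (6 * M) * (9 * \<eta>\<^sup>2 * M / (2 * N)) = 3 / 4 * \<eta>\<^sup>2" if "N \<noteq> 0" for N
      using par that by simp
    from this[of "M - R"] show "a * \<beta> ^ 3 = 3 / 4 * \<eta>\<^sup>2"
      using \<open>R < M\<close> by (simp add: cubes a_def)
    show "c * \<gamma> ^ 3 = 3 / 4 * (1 + \<eta>\<^sup>2)"
      using par by (simp add: cubes c_def)
  qed
  show "regular_solution R M \<eta> F G"
    unfolding F_def G_def
  proof (rule regular_inner_F[OF par])
    show "(M - R) / (6 * M) * \<beta> ^ 3 - R * (M - R - 1) / (6 * M * (1 + R)) * 0 ^ 3 = 3 / 4 * \<eta>\<^sup>2"
      using mass(1) by (simp add: a_def)
    show "1 / (6 * M) * \<gamma> ^ 3 - (M - R) / (6 * M) * \<beta> ^ 3 + (M - R - 1) / (6 * M) * 0 ^ 3 = 3 / 4"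
    proof -
      have "c * \<gamma> ^ 3 - a * \<beta> ^ 3 = 3 / 4"
        unfolding mass by (simp add: algebra_simps)
      then show ?thesis
        by (simp add: a_def c_def)
    qed
  qed (use ord F G in \<open>simp_all add: F_def G_def\<close>)
  show "positivity_set F = {-\<beta><..<\<beta>}"
    using F(1) by (rule positivity_set_interval)
  show "positivity_set G = {-\<gamma><..<\<gamma>}"
    using G(1) by (rule positivity_set_interval)
  show "\<bar>x\<bar> \<le> \<beta> \<Longrightarrow> \<eta>\<^sup>2 * F x = (M - R) / (6 * M) * (\<beta>\<^sup>2 - x\<^sup>2)"
    using profp(3)[of x] par by (simp add: pF a_def)
  show "\<bar>x\<bar> \<le> \<beta> \<Longrightarrow> G x = 1 / (6 * M) * (\<gamma>\<^sup>2 - x\<^sup>2) - (M - R) / (6 * M) * (\<beta>\<^sup>2 - x\<^sup>2)"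
    using profq(3)[of x] by (simp add: pG a_def c_def)
  show "\<beta> \<le> \<bar>x\<bar> \<Longrightarrow> \<bar>x\<bar> \<le> \<gamma> \<Longrightarrow> G x = 1 / (6 * M) * (\<gamma>\<^sup>2 - x\<^sup>2)"
    using profq(4)[of x] by (simp add: pG c_def)
qed

text \<open>At this threshold the values prescribed for \<beta>^3 and \<gamma>^3 coincide, so the
  annulus on which \<open>G\<close> would be alone is empty.\<close>

lemma profile_i_solution:
  assumes par: "R > 0" "M > 0" "\<eta> > 0" and M: "M = R\<mu>_zero R \<eta>"
  obtains F G where "regular_solution R M \<eta> F G" "profile_i R M \<eta> F G"
proof -
  have \<eta>: "0 < 1 + \<eta>\<^sup>2"
    by (simp add: add_pos_nonneg)
  have K: "M - R = \<eta>\<^sup>2 / (1 + \<eta>\<^sup>2)"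
    using M by (simp add: R\<mu>_zero_def)
  have K01: "0 < M - R" "M - R < 1" and MR: "R < M"
    using \<eta> par unfolding K by (simp_all, use K \<eta> par in \<open>simp add: algebra_simps\<close>)
  define k where "k = 9 * \<eta>\<^sup>2 * M / (2 * (M - R))"
  have k: "k = 9 * M / 2 * (1 + \<eta>\<^sup>2)" "0 < k"
    using par \<eta> by (simp_all add: k_def K)
  define \<beta> where "\<beta> = root 3 k"
  have \<beta>: "0 < \<beta>" "\<beta> ^ 3 = k"
    using cube_eq_iff_root[OF k(2), of \<beta>] by (simp_all add: \<beta>_def)
  have above: "(M - R) * \<beta>\<^sup>2 < \<beta>\<^sup>2"
    using K01 \<beta> by simp
  note sol = regular_inner_F_one_hump[OF par MR \<beta>(1) order_refl \<beta>(2)[unfolded k_def] \<beta>(2)[unfolded k(1)] above]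
  let ?F = "F_inner R M \<eta> 0 \<beta> \<beta>" and ?G = "G_outer R M 0 \<beta> \<beta>"
  have "profile_i R M \<eta> ?F ?G"
    unfolding profile_i_def
  proof (intro exI conjI ballI allI)
    show "(0 < b \<and> b ^ 3 = 9 * \<eta>\<^sup>2 * M / (2 * (M - R))) = (b = \<beta>)" for b
      using cube_eq_iff_root[OF k(2), of b] by (simp add: k_def \<beta>_def)
    fix x assume "x \<in> {-\<beta><..<\<beta>}"
    then have x: "\<bar>x\<bar> \<le> \<beta>" by auto
    have "\<eta>\<^sup>2 * ?F x / \<eta>\<^sup>2 = (M - R) / (6 * M) * (\<beta>\<^sup>2 - x\<^sup>2) / \<eta>\<^sup>2"
      using sol(4)[OF x] by simp
    then show "?F x = (M - R) / (6 * \<eta>\<^sup>2 * M) * (\<beta>\<^sup>2 - x\<^sup>2)"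
      using par by (simp add: mult_ac)
    have "?G x = (1 - (M - R)) / (6 * M) * (\<beta>\<^sup>2 - x\<^sup>2)"
      using sol(5)[OF x] by (simp add: diff_divide_distrib left_diff_distrib)
    \<comment> \<open>Both sides equal \<open>1 / (1 + \<eta>\<^sup>2)\<close>, which is why
      \<open>F\<close> and \<open>G\<close> coincide.\<close>
    also have "1 - (M - R) = (M - R) / \<eta>\<^sup>2"
    proof -
      have "1 - t / (1 + t) = t / (1 + t) / t" if "0 < t" for t :: real
      proof -
        have "1 - t / (1 + t) = 1 / (1 + t)"
          using that by (simp add: field_simps)
        then show ?thesis
          using that by simp
      qed
      from this[of "\<eta>\<^sup>2"] par show ?thesis
        unfolding K by simp
    qed
    finally show "?G x = (M - R) / (6 * \<eta>\<^sup>2 * M) * (\<beta>\<^sup>2 - x\<^sup>2)"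
      by (simp add: mult_ac)
  qed (rule sol)+
  then show ?thesis
    using that sol(1) by blast
qed

text \<open>The prescribed cubes have ratio \<open>(M - R) * \<rho>\<close>. The lower threshold
  says that this exceeds 1, hence \<beta> < \<gamma>; the upper one is
  \<open>M - R < \<rho>\<^sup>2\<close>, which \<open>square_less_if_cube_ratio\<close> converts
  into positivity of \<open>G\<close> at 0.\<close>

lemma profile_ii_solution:
  assumes par: "R > 0" "M > 0" "\<eta> > 0" and M: "R\<mu>_zero R \<eta> < M" "M < R\<mu>_plus R \<eta>"
  obtains F G where "regular_solution R M \<eta> F G" "profile_ii R M \<eta> F G"
proof -
  have \<eta>: "0 < 1 + \<eta>\<^sup>2"
    by (simp add: add_pos_nonneg)
  define \<rho> where "\<rho> = (1 + \<eta>\<^sup>2) / \<eta>\<^sup>2"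
  have \<rho>: "0 < \<rho>"
    using par \<eta> by (simp add: \<rho>_def)
  have K: "\<eta>\<^sup>2 / (1 + \<eta>\<^sup>2) < M - R" "M - R < \<rho>\<^sup>2"
    using M by (simp_all add: R\<mu>_zero_def R\<mu>_plus_def \<rho>_def)
  have "0 < \<eta>\<^sup>2 / (1 + \<eta>\<^sup>2)"
    using par \<eta> by simp
  with K have K0: "0 < M - R" and MR: "R < M"
    by linarith+
  define k where "k = 9 * \<eta>\<^sup>2 * M / (2 * (M - R))"
  define l where "l = 9 * M / 2 * (1 + \<eta>\<^sup>2)"
  have k0: "0 < k"
    using par K0 by (simp add: k_def)
  have l: "l = k * ((M - R) * \<rho>)"
  proof -
    have "l = 9 * \<eta>\<^sup>2 * M / (2 * N) * (N * \<rho>)" if "N \<noteq> 0" for N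
      using par that by (simp add: l_def \<rho>_def)
    from this[of "M - R"] K0 show ?thesis
      by (simp add: k_def)
  qed
  have "1 < (M - R) * \<rho>"
    using K(1) \<eta> par by (simp add: \<rho>_def field_simps)
  then have kl: "k < l"
    using k0 unfolding l by simp
  define \<beta> \<gamma> where "\<beta> = root 3 k" and "\<gamma> = root 3 l"
  have \<beta>\<gamma>: "0 < \<beta>" "\<beta> < \<gamma>" "\<beta> ^ 3 = k" "\<gamma> ^ 3 = l"
    using cubes_eq_iff_roots[OF k0 kl, of \<beta> \<gamma>] by (simp_all add: \<beta>_def \<gamma>_def)
  have above: "(M - R) * \<beta>\<^sup>2 < \<gamma>\<^sup>2"
    using \<beta>\<gamma> K K0 \<rho> l by (intro square_less_if_cube_ratio[of \<beta> \<gamma> _ \<rho>]) auto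
  note sol = regular_inner_F_one_hump[OF par MR \<beta>\<gamma>(1) less_imp_le[OF \<beta>\<gamma>(2)] \<beta>\<gamma>(3)[unfolded k_def]
      \<beta>\<gamma>(4)[unfolded l_def] above]
  let ?F = "F_inner R M \<eta> 0 \<beta> \<gamma>" and ?G = "G_outer R M 0 \<beta> \<gamma>"
  have "profile_ii R M \<eta> ?F ?G"
    unfolding profile_ii_def
  proof (intro exI conjI allI impI)
    show "(0 < b \<and> b < c \<and> b ^ 3 = 9 * \<eta>\<^sup>2 * M / (2 * (M - R)) \<and> c ^ 3 = 9 * M / 2 * (1 + \<eta>\<^sup>2))
        = (b = \<beta> \<and> c = \<gamma>)" for b c
      using cubes_eq_iff_roots[OF k0 kl, of b c] by (simp add: k_def l_def \<beta>_def \<gamma>_def)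
    show "?G x = \<gamma>\<^sup>2 / (6 * M) + (R - M) / (6 * M) * \<beta>\<^sup>2 - (1 + R - M) / (6 * M) * x\<^sup>2" if "\<bar>x\<bar> \<le> \<beta>" for x
      unfolding sol(5)[OF that] using par by (simp add: field_simps)
  qed (use sol in auto)
  then show ?thesis
    using that sol(1) by blast
qed

text \<open>The prescribed cubes have ratio \<open>K * \<rho>\<close>. The upper threshold,
  equivalent to \<open>M * (1 + \<eta>\<^sup>2) < X\<close>, makes it exceed 1; the lower one is
  \<open>K < \<rho>\<^sup>2\<close>, which makes \<open>F\<close> positive at 0.\<close>

lemma profile_v_solution:
  assumes par: "R > 0" "M > 0" "\<eta> > 0" and M: "R\<mu>_minus R \<eta> < M" "M < R\<mu>_zero R \<eta>"
  obtains F G where "regular_solution R M \<eta> F G" "profile_v R M \<eta> F G"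
proof -
  have \<eta>: "0 < 1 + \<eta>\<^sup>2"
    by (simp add: add_pos_nonneg)
  define X where "X = (1 + R) * \<eta>\<^sup>2 + R"
  define \<rho> where "\<rho> = X / R"
  define K where "K = R * (1 + R - M) / M"
  have X: "0 < X"
    using par by (simp add: X_def add_pos_pos)
  then have \<rho>: "0 < \<rho>"
    using par by (simp add: \<rho>_def)
  have zero: "M * (1 + \<eta>\<^sup>2) < X"
    using M(2) \<eta> par by (simp add: R\<mu>_zero_def X_def field_simps)
  have "\<eta>\<^sup>2 / (1 + \<eta>\<^sup>2) < 1"
    using \<eta> by simp
  then have MR: "0 < 1 + R - M"
    using M(2) by (simp add: R\<mu>_zero_def)
  then have K0: "0 < K"
    using par by (simp add: K_def)
  have "0 < R ^ 3 + X\<^sup>2"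
    using par by (intro add_pos_nonneg) auto
  then have "R ^ 3 * (1 + R) < M * (R ^ 3 + X\<^sup>2)"
    using M(1) by (simp add: R\<mu>_minus_def X_def pos_divide_less_eq mult.commute)
  then have "R\<^sup>2 * (R * (1 + R - M)) < M * X\<^sup>2"
    by (simp add: algebra_simps power2_eq_square power3_eq_cube)
  then have K\<rho>: "K < \<rho>\<^sup>2"
    using par by (simp add: \<rho>_def K_def power_divide divide_simps mult.commute)
  define a where "a = (1 + R - M) / (6 * M)"
  define b where "b = (R - M) / (6 * M)"
  define c where "c = 1 / (6 * (1 + R))"
  define d where "d = R * (1 + R - M) / (6 * (1 + R) * M)"
  have coef: "0 < a" "0 < c"
    using par MR by (simp_all add: a_def c_def)
  have dc: "d = c * K"
    using par by (simp add: c_def d_def K_def)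
  define k where "k = 9 / 2 * (M / (1 + R - M))"
  define l where "l = 9 / 2 * X"
  have k0: "0 < k"
    using par MR by (simp add: k_def)
  have l: "l = k * (K * \<rho>)"
  proof -
    have "l = 9 / 2 * (M / N) * (R * N / M * \<rho>)" if "N \<noteq> 0" for N
      using par that by (simp add: l_def \<rho>_def)
    from this[of "1 + R - M"] MR show ?thesis
      by (simp add: k_def K_def)
  qed
  have "M * (1 + \<eta>\<^sup>2) * (1 + R) < X * (1 + R)"
    using zero par by simp
  moreover have "M * (1 + \<eta>\<^sup>2) * (1 + R) = M + M * X"
    by (simp add: X_def algebra_simps)
  ultimately have "M < X * (1 + R - M)"
    by (simp add: algebra_simps)
  then have "M / (1 + R - M) < X"
    using MR by (simp add: pos_divide_less_eq)
  then have kl: "k < l"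
    unfolding k_def l_def by (rule mult_strict_left_mono) simp
  define \<beta> \<gamma> where "\<beta> = root 3 k" and "\<gamma> = root 3 l"
  have \<beta>\<gamma>: "0 < \<beta>" "\<beta> < \<gamma>" "\<beta> ^ 3 = k" "\<gamma> ^ 3 = l"
    using cubes_eq_iff_roots[OF k0 kl, of \<beta> \<gamma>] by (simp_all add: \<beta>_def \<gamma>_def)
  have "K * \<beta>\<^sup>2 < \<gamma>\<^sup>2"
    using \<beta>\<gamma> K\<rho> K0 \<rho> l by (intro square_less_if_cube_ratio[of \<beta> \<gamma> _ \<rho>]) auto
  then have "d * \<beta>\<^sup>2 < c * \<gamma>\<^sup>2"
    using coef unfolding dc by simp
  note profp = one_hump_profile(1,2,5)[where b = b, OF \<beta>\<gamma>(1) less_imp_le[OF \<beta>\<gamma>(2)] coef this]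
    and profq = one_hump_profile(3,4,6,7)[where e = b, OF \<beta>\<gamma>(1) less_imp_le[OF \<beta>\<gamma>(2)] coef this]
  let ?F = "F_outer R M \<eta> 0 \<beta> \<gamma>" and ?G = "G_inner R M 0 \<beta> \<gamma>"
  have pF: "?F x = caps b 0 (- d) \<beta> c \<gamma> x / \<eta>\<^sup>2" for x
    by (simp add: F_outer_scale b_def c_def d_def)
  have pG: "?G = caps (- b) 0 a \<beta> 0 \<gamma>"
    by (simp add: G_inner_def a_def b_def)
  have G: "?G x > 0 \<longleftrightarrow> \<bar>x\<bar> < \<beta>" "?G x \<ge> 0" for x
    using profp(1,2)[of x] by (simp_all add: pG)
  have F: "?F x > 0 \<longleftrightarrow> \<bar>x\<bar> < \<gamma>" "?F x \<ge> 0" for x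
    using profq(1,2)[of x] par by (simp_all add: pF zero_less_divide_iff)
  have sol: "regular_solution R M \<eta> ?F ?G"
  proof (rule regular_inner_G[OF par])
    show "(1 + R - M) / (6 * M) * \<beta> ^ 3 - (R - M) / (6 * M) * 0 ^ 3 = 3 / 4"
    proof -
      have "N / (6 * M) * (9 / 2 * (M / N)) = 3 / 4" if "N \<noteq> 0" for N
        using par that by simp
      from this[of "1 + R - M"] MR show ?thesis
        by (simp add: \<beta>\<gamma>(3) k_def)
    qed
    have "d * \<beta> ^ 3 = 3 / 4 * (R / (1 + R))" "c * \<gamma> ^ 3 = 3 / 4 * (X / (1 + R))"
    proof -
      have "R * N / (6 * S * M) * (9 / 2 * (M / N)) = 3 / 4 * (R / S)" if "N \<noteq> 0" "S \<noteq> 0" for N S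
        using par that by simp
      from this[of "1 + R - M" "1 + R"] par MR show "d * \<beta> ^ 3 = 3 / 4 * (R / (1 + R))"
        unfolding \<beta>\<gamma>(3) k_def d_def by simp
      show "c * \<gamma> ^ 3 = 3 / 4 * (X / (1 + R))"
        unfolding \<beta>\<gamma>(4) l_def c_def using par by (simp add: field_simps)
    qed
    moreover have "X / (1 + R) - R / (1 + R) = \<eta>\<^sup>2"
      using par by (simp add: X_def diff_divide_distrib[symmetric])
    ultimately have "c * \<gamma> ^ 3 - d * \<beta> ^ 3 = 3 / 4 * \<eta>\<^sup>2"
      by linarith
    then show "1 / (6 * (1 + R)) * \<gamma> ^ 3 - R * (1 + R - M) / (6 * (1 + R) * M) * \<beta> ^ 3 + (R - M) / (6 * M) * 0 ^ 3
        = 3 / 4 * \<eta>\<^sup>2"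
      by (simp add: c_def d_def)
  qed (use \<beta>\<gamma> F G in simp_all)
  have "profile_v R M \<eta> ?F ?G"
    unfolding profile_v_def
  proof (intro exI conjI allI impI)
    show "(0 < b \<and> b < c \<and> b ^ 3 = 9 / 2 * (M / (1 + R - M)) \<and> c ^ 3 = 9 / 2 * ((1 + R) * \<eta>\<^sup>2 + R))
        = (b = \<beta> \<and> c = \<gamma>)" for b c
      using cubes_eq_iff_roots[OF k0 kl, of b c] by (simp add: k_def l_def X_def \<beta>_def \<gamma>_def)
    show "positivity_set ?F = {-\<gamma><..<\<gamma>}"
      using F(1) by (rule positivity_set_interval)
    show "positivity_set ?G = {-\<beta><..<\<beta>}"
      using G(1) by (rule positivity_set_interval)
    show "\<eta>\<^sup>2 * ?F x = \<gamma>\<^sup>2 / (6 * (1 + R)) - R * (1 + R - M) / (6 * (1 + R) * M) * \<beta>\<^sup>2 - (M - R) / (6 * M) * x\<^sup>2"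
      if "\<bar>x\<bar> \<le> \<beta>" for x
    proof -
      have "\<eta>\<^sup>2 * ?F x = c * (\<gamma>\<^sup>2 - x\<^sup>2) - d * (\<beta>\<^sup>2 - x\<^sup>2)"
        using profq(3)[OF that] par by (simp add: pF)
      also have "\<dots> = c * \<gamma>\<^sup>2 - d * \<beta>\<^sup>2 - (c - d) * x\<^sup>2"
        by (simp add: algebra_simps)
      also have "c - d = (M - R) / (6 * M)"
        using par by (simp add: c_def d_def divide_simps) (simp add: algebra_simps)
      finally show ?thesis
        by (simp add: c_def d_def)
    qed
    show "\<eta>\<^sup>2 * ?F x = 1 / (6 * (1 + R)) * (\<gamma>\<^sup>2 - x\<^sup>2)" if "\<beta> \<le> \<bar>x\<bar> \<and> \<bar>x\<bar> \<le> \<gamma>" for x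
      using profq(4)[of x] that par by (simp add: pF c_def)
    show "?G x = (1 + R - M) / (6 * M) * (\<beta>\<^sup>2 - x\<^sup>2)" if "\<bar>x\<bar> \<le> \<beta>" for x
      using profp(3)[OF that] by (simp add: pG a_def)
  qed
  then show ?thesis
    using that sol by blast
qed

text \<open>The value \<open>R\<close> separates the lower two thresholds and \<open>R + 1\<close>
  the upper two, so the five regimes are disjoint and exhaust the positive parameters.\<close>

lemma thresholds_ordered:
  assumes "R > 0" "\<eta> > 0"
  shows "R\<mu>_minus R \<eta> < R\<mu>_zero R \<eta>" "R\<mu>_zero R \<eta> < R\<mu>_plus R \<eta>"
proof -
  have \<eta>: "0 < 1 + \<eta>\<^sup>2"
    by (simp add: add_pos_nonneg)
  define X where "X = \<eta>\<^sup>2 * (1 + R) + R"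
  have "R\<^sup>2 < X\<^sup>2"
    using assms by (intro sq_less) (simp_all add: X_def)
  then have "R * R\<^sup>2 < R * X\<^sup>2"
    using assms by simp
  then have "R ^ 3 * (1 + R) < R * (R ^ 3 + X\<^sup>2)"
    by (simp add: algebra_simps power2_eq_square power3_eq_cube)
  moreover have "0 < R ^ 3 + X\<^sup>2"
    using assms by (intro add_pos_nonneg) auto
  ultimately have "R\<mu>_minus R \<eta> < R"
    by (simp add: R\<mu>_minus_def X_def[symmetric] pos_divide_less_eq)
  also have "R < R\<mu>_zero R \<eta>"
    using assms \<eta> by (simp add: R\<mu>_zero_def)
  finally show "R\<mu>_minus R \<eta> < R\<mu>_zero R \<eta>" .
  have "\<eta>\<^sup>2 / (1 + \<eta>\<^sup>2) < 1"
    using \<eta> by simp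
  moreover have "1 < (1 + \<eta>\<^sup>2) / \<eta>\<^sup>2"
    using assms by simp
  then have "1 < ((1 + \<eta>\<^sup>2) / \<eta>\<^sup>2)\<^sup>2"
    by (simp add: one_less_power)
  ultimately show "R\<mu>_zero R \<eta> < R\<mu>_plus R \<eta>"
    by (simp add: R\<mu>_zero_def R\<mu>_plus_def)
qed

theorem proposition3p3:
  fixes R R\<^sub>\<mu> \<eta> :: real
  assumes "R > 0" and "R\<^sub>\<mu> > 0" and "\<eta> > 0"
  shows "\<exists>F G.
    even_SS_solution R R\<^sub>\<mu> \<eta> F G \<and>
    (\<forall>F' G'. even_SS_solution R R\<^sub>\<mu> \<eta> F' G' \<longrightarrow>
       (AE x in lebesgue. F' x = F x) \<and> (AE x in lebesgue. G' x = G x)) \<and>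
    continuous_on UNIV F \<and> continuous_on UNIV G \<and>
    (\<forall>x. x \<notin> positivity_set F \<longrightarrow> F x = 0) \<and>
    (\<forall>x. x \<notin> positivity_set G \<longrightarrow> G x = 0) \<and>

    (R\<^sub>\<mu> = R\<mu>_zero R \<eta> \<longrightarrow>
      (\<exists>\<beta>. (\<forall>b. (0 < b \<and> b ^ 3 = 9 * \<eta>\<^sup>2 * R\<^sub>\<mu> / (2 * (R\<^sub>\<mu> - R))) \<longleftrightarrow> b = \<beta>) \<and>
        positivity_set F = {-\<beta><..<\<beta>} \<and> positivity_set G = {-\<beta><..<\<beta>} \<and>
        (\<forall>x \<in> {-\<beta><..<\<beta>}.
           F x = (R\<^sub>\<mu> - R) / (6 * \<eta>\<^sup>2 * R\<^sub>\<mu>) * (\<beta>\<^sup>2 - x\<^sup>2) \<and>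
           G x = (R\<^sub>\<mu> - R) / (6 * \<eta>\<^sup>2 * R\<^sub>\<mu>) * (\<beta>\<^sup>2 - x\<^sup>2)))) \<and>

    (R\<^sub>\<mu> \<in> {R\<mu>_zero R \<eta> <..< R\<mu>_plus R \<eta>} \<longrightarrow>
      (\<exists>\<beta> \<gamma>. (\<forall>b c. (0 < b \<and> b < c \<and>
                  b ^ 3 = 9 * \<eta>\<^sup>2 * R\<^sub>\<mu> / (2 * (R\<^sub>\<mu> - R)) \<and>
                  c ^ 3 = 9 * R\<^sub>\<mu> / 2 * (1 + \<eta>\<^sup>2)) \<longleftrightarrow> b = \<beta> \<and> c = \<gamma>) \<and>
        positivity_set F = {-\<beta><..<\<beta>} \<and> positivity_set G = {-\<gamma><..<\<gamma>} \<and>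
        (\<forall>x. \<bar>x\<bar> \<le> \<beta> \<longrightarrow> \<eta>\<^sup>2 * F x = (R\<^sub>\<mu> - R) / (6 * R\<^sub>\<mu>) * (\<beta>\<^sup>2 - x\<^sup>2)) \<and>
        (\<forall>x. \<bar>x\<bar> \<le> \<beta> \<longrightarrow>
           G x = \<gamma>\<^sup>2 / (6 * R\<^sub>\<mu>) + (R - R\<^sub>\<mu>) / (6 * R\<^sub>\<mu>) * \<beta>\<^sup>2
                 - (1 + R - R\<^sub>\<mu>) / (6 * R\<^sub>\<mu>) * x\<^sup>2) \<and>
        (\<forall>x. \<beta> \<le> \<bar>x\<bar> \<and> \<bar>x\<bar> \<le> \<gamma> \<longrightarrow> G x = 1 / (6 * R\<^sub>\<mu>) * (\<gamma>\<^sup>2 - x\<^sup>2)))) \<and>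

    (R\<^sub>\<mu> \<ge> R\<mu>_plus R \<eta> \<longrightarrow>
      (\<exists>\<alpha> \<beta> \<gamma>. (\<forall>a b c. (0 \<le> a \<and> a < b \<and> b < c \<and>
                  (R\<^sub>\<mu> - R) * b ^ 3 - R * (R\<^sub>\<mu> - R - 1) / (1 + R) * a ^ 3 = 9 * \<eta>\<^sup>2 * R\<^sub>\<mu> / 2 \<and>
                  c ^ 3 - (R\<^sub>\<mu> - R) * b ^ 3 + (R\<^sub>\<mu> - R - 1) * a ^ 3 = 9 * R\<^sub>\<mu> / 2 \<and>
                  c\<^sup>2 - (R\<^sub>\<mu> - R) * b\<^sup>2 + (R\<^sub>\<mu> - R - 1) * a\<^sup>2 = 0)
                \<longleftrightarrow> a = \<alpha> \<and> b = \<beta> \<and> c = \<gamma>) \<and>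
        positivity_set F = {-\<beta><..<\<beta>} \<and>
        positivity_set G = {-\<gamma><..<-\<alpha>} \<union> {\<alpha><..<\<gamma>} \<and>
        (\<forall>x. \<bar>x\<bar> \<le> \<alpha> \<longrightarrow>
           \<eta>\<^sup>2 * F x = (R\<^sub>\<mu> - R) / (6 * R\<^sub>\<mu>) * \<beta>\<^sup>2
                      + R * (1 + R - R\<^sub>\<mu>) / (6 * R\<^sub>\<mu> * (1 + R)) * \<alpha>\<^sup>2 - x\<^sup>2 / (6 * (1 + R))) \<and>
        (\<forall>x. \<alpha> \<le> \<bar>x\<bar> \<and> \<bar>x\<bar> \<le> \<beta> \<longrightarrow>
           \<eta>\<^sup>2 * F x = (R\<^sub>\<mu> - R) / (6 * R\<^sub>\<mu>) * (\<beta>\<^sup>2 - x\<^sup>2)) \<and>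
        (\<forall>x. \<alpha> \<le> \<bar>x\<bar> \<and> \<bar>x\<bar> \<le> \<beta> \<longrightarrow>
           G x = (1 + R - R\<^sub>\<mu>) / (6 * R\<^sub>\<mu>) * (\<alpha>\<^sup>2 - x\<^sup>2)) \<and>
        (\<forall>x. \<beta> \<le> \<bar>x\<bar> \<and> \<bar>x\<bar> \<le> \<gamma> \<longrightarrow> G x = 1 / (6 * R\<^sub>\<mu>) * (\<gamma>\<^sup>2 - x\<^sup>2)))) \<and>

    (R\<^sub>\<mu> \<le> R\<mu>_minus R \<eta> \<longrightarrow>
      (\<exists>\<alpha> \<beta> \<gamma>. (\<forall>a b c. (0 \<le> a \<and> a < b \<and> b < c \<and>
                  (1 + R - R\<^sub>\<mu>) * b ^ 3 - (R - R\<^sub>\<mu>) * a ^ 3 = 9 * R\<^sub>\<mu> / 2 \<and>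
                  R\<^sub>\<mu> * c ^ 3 - R * (1 + R - R\<^sub>\<mu>) * b ^ 3 + (1 + R) * (R - R\<^sub>\<mu>) * a ^ 3
                    = 9 / 2 * R\<^sub>\<mu> * (1 + R) * \<eta>\<^sup>2 \<and>
                  R\<^sub>\<mu> * c\<^sup>2 - R * (1 + R - R\<^sub>\<mu>) * b\<^sup>2 + (1 + R) * (R - R\<^sub>\<mu>) * a\<^sup>2 = 0)
                \<longleftrightarrow> a = \<alpha> \<and> b = \<beta> \<and> c = \<gamma>) \<and>
        positivity_set F = {-\<gamma><..<-\<alpha>} \<union> {\<alpha><..<\<gamma>} \<and>
        positivity_set G = {-\<beta><..<\<beta>} \<and>
        (\<forall>x. \<alpha> \<le> \<bar>x\<bar> \<and> \<bar>x\<bar> \<le> \<beta> \<longrightarrow>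
           \<eta>\<^sup>2 * F x = (R\<^sub>\<mu> - R) / (6 * R\<^sub>\<mu>) * (\<alpha>\<^sup>2 - x\<^sup>2)) \<and>
        (\<forall>x. \<beta> \<le> \<bar>x\<bar> \<and> \<bar>x\<bar> \<le> \<gamma> \<longrightarrow> \<eta>\<^sup>2 * F x = 1 / (6 * (1 + R)) * (\<gamma>\<^sup>2 - x\<^sup>2)) \<and>
        (\<forall>x. \<bar>x\<bar> \<le> \<alpha> \<longrightarrow>
           G x = (R\<^sub>\<mu> - R) / (6 * R\<^sub>\<mu>) * \<alpha>\<^sup>2 + (1 + R - R\<^sub>\<mu>) / (6 * R\<^sub>\<mu>) * \<beta>\<^sup>2
                 - x\<^sup>2 / (6 * R\<^sub>\<mu>)) \<and>
        (\<forall>x. \<alpha> \<le> \<bar>x\<bar> \<and> \<bar>x\<bar> \<le> \<beta> \<longrightarrow>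
           G x = (1 + R - R\<^sub>\<mu>) / (6 * R\<^sub>\<mu>) * (\<beta>\<^sup>2 - x\<^sup>2)))) \<and>

    (R\<^sub>\<mu> \<in> {R\<mu>_minus R \<eta> <..< R\<mu>_zero R \<eta>} \<longrightarrow>
      (\<exists>\<beta> \<gamma>. (\<forall>b c. (0 < b \<and> b < c \<and>
                  b ^ 3 = 9 / 2 * (R\<^sub>\<mu> / (1 + R - R\<^sub>\<mu>)) \<and>
                  c ^ 3 = 9 / 2 * ((1 + R) * \<eta>\<^sup>2 + R)) \<longleftrightarrow> b = \<beta> \<and> c = \<gamma>) \<and>
        positivity_set F = {-\<gamma><..<\<gamma>} \<and> positivity_set G = {-\<beta><..<\<beta>} \<and>
        (\<forall>x. \<bar>x\<bar> \<le> \<beta> \<longrightarrow>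
           \<eta>\<^sup>2 * F x = \<gamma>\<^sup>2 / (6 * (1 + R))
                      - R * (1 + R - R\<^sub>\<mu>) / (6 * (1 + R) * R\<^sub>\<mu>) * \<beta>\<^sup>2
                      - (R\<^sub>\<mu> - R) / (6 * R\<^sub>\<mu>) * x\<^sup>2) \<and>
        (\<forall>x. \<beta> \<le> \<bar>x\<bar> \<and> \<bar>x\<bar> \<le> \<gamma> \<longrightarrow> \<eta>\<^sup>2 * F x = 1 / (6 * (1 + R)) * (\<gamma>\<^sup>2 - x\<^sup>2)) \<and>
        (\<forall>x. \<bar>x\<bar> \<le> \<beta> \<longrightarrow> G x = (1 + R - R\<^sub>\<mu>) / (6 * R\<^sub>\<mu>) * (\<beta>\<^sup>2 - x\<^sup>2))))"
proof -
  note par = assms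
  \<comment> \<open>Uniqueness is the same in all regimes. As the thresholds are ordered, exactly
    one of the five implications has a true premise for given parameters.\<close>
  have key: ?thesis
    if sol: "regular_solution R R\<^sub>\<mu> \<eta> F G"
      and "R\<^sub>\<mu> = R\<mu>_zero R \<eta> \<longrightarrow> profile_i R R\<^sub>\<mu> \<eta> F G"
      and "R\<^sub>\<mu> \<in> {R\<mu>_zero R \<eta> <..< R\<mu>_plus R \<eta>} \<longrightarrow> profile_ii R R\<^sub>\<mu> \<eta> F G"
      and "R\<^sub>\<mu> \<ge> R\<mu>_plus R \<eta> \<longrightarrow> profile_iii R R\<^sub>\<mu> \<eta> F G"
      and "R\<^sub>\<mu> \<le> R\<mu>_minus R \<eta> \<longrightarrow> profile_iv R R\<^sub>\<mu> \<eta> F G"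
      and "R\<^sub>\<mu> \<in> {R\<mu>_minus R \<eta> <..< R\<mu>_zero R \<eta>} \<longrightarrow> profile_v R R\<^sub>\<mu> \<eta> F G"
    for F G
  proof (rule exI[of _ F], rule exI[of _ G], intro conjI)
    note reg = sol[unfolded regular_solution_def]
    show "even_SS_solution R R\<^sub>\<mu> \<eta> F G" "continuous_on UNIV F" "continuous_on UNIV G"
      "\<forall>x. x \<notin> positivity_set F \<longrightarrow> F x = 0" "\<forall>x. x \<notin> positivity_set G \<longrightarrow> G x = 0"
      using reg by blast+
    show "\<forall>F' G'. even_SS_solution R R\<^sub>\<mu> \<eta> F' G' \<longrightarrow>
        (AE x in lebesgue. F' x = F x) \<and> (AE x in lebesgue. G' x = G x)"
      using even_SS_solution_unique[OF par _ conjunct1[OF reg]] by blast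
  qed (fact that(2-6)[unfolded profile_i_def profile_ii_def profile_iii_def profile_iv_def profile_v_def])+
  note ord = thresholds_ordered[OF par(1,3)]
  consider "R\<^sub>\<mu> \<le> R\<mu>_minus R \<eta>" | "R\<mu>_minus R \<eta> < R\<^sub>\<mu>" "R\<^sub>\<mu> < R\<mu>_zero R \<eta>" | "R\<^sub>\<mu> = R\<mu>_zero R \<eta>"
    | "R\<mu>_zero R \<eta> < R\<^sub>\<mu>" "R\<^sub>\<mu> < R\<mu>_plus R \<eta>" | "R\<mu>_plus R \<eta> \<le> R\<^sub>\<mu>"
    by linarith
  then show ?thesis
  proof cases
    case 1
    then obtain F G where "regular_solution R R\<^sub>\<mu> \<eta> F G" "profile_iv R R\<^sub>\<mu> \<eta> F G"
      using profile_iv_solution[OF par] by blast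
    then show ?thesis
      by (intro key[of F G]) (use 1 ord in auto)
  next
    case 2
    then obtain F G where "regular_solution R R\<^sub>\<mu> \<eta> F G" "profile_v R R\<^sub>\<mu> \<eta> F G"
      using profile_v_solution[OF par] by blast
    then show ?thesis
      by (intro key[of F G]) (use 2 ord in auto)
  next
    case 3
    then obtain F G where "regular_solution R R\<^sub>\<mu> \<eta> F G" "profile_i R R\<^sub>\<mu> \<eta> F G"
      using profile_i_solution[OF par] by blast
    then show ?thesis
      by (intro key[of F G]) (use 3 ord in auto)
  next
    case 4
    then obtain F G where "regular_solution R R\<^sub>\<mu> \<eta> F G" "profile_ii R R\<^sub>\<mu> \<eta> F G"
      using profile_ii_solution[OF par] by blast
    then show ?thesis
      by (intro key[of F G]) (use 4 ord in auto)
  next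
    case 5
    then obtain F G where "regular_solution R R\<^sub>\<mu> \<eta> F G" "profile_iii R R\<^sub>\<mu> \<eta> F G"
      using profile_iii_solution[OF par] by blast
    then show ?thesis
      by (intro key[of F G]) (use 5 ord in auto)
  qed
qed

end
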